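(* Let $R$ be a subdivision rule acting on a space $X$ and associated to a group $G$. Then the diameter $diam_X(n)$ of $R^n(X)$ is an upper bound for the divergence of $G$, i.e. $div_G(n)\preceq diam_X(n)$. Conversely, if there is a (bi-infinite) geodesic $\gamma$ in the history graph of $\{R^n(X)\}$ realizing $diam_X(n)$, i.e. with $d_{R^n(X)}(\gamma(n),\gamma(-n))=diam_X(n)$ for all $n$, then $diam_X(n)\preceq div_G(n)$.
   Context: A finite subdivision rule $R$ of dimension $m$ consists of: (1) a finite $m$-dimensional CW complex $S$ which is the union of its closed $m$-cells, such that for every closed $m$-cell $\tilde s$ there is a CW structure $s$ on a closed $m$-disk in which any two subcells that intersect do so in a single cell of lower dimension, the subcells of $s$ are contained in $\partial s$, and the characteristic map $\psi_s:s\to S$ onto $\tilde s$ restricts to a homeomorphism onto each open cell; (2) a finite $m$-dimensional complex $R(S)$ that is a subdivision of $S$; (3) a continuous cellular map $\phi_R:R(S)\to S$ restricting to a homeomorphism on each open cell. "Subdivision rule" means finite subdivision rule. An $R$-complex is an $m$-dimensional CW complex $X$, the union of its closed $m$-cells, with a continuous cellular map $f:X\to S$ restricting to a homeomorphism on each open cell; pulling back the structure of $R(S)$ gives the $R$-complex $R(X)$ with map $\phi_R\circ f$, and $R^0(X)=X$, $R^n(X)=R(R^{n-1}(X))$. Some tile types may be designated ideal; ideal tiles subdivide only into ideal tiles. Let $\Gamma_n$ be the dual graph of $R^n(X)$: one vertex for each non-ideal top-dimensional cell, with an edge between two vertices when the cells share a codimension-1 cell. The history graph $\Gamma$ is the disjoint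 union of the $\Gamma_n$, $n\ge 0$, together with an edge from each vertex of $\Gamma_n$ to each vertex of $\Gamma_{n+1}$ whose cell is contained in its subdivision, and an origin vertex joined to all vertices of $\Gamma_0$. The rule $R$ acting on $X$ is associated to $G$ if $\Gamma$ is quasi-isometric to the Cayley graph of $G$. The metric $d_{R^n(X)}$ is the path metric of $\Gamma_n$, and $diam_X(n)$ is the diameter of $\Gamma_n$ (infinite if $\Gamma_n$ is disconnected). For a bi-infinite geodesic $\gamma$ through the origin of $\Gamma$, $\gamma(n)$ and $\gamma(-n)$ denote the vertices of $\Gamma_n$ on its two halves. The divergence of a bi-infinite geodesic $\gamma$ in a metric space $Z$ is the function of $n$ given by the length of the shortest path in $Z\setminus B(\gamma(0),n)$ between $\gamma(-n)$ and $\gamma(n)$. The divergence $div_G$ of a group $G$ is the supremum of the divergences of all geodesics in the Cayley graph of $G$. Write $f(n)\preceq g(n)$ if $f(n)\le g(an+b)+an+b$ for some constants $a,b$. *)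

theory Defs
  imports
    "HOL-Analysis.Analysis"
    "HOL-Algebra.Generated_Groups"
    "HOL-Library.Extended_Nat"
    "HOL-Library.Extended_Real"
begin

section \<open>CW complexes\<close>

definition cdisk :: "nat \<Rightarrow> (nat \<Rightarrow> real) topology" where
  "cdisk k = subtopology (Euclidean_space k) {x. (\<Sum>i<k. (x i)\<^sup>2) \<le> 1}"

definition disk_interior :: "nat \<Rightarrow> (nat \<Rightarrow> real) set" where
  "disk_interior k = {x \<in> topspace (Euclidean_space k). (\<Sum>i<k. (x i)\<^sup>2) < 1}"

definition disk_boundary :: "nat \<Rightarrow> (nat \<Rightarrow> real) set" where
  "disk_boundary k = {x \<in> topspace (Euclidean_space k). (\<Sum>i<k. (x i)\<^sup>2) = 1}"

text \<open>A cell structure assigns to each dimension \<open>k\<close> the set of its open \<open>k\<close>-cells;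
  the closed cells are the closures of the open ones.\<close>

type_synonym 'a cells = "nat \<Rightarrow> 'a set set"

definition all_cells :: "'a cells \<Rightarrow> 'a set set" where
  "all_cells C = (\<Union>k. C k)"

definition skeleton :: "'a cells \<Rightarrow> nat \<Rightarrow> 'a set" where
  "skeleton C k = (\<Union>j\<in>{..k}. \<Union>(C j))"

definition characteristic_map ::
    "'a topology \<Rightarrow> 'a cells \<Rightarrow> nat \<Rightarrow> 'a set \<Rightarrow> ((nat \<Rightarrow> real) \<Rightarrow> 'a) \<Rightarrow> bool" where
  "characteristic_map T C k e \<Phi> \<longleftrightarrow>
     continuous_map (cdisk k) T \<Phi> \<and>
     homeomorphic_map (subtopology (cdisk k) (disk_interior k)) (subtopology T e) \<Phi> \<and>
     \<Phi> ` disk_boundary k \<subseteq> (\<Union>j\<in>{..<k}. \<Union>(C j))"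

definition cw_complex :: "'a topology \<Rightarrow> 'a cells \<Rightarrow> bool" where
  "cw_complex T C \<longleftrightarrow>
     Hausdorff_space T \<and>
     \<Union>(all_cells C) = topspace T \<and>
     (\<forall>j k. \<forall>d\<in>C j. \<forall>e\<in>C k. (j, d) \<noteq> (k, e) \<longrightarrow> d \<inter> e = {}) \<and>
     (\<forall>k. \<forall>e\<in>C k. \<exists>\<Phi>. characteristic_map T C k e \<Phi>) \<and>
     (\<forall>e\<in>all_cells C. finite {d \<in> all_cells C. d \<inter> T closure_of e \<noteq> {}}) \<and>
     (\<forall>A\<subseteq>topspace T. (\<forall>e\<in>all_cells C. closedin T (A \<inter> T closure_of e)) \<longrightarrow> closedin T A)"

definition cw_dimension :: "'a cells \<Rightarrow> nat \<Rightarrow> bool" where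
  "cw_dimension C m \<longleftrightarrow> C m \<noteq> {} \<and> (\<forall>k>m. C k = {})"

definition union_of_closed_cells :: "'a topology \<Rightarrow> 'a cells \<Rightarrow> nat \<Rightarrow> bool" where
  "union_of_closed_cells T C m \<longleftrightarrow> topspace T = (\<Union>e\<in>C m. T closure_of e)"

definition cw_subdivision :: "'a cells \<Rightarrow> 'a cells \<Rightarrow> bool" where
  "cw_subdivision C' C \<longleftrightarrow> (\<forall>c\<in>all_cells C'. \<exists>e\<in>all_cells C. c \<subseteq> e)"

definition homeomorphic_on_cells ::
    "'a topology \<Rightarrow> 'a cells \<Rightarrow> 'b topology \<Rightarrow> 'b cells \<Rightarrow> ('a \<Rightarrow> 'b) \<Rightarrow> bool" where
  "homeomorphic_on_cells T C U D f \<longleftrightarrow>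
     (\<forall>k. \<forall>e\<in>C k. \<exists>d\<in>D k. homeomorphic_map (subtopology T e) (subtopology U d) f)"

definition cellular_map ::
    "'a topology \<Rightarrow> 'a cells \<Rightarrow> 'b topology \<Rightarrow> 'b cells \<Rightarrow> ('a \<Rightarrow> 'b) \<Rightarrow> bool" where
  "cellular_map T C U D f \<longleftrightarrow>
     continuous_map T U f \<and> (\<forall>k. f ` skeleton C k \<subseteq> skeleton D k)"


section \<open>Finite subdivision rules\<close>

text \<open>The underlying space of \<open>R(S)\<close> is that of \<open>S\<close>, so only the cells of \<open>R(S)\<close> are
  recorded. The set of ideal tile types is a (possibly empty) set of \<open>m\<close>-cells of \<open>S\<close>.\<close>

record 's subdivision_rule =
  rdim :: nat
  rspace :: "'s topology"
  rcells :: "'s cells"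
  rsub :: "'s cells"
  rmap :: "'s \<Rightarrow> 's"
  rideal :: "'s set set"

text \<open>A CW structure on the closed disk whose only cell off the boundary is the open \<open>m\<close>-cell.
  A closed cell and a proper face of it meet in that face, so the ``lower dimension''
  of an intersection is relative to the larger of the two dimensions.\<close>

definition tile_structure :: "nat \<Rightarrow> (nat \<Rightarrow> real) cells \<Rightarrow> bool" where
  "tile_structure m D \<longleftrightarrow>
     cw_complex (cdisk m) D \<and>
     D m = {disk_interior m} \<and>
     (\<forall>k. k \<noteq> m \<longrightarrow> (\<forall>d\<in>D k. d \<subseteq> disk_boundary m)) \<and>
     (\<forall>i j. \<forall>a\<in>D i. \<forall>b\<in>D j.
        a \<noteq> b \<and> cdisk m closure_of a \<inter> cdisk m closure_of b \<noteq> {} \<longrightarrow>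
        (\<exists>k < max i j. \<exists>c\<in>D k.
           cdisk m closure_of a \<inter> cdisk m closure_of b = cdisk m closure_of c))"

definition finite_subdivision_rule :: "'s subdivision_rule \<Rightarrow> bool" where
  "finite_subdivision_rule R \<longleftrightarrow>
     cw_complex (rspace R) (rcells R) \<and>
     finite (all_cells (rcells R)) \<and>
     cw_dimension (rcells R) (rdim R) \<and>
     union_of_closed_cells (rspace R) (rcells R) (rdim R) \<and>
     (\<forall>e\<in>rcells R (rdim R). \<exists>D \<psi>.
        tile_structure (rdim R) D \<and>
        continuous_map (cdisk (rdim R)) (rspace R) \<psi> \<and>
        \<psi> ` disk_interior (rdim R) = e \<and>
        \<psi> ` topspace (cdisk (rdim R)) = rspace R closure_of e \<and>
        homeomorphic_on_cells (cdisk (rdim R)) D (rspace R) (rcells R) \<psi>) \<and>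
     cw_complex (rspace R) (rsub R) \<and>
     finite (all_cells (rsub R)) \<and>
     cw_dimension (rsub R) (rdim R) \<and>
     cw_subdivision (rsub R) (rcells R) \<and>
     cellular_map (rspace R) (rsub R) (rspace R) (rcells R) (rmap R) \<and>
     homeomorphic_on_cells (rspace R) (rsub R) (rspace R) (rcells R) (rmap R) \<and>
     rideal R \<subseteq> rcells R (rdim R) \<and>
     (\<forall>e\<in>rideal R. \<forall>c\<in>rsub R (rdim R). c \<subseteq> e \<longrightarrow> rmap R ` c \<in> rideal R)"

record ('x, 's) rcomplex =
  xspace :: "'x topology"
  xcells :: "'x cells"
  xmap :: "'x \<Rightarrow> 's"

definition r_complex :: "'s subdivision_rule \<Rightarrow> ('x, 's) rcomplex \<Rightarrow> bool" where
  "r_complex R X \<longleftrightarrow>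
     cw_complex (xspace X) (xcells X) \<and>
     cw_dimension (xcells X) (rdim R) \<and>
     union_of_closed_cells (xspace X) (xcells X) (rdim R) \<and>
     cellular_map (xspace X) (xcells X) (rspace R) (rcells R) (xmap X) \<and>
     homeomorphic_on_cells (xspace X) (xcells X) (rspace R) (rcells R) (xmap X)"

text \<open>Since \<open>f\<close> maps each open cell \<open>e\<close> of \<open>X\<close> homeomorphically onto an open cell of \<open>S\<close>,
  the cells of \<open>R(X)\<close> inside \<open>e\<close> are the preimages in \<open>e\<close> of the cells of \<open>R(S)\<close>
  inside \<open>f(e)\<close>.\<close>

definition subdivide :: "'s subdivision_rule \<Rightarrow> ('x, 's) rcomplex \<Rightarrow> ('x, 's) rcomplex" where
  "subdivide R X =
     \<lparr>xspace = xspace X,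
      xcells = (\<lambda>k. {e \<inter> xmap X -` c | e c.
                       e \<in> all_cells (xcells X) \<and> c \<in> rsub R k \<and> c \<subseteq> xmap X ` e}),
      xmap = rmap R \<circ> xmap X\<rparr>"

abbreviation subdivide_n ::
    "'s subdivision_rule \<Rightarrow> nat \<Rightarrow> ('x, 's) rcomplex \<Rightarrow> ('x, 's) rcomplex" where
  "subdivide_n R n X \<equiv> (subdivide R ^^ n) X"


section \<open>Graphs as metric spaces\<close>

record 'v ugraph =
  gverts :: "'v set"
  gedges :: "('v \<times> 'v) set"

text \<open>The edge relations below are symmetric, so \<open>E ^^ n\<close> relates the ends of the edge paths of
  length \<open>n\<close>. The distance is \<open>\<infinity>\<close> if there is no path.\<close>

definition gdist :: "'v ugraph \<Rightarrow> 'v \<Rightarrow> 'v \<Rightarrow> enat" where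
  "gdist \<Gamma> u v = (INF n\<in>{n. (u, v) \<in> gedges \<Gamma> ^^ n}. enat n)"

definition gdiam :: "'v ugraph \<Rightarrow> enat" where
  "gdiam \<Gamma> = (SUP u\<in>gverts \<Gamma>. SUP v\<in>gverts \<Gamma>. gdist \<Gamma> u v)"

definition induced :: "'v ugraph \<Rightarrow> 'v set \<Rightarrow> 'v ugraph" where
  "induced \<Gamma> W = \<lparr>gverts = gverts \<Gamma> \<inter> W, gedges = gedges \<Gamma> \<inter> W \<times> W\<rparr>"

definition gball :: "'v ugraph \<Rightarrow> 'v \<Rightarrow> nat \<Rightarrow> 'v set" where
  "gball \<Gamma> v n = {w \<in> gverts \<Gamma>. gdist \<Gamma> v w < enat n}"

definition biinfinite_geodesic :: "'v ugraph \<Rightarrow> (int \<Rightarrow> 'v) \<Rightarrow> bool" where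
  "biinfinite_geodesic \<Gamma> \<gamma> \<longleftrightarrow>
     range \<gamma> \<subseteq> gverts \<Gamma> \<and> (\<forall>i j. gdist \<Gamma> (\<gamma> i) (\<gamma> j) = enat (nat \<bar>i - j\<bar>))"

definition geodesic_divergence :: "'v ugraph \<Rightarrow> (int \<Rightarrow> 'v) \<Rightarrow> nat \<Rightarrow> enat" where
  "geodesic_divergence \<Gamma> \<gamma> n =
     gdist (induced \<Gamma> (gverts \<Gamma> - gball \<Gamma> (\<gamma> 0) n)) (\<gamma> (- int n)) (\<gamma> (int n))"

definition divergence :: "'v ugraph \<Rightarrow> nat \<Rightarrow> enat" where
  "divergence \<Gamma> n = (SUP \<gamma>\<in>{\<gamma>. biinfinite_geodesic \<Gamma> \<gamma>}. geodesic_divergence \<Gamma> \<gamma> n)"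

definition quasi_isometric :: "'v ugraph \<Rightarrow> 'w ugraph \<Rightarrow> bool" where
  "quasi_isometric \<Gamma> \<Delta> \<longleftrightarrow>
     (\<exists>h (K::real) (L::real). K \<ge> 1 \<and> L \<ge> 0 \<and> h ` gverts \<Gamma> \<subseteq> gverts \<Delta> \<and>
        (\<forall>u\<in>gverts \<Gamma>. \<forall>v\<in>gverts \<Gamma>.
           ereal (1 / K) * ereal_of_enat (gdist \<Gamma> u v) - ereal L
             \<le> ereal_of_enat (gdist \<Delta> (h u) (h v)) \<and>
           ereal_of_enat (gdist \<Delta> (h u) (h v))
             \<le> ereal K * ereal_of_enat (gdist \<Gamma> u v) + ereal L) \<and>
        (\<forall>w\<in>gverts \<Delta>. \<exists>v\<in>gverts \<Gamma>. ereal_of_enat (gdist \<Delta> (h v) w) \<le> ereal L))"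

definition asymp_le :: "(nat \<Rightarrow> enat) \<Rightarrow> (nat \<Rightarrow> enat) \<Rightarrow> bool" (infix \<open>\<preceq>\<^sub>d\<close> 50) where
  "f \<preceq>\<^sub>d g \<longleftrightarrow> (\<exists>a b. \<forall>n. f n \<le> g (a * n + b) + enat (a * n + b))"

definition finite_generating_set :: "('g, 'b) monoid_scheme \<Rightarrow> 'g set \<Rightarrow> bool" where
  "finite_generating_set G A \<longleftrightarrow>
     finite A \<and> A \<subseteq> carrier G \<and> generate G A = carrier G"

definition cayley_graph :: "('g, 'b) monoid_scheme \<Rightarrow> 'g set \<Rightarrow> 'g ugraph" where
  "cayley_graph G A =
     \<lparr>gverts = carrier G,
      gedges = {(x, y). x \<in> carrier G \<and> y \<in> carrier G \<and>
                        (\<exists>s\<in>A. y = x \<otimes>\<^bsub>G\<^esub> s \<or> x = y \<otimes>\<^bsub>G\<^esub> s)}\<rparr>"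


section \<open>Dual graphs and the history graph\<close>

definition tiles :: "'s subdivision_rule \<Rightarrow> ('x, 's) rcomplex \<Rightarrow> 'x set set" where
  "tiles R X = {e \<in> xcells X (rdim R). xmap X ` e \<notin> rideal R}"

definition dual_graph :: "'s subdivision_rule \<Rightarrow> ('x, 's) rcomplex \<Rightarrow> 'x set ugraph" where
  "dual_graph R X =
     \<lparr>gverts = tiles R X,
      gedges = {(d, e). d \<in> tiles R X \<and> e \<in> tiles R X \<and> d \<noteq> e \<and>
                  (\<exists>k. Suc k = rdim R \<and>
                    (\<exists>c\<in>xcells X k. c \<subseteq> xspace X closure_of d \<inter> xspace X closure_of e))}\<rparr>"

definition level_graph ::
    "'s subdivision_rule \<Rightarrow> ('x, 's) rcomplex \<Rightarrow> nat \<Rightarrow> 'x set ugraph" where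
  "level_graph R X n = dual_graph R (subdivide_n R n X)"

definition diam_level :: "'s subdivision_rule \<Rightarrow> ('x, 's) rcomplex \<Rightarrow> nat \<Rightarrow> enat" where
  "diam_level R X n = gdiam (level_graph R X n)"

datatype 'x history_vertex = Origin | Tile nat "'x set"

definition history_graph ::
    "'s subdivision_rule \<Rightarrow> ('x, 's) rcomplex \<Rightarrow> 'x history_vertex ugraph" where
  "history_graph R X =
     (let V = (\<lambda>n. gverts (level_graph R X n));
          horizontal = {(Tile n d, Tile n e) | n d e. (d, e) \<in> gedges (level_graph R X n)};
          vertical = {(Tile n d, Tile (Suc n) e) | n d e. d \<in> V n \<and> e \<in> V (Suc n) \<and> e \<subseteq> d}
                     \<union> {(Origin, Tile 0 e) | e. e \<in> V 0}
      in \<lparr>gverts = {Origin} \<union> {Tile n e | n e. e \<in> V n},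
          gedges = horizontal \<union> vertical \<union> vertical\<inverse>\<rparr>)"

definition associated ::
    "'s subdivision_rule \<Rightarrow> ('x, 's) rcomplex \<Rightarrow> ('g, 'b) monoid_scheme \<Rightarrow> 'g set \<Rightarrow> bool" where
  "associated R X G A \<longleftrightarrow> quasi_isometric (history_graph R X) (cayley_graph G A)"

text \<open>With \<open>\<gamma> 0 = Origin\<close>, the two halves of \<open>\<gamma>\<close> are its restrictions to the positive and to the
  negative integers. Each of them has exactly one vertex in level \<open>n\<close>, at parameter \<open>n + 1\<close>
  respectively \<open>- (n + 1)\<close>.\<close>

definition realizes_diameter ::
    "'s subdivision_rule \<Rightarrow> ('x, 's) rcomplex \<Rightarrow> (int \<Rightarrow> 'x history_vertex) \<Rightarrow> bool" where
  "realizes_diameter R X \<gamma> \<longleftrightarrow>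
     biinfinite_geodesic (history_graph R X) \<gamma> \<and> \<gamma> 0 = Origin \<and>
     (\<forall>n. \<exists>d e. Tile n d \<in> \<gamma> ` {0<..} \<and> Tile n e \<in> \<gamma> ` {..<0} \<and>
               gdist (level_graph R X n) d e = diam_level R X n)"

end

theory Submission
  imports Defs "HOL-Homology.Invariance_of_Domain"
begin

text \<open>Let \<open>H\<close> be the history graph, \<open>Y\<close> the Cayley graph and \<open>h\<close> the quasi-isometry from \<open>H\<close> to \<open>Y\<close>.

  The geometry of \<open>H\<close> comes from one topological fact: when two tiles of \<open>R\<^sup>n\<^sup>+\<^sup>1(X)\<close> share a face, the
  tiles of \<open>R\<^sup>n(X)\<close> that contain them coincide or share a face (\<open>adjacent_tile_parents\<close>). Replacing every
  vertex of a path by its ancestor in a lower level therefore never lengthens the path, and \<open>H\<close> is combed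
  by the vertical rays from the origin. A detour around a ball in \<open>Y\<close> can be read in \<open>H\<close> and pushed into
  a single level, which compares divergence and diameter up to a multiplicative constant.

  That is not enough. The relation \<open>\<preceq>\<^sub>d\<close> allows no constant in front of \<open>g(an + b)\<close>, and \<open>h\<close> maps the
  given geodesic of \<open>H\<close> only to a quasi-geodesic of \<open>Y\<close>, whereas the divergence of \<open>Y\<close> only sees genuine
  geodesics. Both gaps are closed by the same device. Since \<open>Y\<close> is homogeneous, one expensive detour
  around one center gives, at every vertex \<open>v\<close> of \<open>H\<close>, two nearby vertices that can only be connected at
  great cost outside a ball about \<open>v\<close> (a fork: \<open>fork_of_line\<close>, \<open>fork_of_level_pair\<close>). At least one of
  them, say \<open>e\<close>, is then expensive to connect to the ancestors of \<open>v\<close>; call \<open>(v, e)\<close> a gate. The vertical ray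
  to \<open>e\<close> has to pass near \<open>v\<close>, since otherwise one could descend from \<open>e\<close>, cross over in a lower level and
  climb up to \<open>v\<close>. Hence the shadows, where the shadow of \<open>v\<close> consists of the vertices that have an ancestor
  near \<open>v\<close>, decrease along a chain of gates (\<open>gate_nested\<close>), and a path that enters the shadow of \<open>e\<close> from
  outside the shadow of \<open>v\<close> and avoids the ball about \<open>v\<close> is expensive (\<open>gate_crossing\<close>). As the shadows
  are nested, a path into the last shadow of a chain of \<open>k\<close> gates pays for all of them, one after the
  other (\<open>gate_chain_cost\<close>).

  For the first claim, a chain of boundedly many gates fits into a region of size linear in \<open>n\<close> and beats
  any multiplicative constant (\<open>level_diameter_ge\<close>). For the second claim, a geodesic segment of \<open>Y\<close>
  between two gates of a long chain must visit all gates between them: skipping \<open>j\<close> gates would cost \<open>j\<close>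
  times the price of a gate, while the segment has length linear in \<open>j\<close> (\<open>segment_visits\<close>). Recentering
  longer and longer segments and passing to the limit (\<open>limit_line\<close>) gives a bi-infinite geodesic of \<open>Y\<close>
  through \<open>k\<close> consecutive gates, and its divergence pays for all of them (\<open>gate_line\<close>).

  The costs are handled as arbitrary finite lower bounds, so an infinite diameter or divergence needs no
  separate treatment.\<close>

section \<open>The closed disk\<close>

lemma cdisk_eq: "cdisk k = top_of_set {x. (\<forall>i\<ge>k. x i = 0) \<and> (\<Sum>i<k. (x i)\<^sup>2) \<le> 1}"
  unfolding cdisk_def Euclidean_space_def euclidean_product_topology subtopology_subtopology
  by (simp add: Collect_conj_eq)

lemma topspace_cdisk: "topspace (cdisk k) = {x. (\<forall>i\<ge>k. x i = 0) \<and> (\<Sum>i<k. (x i)\<^sup>2) \<le> 1}"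
  by (simp add: cdisk_eq)

lemma disk_interior_eq: "disk_interior k = {x. (\<forall>i\<ge>k. x i = 0) \<and> (\<Sum>i<k. (x i)\<^sup>2) < 1}"
  by (auto simp: disk_interior_def topspace_Euclidean_space)

lemma disk_interior_subset: "disk_interior k \<subseteq> topspace (cdisk k)"
  by (auto simp: disk_interior_eq topspace_cdisk)

lemma continuous_on_coordinate [continuous_intros]:
  "continuous_on S (\<lambda>x::nat \<Rightarrow> real. x i)"
  by (rule continuous_on_product_then_coordinatewise) (rule continuous_on_id)

lemma compact_space_cdisk: "compact_space (cdisk k)"
proof -
  let ?B = "Pi\<^sub>E UNIV (\<lambda>i. if i < k then {-1..1::real} else {0})"
  let ?D = "{x. (\<forall>i\<ge>k. x i = 0) \<and> (\<Sum>i<k. (x i)\<^sup>2) \<le> (1::real)}"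
  have B: "compact ?B"
  proof -
    have "compactin (powertop_real UNIV) ?B"
      by (subst compactin_PiE) auto
    then show ?thesis
      by (simp add: euclidean_product_topology)
  qed
  have "x i \<in> {-1..1}" if "x \<in> ?D" "i < k" for x i
  proof -
    have "(x i)\<^sup>2 \<le> (\<Sum>i<k. (x i)\<^sup>2)"
      using that by (intro member_le_sum) auto
    then have "(x i)\<^sup>2 \<le> 1" using that by auto
    then show ?thesis
      by (auto simp: abs_square_le_1 abs_le_iff)
  qed
  then have sub: "?D \<subseteq> ?B" by force
  have "closed {x::nat\<Rightarrow>real. x i = 0}" for i
    by (intro closed_Collect_eq continuous_intros)
  then have "closed {x::nat\<Rightarrow>real. \<forall>i\<ge>k. x i = 0}"
    using closed_INT[of "{k..}" "\<lambda>i. {x::nat\<Rightarrow>real. x i = 0}"]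
    by (simp add: INTER_eq Ball_def)
  moreover have "closed {x::nat\<Rightarrow>real. (\<Sum>i<k. (x i)\<^sup>2) \<le> 1}"
    by (intro closed_Collect_le continuous_intros)
  ultimately have "closed ?D"
    by (rule closed_Collect_conj)
  then have "compact (?B \<inter> ?D)"
    using compact_Int_closed[OF B, of ?D] by blast
  then have "compact ?D"
    unfolding inf.absorb2[OF sub] .
  then show ?thesis
    by (simp add: cdisk_eq compact_space_subtopology)
qed

lemma openin_disk_interior: "openin (cdisk k) (disk_interior k)"
proof -
  have "open {x::nat\<Rightarrow>real. (\<Sum>i<k. (x i)\<^sup>2) < 1}"
    by (intro open_Collect_less continuous_intros)
  moreover have "disk_interior k = {x. (\<forall>i\<ge>k. x i = 0) \<and> (\<Sum>i<k. (x i)\<^sup>2) \<le> 1} \<inter> {x. (\<Sum>i<k. (x i)\<^sup>2) < 1}"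
    by (auto simp: disk_interior_eq)
  ultimately show ?thesis
    unfolding cdisk_eq by (auto simp: openin_open)
qed

lemma Hausdorff_space_cdisk: "Hausdorff_space (cdisk k)"
  unfolding cdisk_eq by (simp add: Hausdorff_space_subtopology)

definition convex_point :: "(nat \<Rightarrow> real) \<Rightarrow> (nat \<Rightarrow> real) \<Rightarrow> real \<Rightarrow> nat \<Rightarrow> real" where
  "convex_point x y t = (\<lambda>i. (1 - t) * x i + t * y i)"

lemma continuous_on_convex_point: "continuous_on S (convex_point x y)"
  unfolding convex_point_def
  by (intro continuous_on_coordinatewise_then_product continuous_intros)

lemma connected_of_segments:
  assumes "\<And>x y t. x \<in> N \<Longrightarrow> y \<in> N \<Longrightarrow> 0 \<le> t \<Longrightarrow> t \<le> 1 \<Longrightarrow> convex_point x y t \<in> N"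
  shows "connected N"
proof (rule connectedI_const)
  fix P :: "(nat \<Rightarrow> real) \<Rightarrow> bool"
  assume P: "continuous_on N P"
  have "P x = P y" if "x \<in> N" "y \<in> N" for x y
  proof -
    have "convex_point x y ` {0..1} \<subseteq> N"
      using assms[OF that] by force
    then have "continuous_on (convex_point x y ` {0..1}) P"
      by (rule continuous_on_subset[OF P])
    then have "continuous_on {0..1} (P \<circ> convex_point x y)"
      by (rule continuous_on_compose[OF continuous_on_convex_point])
    then obtain c where "\<And>t. t \<in> {0..1} \<Longrightarrow> (P \<circ> convex_point x y) t = c"
      using connectedD_const[of "{0..1::real}" "P \<circ> convex_point x y"] connected_Icc by metis
    from this[of 0] this[of 1] show ?thesis
      by (simp add: convex_point_def)
  qed
  then show "\<exists>c. \<forall>s\<in>N. P s = c" by metis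
qed

lemma convex_point_square_le:
  assumes "0 \<le> t" "t \<le> (1::real)"
  shows "(\<Sum>i<k. (convex_point x y t i)\<^sup>2) \<le> (1 - t) * (\<Sum>i<k. (x i)\<^sup>2) + t * (\<Sum>i<k. (y i)\<^sup>2)"
proof -
  have "((1 - t) * a + t * b)\<^sup>2 \<le> (1 - t) * a\<^sup>2 + t * b\<^sup>2" for a b :: real
  proof -
    have "(1 - t) * a\<^sup>2 + t * b\<^sup>2 - ((1 - t) * a + t * b)\<^sup>2 = t * (1 - t) * (a - b)\<^sup>2"
      by (simp add: power2_eq_square algebra_simps)
    moreover have "0 \<le> t * (1 - t) * (a - b)\<^sup>2" using assms by simp
    ultimately show ?thesis by linarith
  qed
  then show ?thesis
    unfolding convex_point_def sum_distrib_left sum.distrib[symmetric]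
    by (intro sum_mono) auto
qed

lemma disk_interior_convex_point:
  assumes "x \<in> disk_interior k" "y \<in> topspace (cdisk k)" "0 \<le> t" "t < 1"
  shows "convex_point x y t \<in> disk_interior k"
proof -
  have "(\<Sum>i<k. (convex_point x y t i)\<^sup>2) \<le> (1 - t) * (\<Sum>i<k. (x i)\<^sup>2) + t * (\<Sum>i<k. (y i)\<^sup>2)"
    using assms by (intro convex_point_square_le) auto
  also have "\<dots> < (1 - t) * 1 + t * 1"
    using assms by (intro add_less_le_mono mult_strict_left_mono mult_left_mono)
      (auto simp: disk_interior_eq topspace_cdisk)
  finally show ?thesis
    using assms by (auto simp: disk_interior_eq topspace_cdisk convex_point_def)
qed

lemma disk_interior_convex_point':
  assumes "x \<in> disk_interior k" "y \<in> disk_interior k" "0 \<le> t" "t \<le> 1"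
  shows "convex_point x y t \<in> disk_interior k"
proof (cases "t = 1")
  case True
  then show ?thesis using assms by (simp add: convex_point_def)
next
  case False
  then show ?thesis using assms disk_interior_convex_point disk_interior_subset by (simp add: subset_iff)
qed

lemma connectedin_disk_interior: "connectedin (cdisk k) (disk_interior k)"
proof -
  have "connected (disk_interior k)"
    by (rule connected_of_segments) (rule disk_interior_convex_point')
  then show ?thesis
    using disk_interior_subset by (simp add: cdisk_eq connectedin_subtopology)
qed

lemma zero_in_disk_interior: "(\<lambda>i. 0) \<in> disk_interior k"
  by (simp add: disk_interior_eq)

lemma disk_interior_dense: "cdisk k closure_of disk_interior k = topspace (cdisk k)"
proof -
  have "r \<in> cdisk k closure_of disk_interior k" if r: "r \<in> topspace (cdisk k)" for r
  proof -
    let ?s = "convex_point (\<lambda>i. 0) r"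
    have "((\<lambda>t. ?s t) \<longlongrightarrow> ?s 1) (at 1 within {0..<1})"
    proof (rule tendsto_within_subset)
      show "(?s \<longlongrightarrow> ?s 1) (at 1 within {0..1})"
        using continuous_on_convex_point[of "{0..1}" "\<lambda>i. 0" r] by (simp add: continuous_on_def)
    qed auto
    moreover have "?s 1 = r" by (simp add: convex_point_def)
    ultimately have lim: "(?s \<longlongrightarrow> r) (at 1 within {0..<1})" by simp
    have nb: "at 1 within {0..<1::real} \<noteq> bot"
    proof -
      have "at_left (1::real) = at 1 within {0..<1}"
        by (rule at_within_nhd[of _ "{0<..}"]) auto
      then show ?thesis using trivial_limit_at_left_real[of "1::real"] by simp
    qed
    show ?thesis
      unfolding in_closure_of
    proof (intro conjI r allI impI)
      fix N assume N: "r \<in> N \<and> openin (cdisk k) N"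
      then obtain O' where O': "open O'" "N = topspace (cdisk k) \<inter> O'"
        unfolding cdisk_eq openin_open by auto
      have "eventually (\<lambda>t. ?s t \<in> O') (at 1 within {0..<1})"
        using lim O' N by (auto simp: tendsto_def)
      moreover have "eventually (\<lambda>t. t \<in> {0..<1}) (at 1 within {0..<1::real})"
        by (simp add: eventually_at_topological) blast
      ultimately have "eventually (\<lambda>t. ?s t \<in> O' \<and> t \<in> {0..<1}) (at 1 within {0..<1})"
        by (rule eventually_conj)
      then obtain t where t: "?s t \<in> O'" "0 \<le> t" "t < 1"
        using nb eventually_happens'[of "at 1 within {0..<1::real}"] by force
      have "?s t \<in> disk_interior k"
        using r t zero_in_disk_interior by (intro disk_interior_convex_point) auto
      moreover have "?s t \<in> N"
        using t(1) O'(2) subsetD[OF disk_interior_subset calculation] by simp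
      ultimately show "\<exists>y. y \<in> disk_interior k \<and> y \<in> N"
        by blast
    qed
  qed
  then show ?thesis
    by (intro equalityI closure_of_subset_topspace subsetI)
qed

text \<open>The open disk is locally connected at its boundary: a coordinate box around a boundary point meets
  the open disk in a convex set.\<close>

lemma disk_interior_locally_connected:
  assumes N: "openin (cdisk k) N" "r \<in> N"
  obtains N' where "openin (cdisk k) N'" "r \<in> N'" "N' \<subseteq> N"
    "connectedin (cdisk k) (N' \<inter> disk_interior k)"
proof -
  obtain O' where O': "open O'" "N = topspace (cdisk k) \<inter> O'"
    using N unfolding cdisk_eq openin_open by auto
  have "openin (powertop_real UNIV) O'" using O' by (simp add: euclidean_product_topology)
  note product_topology_open_contains_basis[OF this, of r]
  moreover have "r \<in> O'" using N O' by auto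
  ultimately obtain X where X: "r \<in> Pi\<^sub>E UNIV X" "\<And>i. open (X i)" "finite {i. X i \<noteq> UNIV}" "Pi\<^sub>E UNIV X \<subseteq> O'"
    by auto
  have "\<exists>e>0. ball (r i) e \<subseteq> X i" for i
    using X(1) X(2)[of i] open_contains_ball_eq[of "X i"] by auto
  then obtain e where e: "\<And>i. e i > 0" "\<And>i. ball (r i) (e i) \<subseteq> X i" by metis
  define X' where "X' = (\<lambda>i. if X i = UNIV then UNIV else ball (r i) (e i))"
  have X': "open (X' i)" "r i \<in> X' i" "X' i \<subseteq> X i" "convex (X' i)" for i
    using e[of i] X(2)[of i] by (auto simp: X'_def)
  have "{i. X' i \<noteq> UNIV} \<subseteq> {i. X i \<noteq> UNIV}" by (auto simp: X'_def)
  then have "finite {i. X' i \<noteq> UNIV}" using X(3) finite_subset by blast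
  then have "openin (powertop_real UNIV) (Pi\<^sub>E UNIV X')"
    by (intro product_topology_basis) (use X' in auto)
  then have op: "open (Pi\<^sub>E UNIV X')" by (simp add: euclidean_product_topology)
  let ?N = "topspace (cdisk k) \<inter> Pi\<^sub>E UNIV X'"
  have "connected (?N \<inter> disk_interior k)"
  proof (rule connected_of_segments)
    fix x y and t :: real
    assume x: "x \<in> ?N \<inter> disk_interior k" and y: "y \<in> ?N \<inter> disk_interior k" and t: "0 \<le> t" "t \<le> 1"
    have "convex_point x y t \<in> disk_interior k" using x y t by (intro disk_interior_convex_point') auto
    moreover have "convex_point x y t i \<in> X' i" for i
    proof -
      have "x i \<in> X' i" "y i \<in> X' i" using x y by (auto simp: PiE_iff)
      then have "(1 - t) *\<^sub>R x i + t *\<^sub>R y i \<in> X' i"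
        using X'(4)[of i] t by (auto simp: convex_alt)
      then show ?thesis by (simp add: convex_point_def)
    qed
    ultimately show "convex_point x y t \<in> ?N \<inter> disk_interior k"
      using disk_interior_subset by auto
  qed
  then have "connectedin (cdisk k) (?N \<inter> disk_interior k)"
    using disk_interior_subset by (simp add: cdisk_eq connectedin_subtopology inf.coboundedI2)
  moreover have "openin (cdisk k) ?N"
    using op by (auto simp: cdisk_eq openin_open)
  moreover have "r \<in> ?N" "?N \<subseteq> N" using X' X(4) N(2) O'(2) by fastforce+
  ultimately show thesis using that by blast
qed

text \<open>Invariance of domain: composed with the inclusion of Euclidean spaces, the map would have an open
  image inside a proper coordinate subspace if \<open>k\<close> were smaller than \<open>j\<close>.\<close>

lemma cell_dimension_le:
  assumes f: "continuous_map (subtopology (cdisk j) (disk_interior j)) (cdisk k) f"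
    and inj: "inj_on f (disk_interior j)"
  shows "j \<le> k"
proof (rule ccontr)
  assume "\<not> j \<le> k"
  then have kj: "k < j" by simp
  have eq: "subtopology (cdisk j) (disk_interior j) = subtopology (Euclidean_space j) (disk_interior j)"
    unfolding cdisk_def subtopology_subtopology
    by (rule arg_cong2[where f=subtopology]) (auto simp: disk_interior_def)
  have op: "openin (Euclidean_space j) (disk_interior j)"
  proof -
    have "open {x::nat\<Rightarrow>real. (\<Sum>i<j. (x i)\<^sup>2) < 1}"
      by (intro open_Collect_less continuous_intros)
    then show ?thesis
      unfolding Euclidean_space_def euclidean_product_topology disk_interior_eq openin_open by blast
  qed
  have top: "topspace (subtopology (Euclidean_space j) (disk_interior j)) = disk_interior j"
    by (auto simp: disk_interior_def)
  have "continuous_map (subtopology (cdisk j) (disk_interior j)) (Euclidean_space j) f"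
  proof -
    have "continuous_map (subtopology (cdisk j) (disk_interior j)) (Euclidean_space k) f"
      using f unfolding cdisk_def continuous_map_in_subtopology by auto
    then show ?thesis
      unfolding Euclidean_space_def continuous_map_in_subtopology using kj by (auto simp: image_subset_iff Pi_iff)
  qed
  then have op': "openin (Euclidean_space j) (f ` disk_interior j)"
    using invariance_of_domain_Euclidean_space[OF op] inj eq by simp
  define z where "z = f (\<lambda>i. 0)"
  have z: "z \<in> f ` disk_interior j" using zero_in_disk_interior z_def by auto
  have low: "\<forall>i\<ge>k. x i = 0" if "x \<in> f ` disk_interior j" for x
    using continuous_map_image_subset_topspace[OF f] that top eq by (auto simp: topspace_cdisk)
  obtain O' where O': "open O'" "f ` disk_interior j = {x. \<forall>i\<ge>j. x i = 0} \<inter> O'"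
    using op' unfolding Euclidean_space_def euclidean_product_topology openin_open by auto
  \<comment> \<open>Moving \<open>z\<close> in the direction of coordinate \<open>k\<close> leaves the image, which lies in the first \<open>k\<close> coordinates.\<close>
  let ?s = "\<lambda>t. z(k := t)"
  have cs: "continuous_on UNIV ?s"
  proof (rule continuous_on_coordinatewise_then_product)
    fix i show "continuous_on UNIV (\<lambda>t. (z(k := t)) i)" by (cases "i = k") auto
  qed
  then have "open (?s -` O')" using O'(1) by (simp add: open_vimage)
  moreover have "z k = 0" using low[OF z] by simp
  then have "?s 0 = z" by auto
  then have "0 \<in> ?s -` O'" using z O'(2) by auto
  ultimately obtain e where e: "e > 0" "ball 0 e \<subseteq> ?s -` O'"
    using open_contains_ball_eq by blast
  have "e/2 \<in> ball 0 e" using e by (simp add: dist_norm)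
  then have "e/2 \<in> ?s -` O'" using e(2) by blast
  moreover have "\<forall>i\<ge>j. ?s (e/2) i = 0" using low[OF z] kj by auto
  ultimately have "?s (e/2) \<in> f ` disk_interior j" using O'(2) by blast
  then show False using low[of "?s (e/2)"] e by auto
qed

section \<open>Closures of tiles are unions of cells\<close>

lemma closure_of_meets:
  assumes "x \<in> X closure_of S" "openin X U" "x \<in> U"
  shows "\<exists>y\<in>S. y \<in> U"
  using assms by (auto simp: in_closure_of)

text \<open>The cluster set of \<open>g\<close> at a point \<open>r\<close> of the closed disk is connected, because \<open>r\<close> has arbitrarily
  small neighborhoods that meet the open disk in a connected set. A finite cluster set is therefore a
  single point. Here \<open>Z\<close> is the closure of the graph of \<open>g\<close>, so its fibers are the cluster sets.\<close>

lemma disk_cluster_connected: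
  assumes T: "Hausdorff_space T"
    and g: "continuous_map (subtopology (cdisk m) (disk_interior m)) T g"
    and Z: "compactin (prod_topology (cdisk m) T) Z"
      "Z \<subseteq> prod_topology (cdisk m) T closure_of ((\<lambda>r. (r, g r)) ` disk_interior m)"
      "\<And>r. r \<in> disk_interior m \<Longrightarrow> (r, g r) \<in> Z"
    and fin: "finite {y. (r, y) \<in> Z}"
    and y: "(r, y1) \<in> Z" "(r, y2) \<in> Z"
  shows "y1 = y2"
proof (rule ccontr)
  assume ne: "y1 \<noteq> y2"
  let ?F = "{y. (r, y) \<in> Z} - {y1}"
  have Zsub: "Z \<subseteq> topspace (cdisk m) \<times> topspace T"
    using compactin_subset_topspace[OF Z(1)] by simp
  have "compactin T {y1}" "compactin T ?F"
    using fin y Zsub by (auto intro!: finite_imp_compactin)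
  moreover have "disjnt {y1} ?F" by (simp add: disjnt_def)
  ultimately obtain U1 U2 where U: "openin T U1" "openin T U2" "y1 \<in> U1" "?F \<subseteq> U2" "disjnt U1 U2"
    using T[unfolded Hausdorff_space_compact_sets, rule_format, of "{y1}" ?F] by auto
  let ?C = "topspace T - (U1 \<union> U2)"
  have "closedin (prod_topology (cdisk m) T) (topspace (cdisk m) \<times> ?C)"
    using U by (simp add: closedin_prod_Times_iff closedin_diff openin_Un)
  then have "compactin (prod_topology (cdisk m) T) (Z \<inter> (topspace (cdisk m) \<times> ?C))"
    using Z(1) compact_Int_closedin by blast
  then have "compactin (cdisk m) (fst ` (Z \<inter> (topspace (cdisk m) \<times> ?C)))"
    using image_compactin continuous_map_fst by blast
  then have cl: "closedin (cdisk m) (fst ` (Z \<inter> (topspace (cdisk m) \<times> ?C)))"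
    using Hausdorff_space_cdisk compactin_imp_closedin by blast
  let ?N = "topspace (cdisk m) - fst ` (Z \<inter> (topspace (cdisk m) \<times> ?C))"
  have "openin (cdisk m) ?N" using cl by blast
  moreover have "r \<in> ?N" using y Zsub U by force
  ultimately obtain N' where N': "openin (cdisk m) N'" "r \<in> N'" "N' \<subseteq> ?N"
    "connectedin (cdisk m) (N' \<inter> disk_interior m)"
    by (rule disk_interior_locally_connected)
  have "connectedin (subtopology (cdisk m) (disk_interior m)) (N' \<inter> disk_interior m)"
    using N'(4) by (simp add: connectedin_subtopology)
  then have con: "connectedin T (g ` (N' \<inter> disk_interior m))"
    using g connectedin_continuous_map_image by blast
  have sub: "g ` (N' \<inter> disk_interior m) \<subseteq> U1 \<union> U2"
  proof clarify
    fix s assume s: "s \<in> N'" "s \<in> disk_interior m" "g s \<notin> U2"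
    have "(s, g s) \<in> Z" using Z(3) s by blast
    then show "g s \<in> U1" using s N'(3) Zsub by force
  qed
  have meet: "g ` (N' \<inter> disk_interior m) \<inter> U \<noteq> {}" if U: "openin T U" and y: "(r, y) \<in> Z" "y \<in> U" for U y
  proof -
    have "(r, y) \<in> prod_topology (cdisk m) T closure_of ((\<lambda>r. (r, g r)) ` disk_interior m)"
      using y Z(2) by blast
    moreover have "openin (prod_topology (cdisk m) T) (N' \<times> U)"
      using N'(1) U by (simp add: openin_prod_Times_iff)
    moreover have "(r, y) \<in> N' \<times> U" using N' y by simp
    ultimately have "\<exists>p\<in>(\<lambda>r. (r, g r)) ` disk_interior m. p \<in> N' \<times> U"
      by (rule closure_of_meets)
    then show ?thesis by blast
  qed
  have "U1 \<inter> g ` (N' \<inter> disk_interior m) \<noteq> {}"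
    using meet[OF U(1) y(1) U(3)] by (simp only: Int_commute not_False_eq_True)
  moreover have "y2 \<in> U2" using y(2) ne U(4) by blast
  then have "U2 \<inter> g ` (N' \<inter> disk_interior m) \<noteq> {}"
    using meet[OF U(2) y(2)] by (simp only: Int_commute not_False_eq_True)
  moreover have "U1 \<inter> U2 \<inter> g ` (N' \<inter> disk_interior m) = {}" using U(5) by (auto simp: disjnt_def)
  ultimately show False
    using connectedinD[OF con U(1,2) sub] by blast
qed

text \<open>The part of the axioms of an \<open>R\<close>-complex that passes to subdivisions by elementary arguments. Attaching
  maps for the cells of a subdivision would have to be lifted along the map to \<open>S\<close>; compactness of closed
  tiles and the fact that a closed tile meets finitely many cells are enough instead.\<close>

definition charted :: "'s subdivision_rule \<Rightarrow> ('x, 's) rcomplex \<Rightarrow> bool" where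
  "charted R X \<longleftrightarrow>
     Hausdorff_space (xspace X) \<and>
     continuous_map (xspace X) (rspace R) (xmap X) \<and>
     \<Union>(all_cells (xcells X)) = topspace (xspace X) \<and>
     (\<forall>j k. \<forall>d\<in>xcells X j. \<forall>e\<in>xcells X k. (j, d) \<noteq> (k, e) \<longrightarrow> d \<inter> e = {}) \<and>
     (\<forall>k. \<forall>e\<in>xcells X k. xmap X ` e \<in> rcells R k \<and>
        homeomorphic_map (subtopology (xspace X) e) (subtopology (rspace R) (xmap X ` e)) (xmap X)) \<and>
     (\<forall>P\<in>xcells X (rdim R). compactin (xspace X) (xspace X closure_of P) \<and>
        finite {e \<in> all_cells (xcells X). e \<inter> xspace X closure_of P \<noteq> {}})"

lemma chartedD:
  assumes "charted R X"
  shows "Hausdorff_space (xspace X)" "continuous_map (xspace X) (rspace R) (xmap X)"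
    "\<Union>(all_cells (xcells X)) = topspace (xspace X)"
    "\<And>j k d e. d \<in> xcells X j \<Longrightarrow> e \<in> xcells X k \<Longrightarrow> d \<inter> e \<noteq> {} \<Longrightarrow> j = k \<and> d = e"
    "\<And>k e. e \<in> xcells X k \<Longrightarrow> xmap X ` e \<in> rcells R k"
    "\<And>k e. e \<in> xcells X k \<Longrightarrow>
        homeomorphic_map (subtopology (xspace X) e) (subtopology (rspace R) (xmap X ` e)) (xmap X)"
    "\<And>k e. e \<in> xcells X k \<Longrightarrow> e \<subseteq> topspace (xspace X)"
    "\<And>P. P \<in> xcells X (rdim R) \<Longrightarrow> compactin (xspace X) (xspace X closure_of P)"
    "\<And>P. P \<in> xcells X (rdim R) \<Longrightarrow> finite {e \<in> all_cells (xcells X). e \<inter> xspace X closure_of P \<noteq> {}}"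
proof -
  show cov: "\<Union>(all_cells (xcells X)) = topspace (xspace X)"
    using assms by (simp add: charted_def)
  then show sub: "\<And>k e. e \<in> xcells X k \<Longrightarrow> e \<subseteq> topspace (xspace X)"
    by (auto simp: all_cells_def)
  have "\<forall>j k. \<forall>d\<in>xcells X j. \<forall>e\<in>xcells X k. (j, d) \<noteq> (k, e) \<longrightarrow> d \<inter> e = {}"
    using assms unfolding charted_def by (elim conjE)
  then show "\<And>j k d e. d \<in> xcells X j \<Longrightarrow> e \<in> xcells X k \<Longrightarrow> d \<inter> e \<noteq> {} \<Longrightarrow> j = k \<and> d = e"
    by (metis Pair_inject)
qed (use assms in \<open>simp_all add: charted_def\<close>)

lemma cw_complexD:
  assumes "cw_complex T C"
  shows "Hausdorff_space T" "\<Union>(all_cells C) = topspace T"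
    "\<And>j k d e. d \<in> C j \<Longrightarrow> e \<in> C k \<Longrightarrow> d \<inter> e \<noteq> {} \<Longrightarrow> j = k \<and> d = e"
    "\<And>k e. e \<in> C k \<Longrightarrow> e \<subseteq> topspace T"
    "\<And>k e. e \<in> C k \<Longrightarrow> \<exists>\<Phi>. characteristic_map T C k e \<Phi>"
    "\<And>e. e \<in> all_cells C \<Longrightarrow> finite {d \<in> all_cells C. d \<inter> T closure_of e \<noteq> {}}"
proof -
  have "\<forall>j k. \<forall>d\<in>C j. \<forall>e\<in>C k. (j, d) \<noteq> (k, e) \<longrightarrow> d \<inter> e = {}"
    using assms unfolding cw_complex_def by (elim conjE)
  then show "\<And>j k d e. d \<in> C j \<Longrightarrow> e \<in> C k \<Longrightarrow> d \<inter> e \<noteq> {} \<Longrightarrow> j = k \<and> d = e"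
    by (metis Pair_inject)
  show "\<Union>(all_cells C) = topspace T"
    using assms by (simp add: cw_complex_def)
  then show "\<And>k e. e \<in> C k \<Longrightarrow> e \<subseteq> topspace T"
    by (auto simp: all_cells_def)
  show "Hausdorff_space T" "\<And>k e. e \<in> C k \<Longrightarrow> \<exists>\<Phi>. characteristic_map T C k e \<Phi>"
    "\<And>e. e \<in> all_cells C \<Longrightarrow> finite {d \<in> all_cells C. d \<inter> T closure_of e \<noteq> {}}"
    using assms unfolding cw_complex_def by meson+
qed

lemma cw_complex_cell_homeomorphic:
  assumes "cw_complex T C" "e \<in> C k"
  obtains \<Phi> where "homeomorphic_map (subtopology (cdisk k) (disk_interior k)) (subtopology T e) \<Phi>"
    "continuous_map (cdisk k) T \<Phi>" "\<Phi> ` disk_interior k = e"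
proof -
  obtain \<Phi> where "characteristic_map T C k e \<Phi>"
    using cw_complexD(5)[OF assms] by blast
  moreover from this have "\<Phi> ` disk_interior k = e"
    using homeomorphic_imp_surjective_map[of "subtopology (cdisk k) (disk_interior k)" "subtopology T e" \<Phi>]
      disk_interior_subset[of k] cw_complexD(4)[OF assms]
    by (simp add: characteristic_map_def inf.absorb2)
  ultimately show thesis using that unfolding characteristic_map_def by blast
qed

lemma cw_complex_cell_connected:
  assumes "cw_complex T C" "e \<in> C k"
  shows "connectedin T e" "e \<noteq> {}"
proof -
  obtain \<Phi> where \<Phi>: "continuous_map (cdisk k) T \<Phi>" "\<Phi> ` disk_interior k = e"
    using cw_complex_cell_homeomorphic[OF assms] by blast
  then show "connectedin T e"
    using connectedin_continuous_map_image[OF \<Phi>(1) connectedin_disk_interior] by simp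
  show "e \<noteq> {}" using \<Phi>(2) zero_in_disk_interior by blast
qed

lemma cw_complex_cell_closure_compact:
  assumes "cw_complex T C" "e \<in> C k"
  shows "compactin T (T closure_of e)"
proof -
  obtain \<Phi> where \<Phi>: "continuous_map (cdisk k) T \<Phi>" "\<Phi> ` disk_interior k = e"
    using cw_complex_cell_homeomorphic[OF assms] by blast
  have cp: "compactin T (\<Phi> ` topspace (cdisk k))"
    using image_compactin[OF compact_space_cdisk[unfolded compact_space_def] \<Phi>(1)] .
  then have "closedin T (\<Phi> ` topspace (cdisk k))"
    using cw_complexD(1)[OF assms(1)] compactin_imp_closedin by blast
  moreover have "e \<subseteq> \<Phi> ` topspace (cdisk k)"
    unfolding \<Phi>(2)[symmetric] by (rule image_mono[OF disk_interior_subset])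
  ultimately have "T closure_of e \<subseteq> \<Phi> ` topspace (cdisk k)"
    by (rule closure_of_minimal[rotated])
  then show ?thesis
    by (rule closed_compactin[OF cp _ closedin_closure_of])
qed

lemma homeomorphic_cell_image:
  assumes C: "\<And>k e. e \<in> C k \<Longrightarrow> e \<subseteq> topspace T" and D: "\<And>k e. e \<in> D k \<Longrightarrow> e \<subseteq> topspace U"
    and f: "homeomorphic_on_cells T C U D f" and e: "e \<in> C k"
  shows "f ` e \<in> D k" "homeomorphic_map (subtopology T e) (subtopology U (f ` e)) f"
proof -
  obtain d where d: "d \<in> D k" "homeomorphic_map (subtopology T e) (subtopology U d) f"
    using f e unfolding homeomorphic_on_cells_def by blast
  have "f ` e = d"
    using homeomorphic_imp_surjective_map[OF d(2)] C[OF e] D[OF d(1)] by (simp add: inf.absorb2)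
  then show "f ` e \<in> D k" "homeomorphic_map (subtopology T e) (subtopology U (f ` e)) f"
    using d by auto
qed

lemma finite_subdivision_ruleD:
  assumes "finite_subdivision_rule R"
  shows "cw_complex (rspace R) (rcells R)" "cw_complex (rspace R) (rsub R)"
    "finite (all_cells (rsub R))" "\<And>k. rdim R < k \<Longrightarrow> rcells R k = {}"
    "\<And>c. c \<in> all_cells (rsub R) \<Longrightarrow> \<exists>e\<in>all_cells (rcells R). c \<subseteq> e"
    "continuous_map (rspace R) (rspace R) (rmap R)"
    "\<And>k c. c \<in> rsub R k \<Longrightarrow> rmap R ` c \<in> rcells R k"
    "\<And>k c. c \<in> rsub R k \<Longrightarrow>
        homeomorphic_map (subtopology (rspace R) c) (subtopology (rspace R) (rmap R ` c)) (rmap R)"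
    "\<And>e c. e \<in> rideal R \<Longrightarrow> c \<in> rsub R (rdim R) \<Longrightarrow> c \<subseteq> e \<Longrightarrow> rmap R ` c \<in> rideal R"
    "\<And>e. e \<in> rcells R (rdim R) \<Longrightarrow> \<exists>D \<psi>.
        tile_structure (rdim R) D \<and>
        continuous_map (cdisk (rdim R)) (rspace R) \<psi> \<and>
        \<psi> ` disk_interior (rdim R) = e \<and>
        homeomorphic_on_cells (cdisk (rdim R)) D (rspace R) (rcells R) \<psi>"
proof -
  show 1: "cw_complex (rspace R) (rcells R)" and 2: "cw_complex (rspace R) (rsub R)"
    using assms by (auto simp: finite_subdivision_rule_def)
  have 3: "homeomorphic_on_cells (rspace R) (rsub R) (rspace R) (rcells R) (rmap R)"
    using assms by (simp add: finite_subdivision_rule_def)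
  fix k c assume "c \<in> rsub R k"
  then show "rmap R ` c \<in> rcells R k"
    "homeomorphic_map (subtopology (rspace R) c) (subtopology (rspace R) (rmap R ` c)) (rmap R)"
    using homeomorphic_cell_image[OF cw_complexD(4)[OF 2] cw_complexD(4)[OF 1] 3] by auto
next
  fix e assume e: "e \<in> rcells R (rdim R)"
  have "\<forall>e\<in>rcells R (rdim R). \<exists>D \<psi>.
        tile_structure (rdim R) D \<and>
        continuous_map (cdisk (rdim R)) (rspace R) \<psi> \<and>
        \<psi> ` disk_interior (rdim R) = e \<and>
        \<psi> ` topspace (cdisk (rdim R)) = rspace R closure_of e \<and>
        homeomorphic_on_cells (cdisk (rdim R)) D (rspace R) (rcells R) \<psi>"
    using assms unfolding finite_subdivision_rule_def by (elim conjE)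
  from bspec[OF this e] show "\<exists>D \<psi>.
        tile_structure (rdim R) D \<and>
        continuous_map (cdisk (rdim R)) (rspace R) \<psi> \<and>
        \<psi> ` disk_interior (rdim R) = e \<and>
        homeomorphic_on_cells (cdisk (rdim R)) D (rspace R) (rcells R) \<psi>"
    by (elim exE conjE) (intro exI conjI)
qed (use assms in \<open>simp_all add: finite_subdivision_rule_def cw_dimension_def cw_subdivision_def cellular_map_def\<close>)

lemma r_complex_charted:
  assumes R: "finite_subdivision_rule R" and X: "r_complex R X"
  shows "charted R X"
proof -
  have cw: "cw_complex (xspace X) (xcells X)"
    and f: "cellular_map (xspace X) (xcells X) (rspace R) (rcells R) (xmap X)"
    and h: "homeomorphic_on_cells (xspace X) (xcells X) (rspace R) (rcells R) (xmap X)"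
    using X by (auto simp: r_complex_def)
  note cell = homeomorphic_cell_image[OF cw_complexD(4)[OF cw] cw_complexD(4)[OF finite_subdivision_ruleD(1)[OF R]] h]
  have "finite {e \<in> all_cells (xcells X). e \<inter> xspace X closure_of P \<noteq> {}}" if "P \<in> xcells X (rdim R)" for P
    using cw_complexD(6)[OF cw, of P] that by (auto simp: all_cells_def)
  moreover have "\<forall>j k. \<forall>d\<in>xcells X j. \<forall>e\<in>xcells X k. (j, d) \<noteq> (k, e) \<longrightarrow> d \<inter> e = {}"
    using cw by (simp add: cw_complex_def)
  ultimately show ?thesis
    unfolding charted_def
    using cell cw_complexD(1,2)[OF cw] cw_complex_cell_closure_compact[OF cw] f
    by (simp add: cellular_map_def)
qed

text \<open>The closure of a tile \<open>P\<close> is a union of cells, also in a subdivision, where no attaching map of \<open>P\<close>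
  is at hand. The chart \<open>\<psi>\<close> of the tile type of \<open>P\<close> lifts over the open disk to a map \<open>g\<close> onto \<open>P\<close>. Let
  \<open>Z\<close> be the closure of its graph. Over a cell \<open>d\<close> of the disk, the points of \<open>Z\<close> lie in the finitely many
  cells that meet the closure of \<open>P\<close> and have the same image as \<open>d\<close>, at most one point in each. By
  \<open>disk_cluster_connected\<close> there is only one point over each \<open>r\<close> in \<open>d\<close>, so \<open>g\<close> extends to \<open>d\<close>, and as
  \<open>d\<close> is connected the extension maps \<open>d\<close> onto a single cell.\<close>

lemma closure_contains_cell:
  assumes R: "finite_subdivision_rule R" and X: "charted R X"
    and P: "P \<in> xcells X (rdim R)" and C: "C \<in> xcells X k" and ne: "C \<noteq> P"
    and meets: "C \<inter> xspace X closure_of P \<noteq> {}"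
  shows "k \<noteq> rdim R" "C \<subseteq> xspace X closure_of P"
proof -
  define T S f m K where defs: "T = xspace X" "S = rspace R" "f = xmap X" "m = rdim R" "K = T closure_of P"
  note X = chartedD[OF X, folded defs(1-4)] and R' = finite_subdivision_ruleD[OF R, folded defs(1-4)]
  have Kcpt: "compactin T K" using X(8)[of P] P defs by simp
  have PK: "P \<subseteq> K" using X(7)[of P m] P closure_of_subset defs by fastforce
  have KT: "K \<subseteq> topspace T" using compactin_subset_topspace[OF Kcpt] .
  have HS: "Hausdorff_space S" using cw_complexD(1)[OF R'(1)] .
  define Q where "Q = f ` P"
  have Q: "Q \<in> rcells R m" using X(5) P by (simp add: Q_def defs)
  obtain D \<psi> where D: "tile_structure m D" and \<psi>: "continuous_map (cdisk m) S \<psi>"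
    and \<psi>Q: "\<psi> ` disk_interior m = Q"
    and \<psi>D: "homeomorphic_on_cells (cdisk m) D S (rcells R) \<psi>"
    using R'(10)[OF Q] by (elim exE conjE)
  have cwD: "cw_complex (cdisk m) D" and Dm: "D m = {disk_interior m}"
    using D by (auto simp: tile_structure_def)
  have \<psi>cell: "\<psi> ` e \<in> rcells R k" if "e \<in> D k" for e k
    by (rule homeomorphic_cell_image(1)[OF _ _ \<psi>D that])
      (use cw_complexD(4)[OF cwD] cw_complexD(4)[OF R'(1)] in blast)+
  define inverse_on where "inverse_on = (\<lambda>C h. homeomorphic_maps (subtopology T C) (subtopology S (f ` C)) f h)"
  have inv: "\<exists>h. inverse_on C h" if "C \<in> xcells X k" for C k
    using X(6)[OF that] unfolding inverse_on_def homeomorphic_map_maps by blast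
  have inv_cont: "continuous_map (subtopology S (f ` C)) T h"
    and inv_in: "\<And>b. b \<in> f ` C \<Longrightarrow> h b \<in> C"
    and inv_left: "\<And>y. y \<in> C \<Longrightarrow> h (f y) = y"
    and inv_right: "\<And>b. b \<in> f ` C \<Longrightarrow> f (h b) = b"
    if h: "inverse_on C h" and "C \<in> xcells X k" for C k h
  proof -
    have sub: "C \<subseteq> topspace T" "f ` C \<subseteq> topspace S"
      using X(7)[OF that(2)] X(5)[OF that(2)] cw_complexD(4)[OF R'(1)] by auto
    show "continuous_map (subtopology S (f ` C)) T h"
      using h unfolding inverse_on_def homeomorphic_maps_def continuous_map_in_subtopology by blast
    show "\<And>b. b \<in> f ` C \<Longrightarrow> h b \<in> C"  "\<And>y. y \<in> C \<Longrightarrow> h (f y) = y" "\<And>b. b \<in> f ` C \<Longrightarrow> f (h b) = b"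
      using h sub unfolding inverse_on_def homeomorphic_maps_def continuous_map_in_subtopology by auto
  qed
  obtain h where h: "inverse_on P h" using inv P defs by blast
  note hP = inv_cont[OF h P[folded defs]] inv_in[OF h P[folded defs]] inv_left[OF h P[folded defs]] inv_right[OF h P[folded defs]]
  define g where "g = h \<circ> \<psi>"
  have gc: "continuous_map (subtopology (cdisk m) (disk_interior m)) T g"
    unfolding g_def
  proof (rule continuous_map_compose)
    show "continuous_map (subtopology (cdisk m) (disk_interior m)) (subtopology S (f ` P)) \<psi>"
      using \<psi> \<psi>Q by (auto simp: continuous_map_in_subtopology Q_def continuous_map_from_subtopology)
  qed (rule hP(1))
  have gP: "g ` disk_interior m = P"
  proof -
    have "g ` disk_interior m = h ` f ` P" using \<psi>Q unfolding g_def Q_def image_comp[symmetric] by (rule arg_cong)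
    also have "\<dots> = P" using hP(3) by (force simp: image_image)
    finally show ?thesis .
  qed
  have fg: "f (g r) = \<psi> r" if "r \<in> disk_interior m" for r
  proof -
    have "\<psi> r \<in> f ` P" using \<psi>Q that unfolding Q_def by blast
    then show ?thesis using hP(4) by (simp add: g_def)
  qed
  let ?XY = "prod_topology (cdisk m) T"
  let ?G = "(\<lambda>r. (r, g r)) ` disk_interior m"
  define Z where "Z = ?XY closure_of ?G"
  have G_sub: "?G \<subseteq> topspace (cdisk m) \<times> K"
    using disk_interior_subset gP PK by blast
  have Zsub: "Z \<subseteq> topspace (cdisk m) \<times> K"
    unfolding Z_def
  proof (rule closure_of_minimal[OF G_sub])
    show "closedin ?XY (topspace (cdisk m) \<times> K)"
      by (simp add: closedin_prod_Times_iff defs)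
  qed
  have Zcpt: "compactin ?XY Z"
  proof (rule closed_compactin[OF _ Zsub])
    show "compactin ?XY (topspace (cdisk m) \<times> K)"
      using compact_space_cdisk Kcpt by (simp add: compactin_Times compact_space_def)
  qed (simp add: Z_def)
  have GZ: "(r, g r) \<in> Z" if "r \<in> disk_interior m" for r
  proof -
    have "?G \<subseteq> topspace ?XY" using G_sub KT by auto
    then show ?thesis using closure_of_subset[of ?G ?XY] that by (auto simp: Z_def)
  qed
  have Zf: "f y = \<psi> r" if "(r, y) \<in> Z" for r y
  proof -
    have "closedin ?XY {p \<in> topspace ?XY. (f \<circ> snd) p = (\<psi> \<circ> fst) p}"
      by (rule closedin_continuous_maps_eq[OF HS continuous_map_compose[OF continuous_map_snd X(2)]
            continuous_map_compose[OF continuous_map_fst \<psi>]])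
    moreover have "?G \<subseteq> {p \<in> topspace ?XY. (f \<circ> snd) p = (\<psi> \<circ> fst) p}"
      using G_sub KT fg by auto
    ultimately have "Z \<subseteq> {p \<in> topspace ?XY. (f \<circ> snd) p = (\<psi> \<circ> fst) p}"
      unfolding Z_def by (rule closure_of_minimal[rotated])
    then show ?thesis using that by auto
  qed
  have Zint: "y = g r" if "(r, y) \<in> Z" "r \<in> disk_interior m" for r y
  proof (rule ccontr)
    assume "y \<noteq> g r"
    moreover have "y \<in> topspace T" "g r \<in> topspace T"
      using that Zsub KT GZ by blast+
    ultimately obtain U V where UV: "openin T U" "openin T V" "y \<in> U" "g r \<in> V" "disjnt U V"
      using X(1) unfolding Hausdorff_space_def by blast
    let ?W = "{s \<in> topspace (subtopology (cdisk m) (disk_interior m)). g s \<in> V}"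
    have "openin (subtopology (cdisk m) (disk_interior m)) ?W"
      using gc UV(2) by (rule openin_continuous_map_preimage)
    then have W: "openin (cdisk m) ?W" using openin_disk_interior openin_trans_full by blast
    have "openin ?XY (?W \<times> U)" using W UV(1) by (simp add: openin_prod_Times_iff)
    moreover have "(r, y) \<in> ?W \<times> U" using that UV disk_interior_subset by auto
    ultimately have "\<exists>p\<in>?G. p \<in> ?W \<times> U"
      using closure_of_meets[OF that(1)[unfolded Z_def]] by blast
    then show False using UV(5) by (auto simp: disjnt_def)
  qed
  have Zfst: "\<exists>y. (r, y) \<in> Z" if "r \<in> topspace (cdisk m)" for r
  proof -
    have "compactin (cdisk m) (fst ` Z)" using Zcpt image_compactin continuous_map_fst by blast
    then have "closedin (cdisk m) (fst ` Z)" using Hausdorff_space_cdisk compactin_imp_closedin by blast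
    moreover have "disk_interior m \<subseteq> fst ` Z" using GZ by force
    ultimately have "cdisk m closure_of disk_interior m \<subseteq> fst ` Z" by (rule closure_of_minimal[rotated])
    then show ?thesis using that disk_interior_dense by force
  qed
  have Zsnd: "\<exists>r. (r, y) \<in> Z" if "y \<in> K" for y
  proof -
    have "compactin T (snd ` Z)" using Zcpt image_compactin continuous_map_snd by blast
    then have "closedin T (snd ` Z)" using X(1) compactin_imp_closedin by blast
    moreover have "P \<subseteq> snd ` Z" using GZ gP by force
    ultimately have "K \<subseteq> snd ` Z" unfolding defs by (rule closure_of_minimal[rotated])
    then show ?thesis using that by force
  qed
  \<comment> \<open>A point \<open>q\<close> of the disk over the given point \<open>x\<close> of \<open>C\<close>; the cell \<open>d\<close> of \<open>q\<close> lies over \<open>C\<close>.\<close>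
  obtain x where x: "x \<in> C" "x \<in> K" using meets defs by blast
  obtain q where q: "(q, x) \<in> Z" using Zsnd x by blast
  have qint: "q \<notin> disk_interior m"
  proof
    assume "q \<in> disk_interior m"
    then have "x \<in> P" using Zint[OF q] gP by blast
    then show False using X(4)[OF C P] x ne by blast
  qed
  have "q \<in> topspace (cdisk m)" using q Zsub by blast
  then obtain d j where d: "d \<in> D j" "q \<in> d"
    using cw_complexD(2)[OF cwD, symmetric] by (auto simp: all_cells_def)
  have "j \<noteq> m" using d Dm qint by auto
  define B where "B = f ` C"
  have B: "B \<in> rcells R k" using X(5)[OF C] by (simp add: B_def)
  have "f x = \<psi> q" using Zf q by simp
  then have "\<psi> ` d \<inter> B \<noteq> {}" using d(2) x(1) unfolding B_def by (metis IntI empty_iff imageI)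
  then have jk: "j = k" and \<psi>d: "\<psi> ` d = B"
    using cw_complexD(3)[OF R'(1) \<psi>cell[OF d(1)] B] by blast+
  show "k \<noteq> rdim R" using jk \<open>j \<noteq> m\<close> by (simp add: defs)
  \<comment> \<open>\<open>CC\<close> collects the cells over \<open>B\<close> in which \<open>g\<close> can cluster along \<open>d\<close>; \<open>E C'\<close> is the set of points of \<open>d\<close>
    where it clusters in \<open>C'\<close>. These sets partition \<open>d\<close> into finitely many closed sets.\<close>
  define CC where "CC = {C' \<in> all_cells (xcells X). C' \<inter> K \<noteq> {} \<and> f ` C' = B}"
  have finCC: "finite CC" using X(9)[of P] P by (auto simp: CC_def defs intro: finite_subset[rotated])
  have "\<exists>h. \<forall>C'\<in>CC. inverse_on C' (h C')"
    using inv by (intro bchoice) (auto simp: CC_def all_cells_def)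
  then obtain hh where hh: "\<And>C'. C' \<in> CC \<Longrightarrow> inverse_on C' (hh C')" by blast
  have CCcell: "\<exists>k. C' \<in> xcells X k" and CCB: "f ` C' = B" if "C' \<in> CC" for C'
    using that by (auto simp: CC_def all_cells_def)
  have fibre: "\<exists>C'\<in>CC. y = hh C' (\<psi> r) \<and> y \<in> C'" if "r \<in> d" "(r, y) \<in> Z" for r y
  proof -
    have yK: "y \<in> K" using that Zsub by blast
    then obtain C' k' where C': "C' \<in> xcells X k'" "y \<in> C'"
      using X(3)[symmetric] KT by (auto simp: all_cells_def)
    have "f y \<in> B" using Zf[OF that(2)] that(1) \<psi>d by auto
    then have "f ` C' = B"
      using cw_complexD(3)[OF R'(1) X(5)[OF C'(1)] B] C'(2) by blast
    then have "C' \<in> CC" using C' yK by (auto simp: CC_def all_cells_def)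
    moreover have "hh C' (f y) = y" using inv_left[OF hh[OF \<open>C' \<in> CC\<close>] C'(1) C'(2)] .
    ultimately show ?thesis using Zf[OF that(2)] C'(2) by auto
  qed
  have uniq: "y1 = y2" if "r \<in> d" "(r, y1) \<in> Z" "(r, y2) \<in> Z" for r y1 y2
  proof (rule disk_cluster_connected[OF X(1) gc Zcpt _ GZ _ that(2,3)])
    have "{y. (r, y) \<in> Z} \<subseteq> (\<lambda>C'. hh C' (\<psi> r)) ` CC" using fibre[OF that(1)] by blast
    then show "finite {y. (r, y) \<in> Z}" using finCC finite_surj by blast
  qed (simp add: Z_def)
  define E where "E = (\<lambda>C'. {r \<in> d. (r, hh C' (\<psi> r)) \<in> Z})"
  let ?d = "subtopology (cdisk m) d"
  have dtop: "topspace ?d = d" using cw_complexD(4)[OF cwD d(1)] by (simp add: inf.absorb2)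
  have Eclosed: "closedin ?d (E C')" if C': "C' \<in> CC" for C'
  proof -
    have "continuous_map ?d (subtopology S (f ` C')) \<psi>"
      using \<psi> \<psi>d CCB[OF C'] by (auto simp: continuous_map_in_subtopology continuous_map_from_subtopology)
    then have "continuous_map ?d T (hh C' \<circ> \<psi>)"
      using CCcell[OF C'] inv_cont[OF hh[OF C']] continuous_map_compose by blast
    then have "continuous_map ?d ?XY (\<lambda>r. (r, (hh C' \<circ> \<psi>) r))"
      by (rule continuous_map_pairedI[OF continuous_map_from_subtopology[OF continuous_map_id[unfolded id_def]]])
    then have "closedin ?d {r \<in> topspace ?d. (r, (hh C' \<circ> \<psi>) r) \<in> Z}"
      by (rule closedin_continuous_map_preimage) (simp add: Z_def)
    then show ?thesis by (simp only: dtop E_def o_def)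
  qed
  have Ecover: "d = \<Union>(E ` CC)"
  proof -
    have "r \<in> \<Union>(E ` CC)" if "r \<in> d" for r
    proof -
      have "r \<in> topspace (cdisk m)" using that cw_complexD(4)[OF cwD d(1)] by blast
      then obtain y where "(r, y) \<in> Z" using Zfst by blast
      then show ?thesis using fibre[OF that] that unfolding E_def by blast
    qed
    then show ?thesis by (auto simp: E_def)
  qed
  have Edisj: "C1 = C2" if r: "r \<in> E C1" "r \<in> E C2" and C12: "C1 \<in> CC" "C2 \<in> CC" for r C1 C2
  proof -
    have "r \<in> d" and eq: "hh C1 (\<psi> r) = hh C2 (\<psi> r)" using r uniq by (auto simp: E_def)
    then have "\<psi> r \<in> f ` C1" "\<psi> r \<in> f ` C2" using \<psi>d CCB C12 by auto
    then have "hh C1 (\<psi> r) \<in> C1" "hh C2 (\<psi> r) \<in> C2"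
      using CCcell C12 inv_in[OF hh[OF C12(1)]] inv_in[OF hh[OF C12(2)]] by blast+
    then show ?thesis using eq CCcell[OF C12(1)] CCcell[OF C12(2)] X(4) by (metis IntI empty_iff)
  qed
  have CinCC: "C \<in> CC" using C x by (auto simp: CC_def all_cells_def B_def)
  have "q \<in> E C"
    using d(2) q inv_left[OF hh[OF CinCC] C x(1)] \<open>f x = \<psi> q\<close> by (auto simp: E_def)
  have "E C = d"
  proof -
    have 1: "closedin ?d (E C)" using Eclosed CinCC .
    have "closedin ?d (\<Union>(E ` (CC - {C})))" using finCC Eclosed by (intro closedin_Union) auto
    moreover have "d - E C = \<Union>(E ` (CC - {C}))"
    proof
      show "d - E C \<subseteq> \<Union>(E ` (CC - {C}))" using Ecover by blast
      show "\<Union>(E ` (CC - {C})) \<subseteq> d - E C" using Edisj CinCC by (auto simp: E_def)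
    qed
    ultimately have "closedin ?d (topspace ?d - E C)" using dtop by simp
    then have "openin ?d (E C)" using closedin_subset[OF 1] by (simp add: openin_closedin_eq)
    moreover have "connected_space ?d" using cw_complex_cell_connected(1)[OF cwD d(1)] by (simp add: connectedin_def)
    ultimately show ?thesis
      using 1 \<open>q \<in> E C\<close> dtop unfolding connected_space_clopen_in by blast
  qed
  show "C \<subseteq> xspace X closure_of P"
  proof
    fix y assume y: "y \<in> C"
    then have "f y \<in> \<psi> ` d" using \<psi>d B_def by simp
    then obtain r where r: "r \<in> d" "\<psi> r = f y" by auto
    then have "r \<in> E C" using \<open>E C = d\<close> by simp
    then have "(r, hh C (\<psi> r)) \<in> Z" by (simp add: E_def)
    then have "(r, y) \<in> Z" using r inv_left[OF hh[OF CinCC] C y] by simp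
    then show "y \<in> xspace X closure_of P" using Zsub defs by blast
  qed
qed

lemma cell_in_cell_dimension_le:
  assumes S: "cw_complex S D" and S': "cw_complex S C" and c: "c \<in> C j" and e: "e \<in> D k" and sub: "c \<subseteq> e"
  shows "j \<le> k"
proof -
  obtain \<Phi> where \<Phi>: "homeomorphic_map (subtopology (cdisk j) (disk_interior j)) (subtopology S c) \<Phi>"
     "\<Phi> ` disk_interior j = c"
    using cw_complex_cell_homeomorphic[OF S' c] by blast
  obtain \<Psi> where "homeomorphic_map (subtopology (cdisk k) (disk_interior k)) (subtopology S e) \<Psi>"
    using cw_complex_cell_homeomorphic[OF S e] by blast
  then obtain \<Psi>' where \<Psi>': "homeomorphic_maps (subtopology (cdisk k) (disk_interior k)) (subtopology S e) \<Psi> \<Psi>'"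
    using homeomorphic_map_maps by blast
  have etop: "topspace (subtopology S e) = e" using cw_complexD(4)[OF S e] by (simp add: inf.absorb2)
  have "continuous_map (subtopology (cdisk j) (disk_interior j)) (subtopology S e) \<Phi>"
    using homeomorphic_imp_continuous_map[OF \<Phi>(1)] sub by (auto simp: continuous_map_in_subtopology)
  moreover have "continuous_map (subtopology S e) (cdisk k) \<Psi>'"
    using \<Psi>' by (auto simp: homeomorphic_maps_def continuous_map_in_subtopology)
  ultimately have "continuous_map (subtopology (cdisk j) (disk_interior j)) (cdisk k) (\<Psi>' \<circ> \<Phi>)"
    by (rule continuous_map_compose)
  moreover have "inj_on (\<Psi>' \<circ> \<Phi>) (disk_interior j)"
  proof (rule comp_inj_on)
    show "inj_on \<Phi> (disk_interior j)"
      using homeomorphic_imp_injective_map[OF \<Phi>(1)] disk_interior_subset by (simp add: inf.absorb2)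
    have "\<Psi> (\<Psi>' y) = y" if "y \<in> e" for y
      using \<Psi>' that etop unfolding homeomorphic_maps_def by blast
    then have "inj_on \<Psi>' e" by (metis inj_onI)
    then show "inj_on \<Psi>' (\<Phi> ` disk_interior j)" using \<Phi>(2) sub inj_on_subset by blast
  qed
  ultimately show ?thesis by (rule cell_dimension_le)
qed

section \<open>Tiles and their parents\<close>

lemma subdivide_simps [simp]:
  "xspace (subdivide R X) = xspace X"
  "xmap (subdivide R X) = rmap R \<circ> xmap X"
  "xcells (subdivide R X) k = {e \<inter> xmap X -` c | e c.
     e \<in> all_cells (xcells X) \<and> c \<in> rsub R k \<and> c \<subseteq> xmap X ` e}"
  by (simp_all add: subdivide_def)

lemma subdivide_cellE:
  assumes "u \<in> xcells (subdivide R X) k"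
  obtains e c j where "u = e \<inter> xmap X -` c" "e \<in> xcells X j" "c \<in> rsub R k" "c \<subseteq> xmap X ` e"
  using assms by (auto simp: all_cells_def)

lemma charted_cell_nonempty:
  assumes "finite_subdivision_rule R" "charted R X" "e \<in> xcells X k"
  shows "e \<noteq> {}"
  using cw_complex_cell_connected(2)[OF finite_subdivision_ruleD(1)[OF assms(1)] chartedD(5)[OF assms(2,3)]] by blast

lemma subdivide_cell_homeomorphic:
  assumes R: "finite_subdivision_rule R" and X: "charted R X"
    and e: "e \<in> xcells X j" and c: "c \<in> rsub R k" and sub: "c \<subseteq> xmap X ` e"
  shows "xmap X ` (e \<inter> xmap X -` c) = c"
    "homeomorphic_map (subtopology (xspace X) (e \<inter> xmap X -` c)) (subtopology (rspace R) (rmap R ` c))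
       (rmap R \<circ> xmap X)"
proof -
  let ?f = "xmap X"
  show img: "?f ` (e \<inter> ?f -` c) = c" using sub by auto
  have e': "e \<subseteq> topspace (xspace X)" using chartedD(7)[OF X e] .
  have fe: "?f ` e \<subseteq> topspace (rspace R)"
    using cw_complexD(4)[OF finite_subdivision_ruleD(1)[OF R] chartedD(5)[OF X e]] .
  have "?f ` (topspace (subtopology (xspace X) e) \<inter> ?f -` c) = topspace (subtopology (rspace R) (?f ` e)) \<inter> c"
    using img e' fe sub by (simp add: inf.absorb2)
  then have "homeomorphic_map (subtopology (subtopology (xspace X) e) (?f -` c))
      (subtopology (subtopology (rspace R) (?f ` e)) c) ?f"
    by (rule homeomorphic_map_subtopologies[OF chartedD(6)[OF X e]])
  then have "homeomorphic_map (subtopology (xspace X) (e \<inter> ?f -` c)) (subtopology (rspace R) c) ?f"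
    using sub by (simp add: subtopology_subtopology inf.absorb2)
  then show "homeomorphic_map (subtopology (xspace X) (e \<inter> ?f -` c)) (subtopology (rspace R) (rmap R ` c))
       (rmap R \<circ> ?f)"
    using finite_subdivision_ruleD(8)[OF R c] by (rule homeomorphic_map_compose)
qed

lemma subdivide_cell_parent_dimension:
  assumes R: "finite_subdivision_rule R" and X: "charted R X"
    and e: "e \<in> xcells X j" and c: "c \<in> rsub R k" and sub: "c \<subseteq> xmap X ` e"
  shows "k \<le> j" "j \<le> rdim R"
proof -
  show "k \<le> j"
    using cell_in_cell_dimension_le[OF finite_subdivision_ruleD(1)[OF R] finite_subdivision_ruleD(2)[OF R] c chartedD(5)[OF X e] sub] .
  show "j \<le> rdim R"
    using finite_subdivision_ruleD(4)[OF R, of j] chartedD(5)[OF X e] by (metis empty_iff not_le)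
qed

text \<open>A tile of the subdivision lies in a tile of \<open>X\<close>, so its closure inherits compactness, and the finitely
  many cells that meet the larger closure have finitely many subcells.\<close>

lemma charted_subdivide:
  assumes R: "finite_subdivision_rule R" and X: "charted R X"
  shows "charted R (subdivide R X)"
proof -
  let ?f = "xmap X" and ?X = "subdivide R X" and ?T = "xspace X"
  note S = cw_complexD[OF finite_subdivision_ruleD(1)[OF R]] and S' = cw_complexD[OF finite_subdivision_ruleD(2)[OF R]]
  have cells: "xmap ?X ` u \<in> rcells R k \<and>
        homeomorphic_map (subtopology (xspace ?X) u) (subtopology (rspace R) (xmap ?X ` u)) (xmap ?X)"
    if u: "u \<in> xcells ?X k" for u k
    using u
  proof (rule subdivide_cellE)
    fix e c j assume *: "u = e \<inter> ?f -` c" "e \<in> xcells X j" "c \<in> rsub R k" "c \<subseteq> ?f ` e"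
    have "xmap ?X ` u = rmap R ` c"
      unfolding *(1) subdivide_simps(2) image_comp[symmetric]
        subdivide_cell_homeomorphic(1)[OF R X *(2-4)] ..
    then show ?thesis
      using subdivide_cell_homeomorphic(2)[OF R X *(2-4)] *(1) finite_subdivision_ruleD(7)[OF R *(3)] by simp
  qed
  have cover: "\<Union>(all_cells (xcells ?X)) = topspace (xspace ?X)"
  proof
    show "\<Union>(all_cells (xcells ?X)) \<subseteq> topspace (xspace ?X)"
      using chartedD(7)[OF X] by (fastforce simp: all_cells_def)
    show "topspace (xspace ?X) \<subseteq> \<Union>(all_cells (xcells ?X))"
    proof
      fix x assume "x \<in> topspace (xspace ?X)"
      then obtain e j where e: "e \<in> xcells X j" "x \<in> e"
        using chartedD(3)[OF X, symmetric] by (auto simp: all_cells_def)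
      note fe = chartedD(5)[OF X e(1)]
      have "?f x \<in> topspace (rspace R)" using S(4)[OF fe] e(2) by blast
      then obtain c k where c: "c \<in> rsub R k" "?f x \<in> c"
        using S'(2)[symmetric] by (auto simp: all_cells_def)
      then have "c \<in> all_cells (rsub R)" by (auto simp: all_cells_def)
      then obtain b i where b: "b \<in> rcells R i" "c \<subseteq> b"
        using finite_subdivision_ruleD(5)[OF R, of c] unfolding all_cells_def by blast
      have "b \<inter> ?f ` e \<noteq> {}" using b c e by blast
      then have "b = ?f ` e" using S(3)[OF b(1) fe] by blast
      then have "e \<inter> ?f -` c \<in> xcells ?X k" using b c e(1) by (auto simp: all_cells_def)
      then have "e \<inter> ?f -` c \<in> all_cells (xcells ?X)" unfolding all_cells_def by blast
      moreover have "x \<in> e \<inter> ?f -` c" using e c by simp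
      ultimately show "x \<in> \<Union>(all_cells (xcells ?X))" by blast
    qed
  qed
  have disj: "d \<inter> e = {}" if d: "d \<in> xcells ?X j" and e: "e \<in> xcells ?X k" and ne: "(j, d) \<noteq> (k, e)" for j k d e
  proof (rule ccontr)
    assume "d \<inter> e \<noteq> {}"
    then obtain x where x: "x \<in> d" "x \<in> e" by blast
    obtain a b i where d': "d = a \<inter> ?f -` b" "a \<in> xcells X i" "b \<in> rsub R j" using d by (rule subdivide_cellE)
    obtain a' b' i' where e': "e = a' \<inter> ?f -` b'" "a' \<in> xcells X i'" "b' \<in> rsub R k" using e by (rule subdivide_cellE)
    have "a = a'" using chartedD(4)[OF X d'(2) e'(2)] x d'(1) e'(1) by blast
    moreover have "j = k \<and> b = b'" using S'(3)[OF d'(3) e'(3)] x d'(1) e'(1) by blast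
    ultimately show False using ne d'(1) e'(1) by simp
  qed
  have top: "compactin ?T (?T closure_of u)" "finite {e \<in> all_cells (xcells ?X). e \<inter> ?T closure_of u \<noteq> {}}"
    if u: "u \<in> xcells ?X (rdim R)" for u
  proof -
    obtain e c j where *: "u = e \<inter> ?f -` c" "e \<in> xcells X j" "c \<in> rsub R (rdim R)" "c \<subseteq> ?f ` e"
      using u by (rule subdivide_cellE)
    have "j = rdim R" using subdivide_cell_parent_dimension[OF R X *(2-4)] by simp
    then have e: "e \<in> xcells X (rdim R)" using *(2) by simp
    have mono: "?T closure_of u \<subseteq> ?T closure_of e" using *(1) by (intro closure_of_mono) blast
    show "compactin ?T (?T closure_of u)"
      by (rule closed_compactin[OF chartedD(8)[OF X e] mono closedin_closure_of])
    let ?E = "{d \<in> all_cells (xcells X). d \<inter> ?T closure_of e \<noteq> {}}"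
    have "{d \<in> all_cells (xcells ?X). d \<inter> ?T closure_of u \<noteq> {}}
        \<subseteq> (\<lambda>(a, b). a \<inter> ?f -` b) ` (?E \<times> all_cells (rsub R))"
    proof
      fix d assume "d \<in> {d \<in> all_cells (xcells ?X). d \<inter> ?T closure_of u \<noteq> {}}"
      then obtain k where d: "d \<in> xcells ?X k" "d \<inter> ?T closure_of u \<noteq> {}" by (auto simp: all_cells_def)
      obtain a b i where d': "d = a \<inter> ?f -` b" "a \<in> xcells X i" "b \<in> rsub R k" using d(1) by (rule subdivide_cellE)
      have "a \<inter> ?T closure_of e \<noteq> {}" using d(2) d'(1) mono by blast
      then have "a \<in> ?E" using d'(2) by (auto simp: all_cells_def)
      moreover have "b \<in> all_cells (rsub R)" using d'(3) by (auto simp: all_cells_def)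
      ultimately show "d \<in> (\<lambda>(a, b). a \<inter> ?f -` b) ` (?E \<times> all_cells (rsub R))"
        using d'(1) by (intro image_eqI[of _ _ "(a, b)"]) auto
    qed
    moreover have "finite ((\<lambda>(a, b). a \<inter> ?f -` b) ` (?E \<times> all_cells (rsub R)))"
      using chartedD(9)[OF X e] finite_subdivision_ruleD(3)[OF R] by (intro finite_imageI finite_cartesian_product)
    ultimately show "finite {e \<in> all_cells (xcells ?X). e \<inter> ?T closure_of u \<noteq> {}}"
      by (rule finite_subset)
  qed
  have cont: "continuous_map (xspace ?X) (rspace R) (xmap ?X)"
    using continuous_map_compose[OF chartedD(2)[OF X] finite_subdivision_ruleD(6)[OF R]] by simp
  show ?thesis
    unfolding charted_def
  proof (intro conjI allI ballI impI)
    show "Hausdorff_space (xspace ?X)" using chartedD(1)[OF X] by simp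
    fix P assume P: "P \<in> xcells ?X (rdim R)"
    show "compactin (xspace ?X) (xspace ?X closure_of P)"
      unfolding subdivide_simps(1) by (rule top(1)[OF P])
    show "finite {e \<in> all_cells (xcells ?X). e \<inter> xspace ?X closure_of P \<noteq> {}}"
      unfolding subdivide_simps(1) by (rule top(2)[OF P])
  next
    show "d \<inter> e = {}" if "d \<in> xcells ?X j" "e \<in> xcells ?X k" "(j, d) \<noteq> (k, e)" for j k d e
      by (rule disj[OF that])
  next
    show "xmap ?X ` u \<in> rcells R k" if "u \<in> xcells ?X k" for u k using cells[OF that] by (rule conjunct1)
    show "homeomorphic_map (subtopology (xspace ?X) u) (subtopology (rspace R) (xmap ?X ` u)) (xmap ?X)"
      if "u \<in> xcells ?X k" for u k using cells[OF that] by (rule conjunct2)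
  qed (fact cont cover)+
qed

lemma charted_subdivide_n:
  assumes "finite_subdivision_rule R" "r_complex R X"
  shows "charted R (subdivide_n R n X)"
  by (induction n) (use assms r_complex_charted charted_subdivide in auto)

lemma tile_parent:
  assumes R: "finite_subdivision_rule R" and X: "charted R X" and d: "d \<in> tiles R (subdivide R X)"
  shows "\<exists>P\<in>tiles R X. d \<subseteq> P"
proof -
  have "d \<in> xcells (subdivide R X) (rdim R)" and nonideal: "xmap (subdivide R X) ` d \<notin> rideal R"
    using d by (simp_all add: tiles_def)
  from this(1) obtain e c j where *: "d = e \<inter> xmap X -` c" "e \<in> xcells X j" "c \<in> rsub R (rdim R)" "c \<subseteq> xmap X ` e"
    by (rule subdivide_cellE)
  have "j = rdim R" using subdivide_cell_parent_dimension[OF R X *(2-4)] by simp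
  moreover have "xmap X ` e \<notin> rideal R"
  proof
    assume "xmap X ` e \<in> rideal R"
    then have "rmap R ` c \<in> rideal R" using finite_subdivision_ruleD(9)[OF R _ *(3,4)] by blast
    moreover have "xmap (subdivide R X) ` d = rmap R ` c"
      unfolding *(1) subdivide_simps(2) image_comp[symmetric]
        subdivide_cell_homeomorphic(1)[OF R X *(2-4)] ..
    ultimately show False using nonideal by simp
  qed
  ultimately show ?thesis using *(1,2) by (auto simp: tiles_def)
qed

lemma tiles_disjoint:
  assumes "charted R X" "d \<in> tiles R X" "e \<in> tiles R X" "d \<inter> e \<noteq> {}"
  shows "d = e"
proof -
  have "d \<in> xcells X (rdim R)" "e \<in> xcells X (rdim R)" using assms(2,3) by (simp_all add: tiles_def)
  then show ?thesis using chartedD(4)[OF assms(1)] assms(4) by metis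
qed

lemma tile_nonempty:
  assumes "finite_subdivision_rule R" "charted R X" "d \<in> tiles R X"
  shows "d \<noteq> {}"
  using charted_cell_nonempty[OF assms(1,2)] assms(3) by (auto simp: tiles_def)

text \<open>The common face \<open>c\<close> lies in a cell \<open>C\<close> of \<open>X\<close> that meets the closures of both parents. The dimension of
  \<open>C\<close> is at least that of \<open>c\<close> by invariance of domain, and \<open>C\<close> is not a tile, since a tile does
  not meet the closure of a different tile. So \<open>C\<close> is a face, and it is contained in both closures.\<close>

lemma adjacent_tile_parents:
  assumes R: "finite_subdivision_rule R" and X: "charted R X"
    and de: "(d, e) \<in> gedges (dual_graph R (subdivide R X))"
    and P: "P \<in> tiles R X" "d \<subseteq> P" and Q: "Q \<in> tiles R X" "e \<subseteq> Q" and ne: "P \<noteq> Q"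
  shows "(P, Q) \<in> gedges (dual_graph R X)"
proof -
  obtain k c where k: "Suc k = rdim R" and c: "c \<in> xcells (subdivide R X) k"
    and csub: "c \<subseteq> xspace X closure_of d \<inter> xspace X closure_of e"
    using de unfolding dual_graph_def by auto
  obtain C c0 j where *: "c = C \<inter> xmap X -` c0" "C \<in> xcells X j" "c0 \<in> rsub R k" "c0 \<subseteq> xmap X ` C"
    using c by (rule subdivide_cellE)
  have j: "k \<le> j" "j \<le> rdim R" using subdivide_cell_parent_dimension[OF R X *(2-4)] by auto
  have PQ: "P \<in> xcells X (rdim R)" "Q \<in> xcells X (rdim R)" using P Q by (auto simp: tiles_def)
  have "c \<noteq> {}" using charted_cell_nonempty[OF R charted_subdivide[OF R X] c] .
  moreover have "c \<subseteq> xspace X closure_of P" "c \<subseteq> xspace X closure_of Q"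
    using csub closure_of_mono[OF P(2)] closure_of_mono[OF Q(2)] by blast+
  ultimately have meets: "C \<inter> xspace X closure_of P \<noteq> {}" "C \<inter> xspace X closure_of Q \<noteq> {}"
    using *(1) by blast+
  have "C \<noteq> P \<or> C \<noteq> Q" using ne by blast
  then have "j \<noteq> rdim R"
    using closure_contains_cell(1)[OF R X PQ(1) *(2) _ meets(1)]
      closure_contains_cell(1)[OF R X PQ(2) *(2) _ meets(2)] by blast
  then have "j = k" using j k by simp
  then have C: "C \<in> xcells X k" using *(2) by simp
  have "C \<noteq> P'" if "P' \<in> xcells X (rdim R)" for P'
    using chartedD(4)[OF X C that] charted_cell_nonempty[OF R X C] k by auto
  then have "C \<subseteq> xspace X closure_of P" "C \<subseteq> xspace X closure_of Q"
    using closure_contains_cell(2)[OF R X PQ(1) *(2) _ meets(1)]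
      closure_contains_cell(2)[OF R X PQ(2) *(2) _ meets(2)] PQ by blast+
  then show ?thesis
    using k C P(1) Q(1) ne unfolding dual_graph_def by auto
qed

section \<open>Paths in a set of vertices\<close>

text \<open>Paths of length at most \<open>n\<close> that stay in \<open>W\<close>. An upper bound instead of the exact length makes lengths
  add up under concatenation without any subtraction, and \<open>W = V\<close> gives the balls of the graph.\<close>

definition reach :: "('v \<times> 'v) set \<Rightarrow> 'v set \<Rightarrow> nat \<Rightarrow> 'v \<Rightarrow> 'v \<Rightarrow> bool" where
  "reach E W n u v \<longleftrightarrow> u \<in> W \<and> (\<exists>j\<le>n. (u, v) \<in> (E \<inter> W \<times> W) ^^ j)"

lemma reach_refl: "u \<in> W \<Longrightarrow> reach E W n u u"
  by (auto simp: reach_def intro!: exI[of _ 0])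

lemma reach_edge: "u \<in> W \<Longrightarrow> v \<in> W \<Longrightarrow> (u, v) \<in> E \<Longrightarrow> 1 \<le> n \<Longrightarrow> reach E W n u v"
  by (auto simp: reach_def intro!: exI[of _ 1])

lemma reach_step: "u \<in> W \<Longrightarrow> v \<in> W \<Longrightarrow> u = v \<or> (u, v) \<in> E \<Longrightarrow> reach E W 1 u v"
  using reach_refl reach_edge by fastforce

lemma reach_trans:
  assumes "reach E W m u v" "reach E W n v w"
  shows "reach E W (m + n) u w"
proof -
  obtain i j where "i \<le> m" "(u, v) \<in> (E \<inter> W \<times> W) ^^ i" "j \<le> n" "(v, w) \<in> (E \<inter> W \<times> W) ^^ j"
    using assms by (auto simp: reach_def)
  then have "i + j \<le> m + n" "(u, w) \<in> (E \<inter> W \<times> W) ^^ (i + j)"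
    by (auto simp: relpow_add)
  then show ?thesis using assms(1) unfolding reach_def by blast
qed

lemma reach_mono: "reach E W m u v \<Longrightarrow> m \<le> n \<Longrightarrow> W \<subseteq> W' \<Longrightarrow> reach E W' n u v"
proof -
  assume a: "reach E W m u v" "m \<le> n" "W \<subseteq> W'"
  then obtain j where "j \<le> m" "(u, v) \<in> (E \<inter> W \<times> W) ^^ j" by (auto simp: reach_def)
  moreover have "(E \<inter> W \<times> W) ^^ j \<subseteq> (E \<inter> W' \<times> W') ^^ j"
    by (induction j) (use a in auto)
  ultimately show ?thesis using a unfolding reach_def by (meson order_trans subsetD)
qed

lemma reach_le: "reach E W m u v \<Longrightarrow> m \<le> n \<Longrightarrow> reach E W n u v"
  by (rule reach_mono) auto

lemma reach_subset: "reach E W n u v \<Longrightarrow> W \<subseteq> W' \<Longrightarrow> reach E W' n u v"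
  by (rule reach_mono) auto

lemma reach_in: "reach E W n u v \<Longrightarrow> u \<in> W \<and> v \<in> W"
proof -
  assume "reach E W n u v"
  then obtain j where j: "u \<in> W" "(u, v) \<in> (E \<inter> W \<times> W) ^^ j" by (auto simp: reach_def)
  then show ?thesis by (cases j) auto
qed

lemma reach_induct [consumes 1, case_names refl step]:
  assumes "reach E W n u v"
    and "\<And>n. u \<in> W \<Longrightarrow> P n u"
    and "\<And>n x y. reach E W n u x \<Longrightarrow> P n x \<Longrightarrow> (x, y) \<in> E \<Longrightarrow> x \<in> W \<Longrightarrow> y \<in> W \<Longrightarrow> P (Suc n) y"
  shows "P n v"
proof -
  obtain j where j: "j \<le> n" "u \<in> W" "(u, v) \<in> (E \<inter> W \<times> W) ^^ j"
    using assms(1) by (auto simp: reach_def)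
  from j(1,3) show ?thesis
  proof (induction j arbitrary: v n)
    case 0
    then show ?case using assms(2) j(2) by simp
  next
    case (Suc j)
    then obtain x where x: "(u, x) \<in> (E \<inter> W \<times> W) ^^ j" "(x, v) \<in> E" "x \<in> W" "v \<in> W" by auto
    obtain n' where n': "n = Suc n'" "j \<le> n'" using Suc.prems(1) Suc_le_D by (metis Suc_le_mono)
    then show ?case
      using assms(3)[of n' x v] Suc.IH[OF n'(2) x(1)] x j(2) by (auto simp: reach_def)
  qed
qed

lemma reach_sym:
  assumes "sym E" "reach E W n u v"
  shows "reach E W n v u"
  using assms(2)
proof (induction rule: reach_induct)
  case (step n x y)
  have "reach E W 1 y x" using step assms(1) by (intro reach_step) (auto dest: symD)
  from reach_trans[OF this step.IH] show ?case by simp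
qed (rule reach_refl)

lemma reach_sum: "reach E W m u v \<Longrightarrow> reach E W n v w \<Longrightarrow> m + n \<le> k \<Longrightarrow> reach E W k u w"
  using reach_trans reach_le by metis

text \<open>A map that sends edges to paths of length \<open>c\<close> inside \<open>W'\<close> stretches paths by the factor \<open>c\<close>. All
  comparisons of path lengths in different graphs are instances of this.\<close>

lemma reach_transfer:
  assumes "reach E W n u v"
    and "\<And>a b. a \<in> W \<Longrightarrow> b \<in> W \<Longrightarrow> (a, b) \<in> E \<Longrightarrow> reach E' W' c (\<phi> a) (\<phi> b)"
    and "\<And>a. a \<in> W \<Longrightarrow> \<phi> a \<in> W'"
  shows "reach E' W' (c * n) (\<phi> u) (\<phi> v)"
  using assms(1)
proof (induction rule: reach_induct)
  case (refl n)
  then show ?case using assms(3) reach_refl by metis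
next
  case (step n x y)
  then show ?case using assms(2)[of x y] by (auto intro: reach_sum)
qed

lemma reach_near: "reach E V n u v \<Longrightarrow> reach E {x. reach E V n u x} n u v"
proof -
  assume "reach E V n u v"
  then obtain j where j: "j \<le> n" "u \<in> V" "(u, v) \<in> (E \<inter> V \<times> V) ^^ j" by (auto simp: reach_def)
  have "(u, w) \<in> (E \<inter> {x. reach E V n u x} \<times> {x. reach E V n u x}) ^^ i"
    if "(u, w) \<in> (E \<inter> V \<times> V) ^^ i" "i \<le> n" for w i
    using that
  proof (induction i arbitrary: w)
    case (Suc i)
    then obtain x where x: "(u, x) \<in> (E \<inter> V \<times> V) ^^ i" "(x, w) \<in> E \<inter> V \<times> V" by auto
    have "(u, w) \<in> (E \<inter> V \<times> V) ^^ Suc i" using Suc by blast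
    then have "reach E V n u x" "reach E V n u w"
      using x(1) Suc.prems(2) j(2) unfolding reach_def by (metis Suc_leD, metis)
    then show ?case using Suc.IH[OF x(1)] Suc.prems(2) x(2) by auto
  qed simp
  from this[OF j(3,1)] have "(u, v) \<in> (E \<inter> {x. reach E V n u x} \<times> {x. reach E V n u x}) ^^ j" .
  moreover have "u \<in> {x. reach E V n u x}" using reach_refl[OF j(2)] by simp
  ultimately show ?thesis using j(1) unfolding reach_def[of E "{x. reach E V n u x}"] by blast
qed

lemma reach_crossing:
  assumes "reach E W n z z'" "z \<notin> A" "z' \<in> A"
  obtains i j y y' where "i + j + 1 \<le> n" "reach E W i z y" "y \<notin> A" "y' \<in> A" "(y, y') \<in> E" "reach E W j y' z'"
proof -
  have "z' \<in> A \<longrightarrow> (\<exists>i j y y'. i + j + 1 \<le> n \<and> reach E W i z y \<and> y \<notin> A \<and> y' \<in> A \<and> (y, y') \<in> E \<and> reach E W j y' z')"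
    using assms(1)
  proof (induction rule: reach_induct)
    case (refl n)
    then show ?case using assms(2) by blast
  next
    case (step n x y)
    show ?case
    proof (cases "x \<in> A")
      case True
      then obtain i j a b where "i + j + 1 \<le> n" "reach E W i z a" "a \<notin> A" "b \<in> A" "(a, b) \<in> E" "reach E W j b x"
        using step by blast
      moreover from this have "reach E W (j + 1) b y"
        using step reach_trans[of E W j b x 1 y] reach_step[of x W y E] by blast
      ultimately show ?thesis
        by (intro impI exI[of _ i] exI[of _ "j + 1"] exI[of _ a] exI[of _ b]) auto
    next
      case False
      then show ?thesis
        using step reach_refl[of y W E 0] by (intro impI exI[of _ n] exI[of _ 0] exI[of _ x] exI[of _ y]) auto
    qed
  qed
  then show thesis using assms(3) that by blast
qed

section \<open>Leveled graphs and shadows\<close>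

text \<open>The history graph, stripped of its topology. The last axiom says that ancestry is 1-Lipschitz.\<close>

locale leveled_graph =
  fixes V :: "'v set" and E :: "('v \<times> 'v) set" and lev :: "'v \<Rightarrow> nat" and par :: "'v \<Rightarrow> 'v"
  assumes E_sub: "E \<subseteq> V \<times> V" and symE: "sym E"
    and par: "v \<in> V \<Longrightarrow> 0 < lev v \<Longrightarrow> par v \<in> V \<and> lev v = Suc (lev (par v)) \<and> (v, par v) \<in> E"
    and origin_unique: "u \<in> V \<Longrightarrow> v \<in> V \<Longrightarrow> lev u = 0 \<Longrightarrow> lev v = 0 \<Longrightarrow> u = v"
    and edge_levels: "(u, v) \<in> E \<Longrightarrow> lev u \<le> lev v \<Longrightarrow> lev u = lev v \<or> u = par v \<and> 0 < lev v"
    and edge_parents: "(u, v) \<in> E \<Longrightarrow> lev u = lev v \<Longrightarrow> 0 < lev v \<Longrightarrow> par u = par v \<or> (par u, par v) \<in> E"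
begin

abbreviation near :: "nat \<Rightarrow> 'v \<Rightarrow> 'v \<Rightarrow> bool" where
  "near \<equiv> reach E V"

text \<open>Vertices of level at most \<open>l\<close> are fixed, so \<open>anc l\<close> caps the levels along a path at \<open>l\<close>.\<close>

definition anc :: "nat \<Rightarrow> 'v \<Rightarrow> 'v" where
  "anc l v = (par ^^ (lev v - l)) v"

lemma funpow_par: "v \<in> V \<Longrightarrow> i \<le> lev v \<Longrightarrow> (par ^^ i) v \<in> V \<and> lev ((par ^^ i) v) = lev v - i"
proof (induction i)
  case (Suc i)
  then have "(par ^^ i) v \<in> V" "lev ((par ^^ i) v) = lev v - i" by auto
  then show ?case using par[of "(par ^^ i) v"] Suc.prems by auto
qed simp

lemma anc_in: "v \<in> V \<Longrightarrow> anc l v \<in> V"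
  using funpow_par[of v "lev v - l"] by (simp add: anc_def)

lemma lev_anc: "v \<in> V \<Longrightarrow> lev (anc l v) = min l (lev v)"
  using funpow_par[of v "lev v - l"] by (auto simp: anc_def)

lemma anc_self: "lev v \<le> l \<Longrightarrow> anc l v = v"
  by (simp add: anc_def)

lemma anc_Suc: "v \<in> V \<Longrightarrow> l < lev v \<Longrightarrow> anc l v = par (anc (Suc l) v)"
proof -
  assume "l < lev v"
  then have "lev v - l = Suc (lev v - Suc l)" by simp
  then show ?thesis by (simp add: anc_def)
qed

lemma anc_par: "v \<in> V \<Longrightarrow> 0 < lev v \<Longrightarrow> l < lev v \<Longrightarrow> anc l (par v) = anc l v"
proof -
  assume a: "v \<in> V" "0 < lev v" "l < lev v"
  then have "lev v - l = Suc (lev (par v) - l)" using par by fastforce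
  then show ?thesis by (simp add: anc_def funpow_Suc_right del: funpow.simps)
qed

lemma anc_anc: "v \<in> V \<Longrightarrow> anc l (anc k v) = anc (min l k) v"
proof -
  assume v: "v \<in> V"
  have "(lev v - k) + (min k (lev v) - l) = lev v - min l k" by simp
  then have "(par ^^ (min k (lev v) - l)) ((par ^^ (lev v - k)) v) = (par ^^ (lev v - min l k)) v"
    by (metis add.commute comp_apply funpow_add)
  then show ?thesis using lev_anc[OF v] by (simp add: anc_def)
qed

lemma anc_edge:
  assumes "(u, v) \<in> E"
  shows "anc l u = anc l v \<or> (anc l u, anc l v) \<in> E"
proof -
  have uv: "u \<in> V" "v \<in> V" using assms E_sub by auto
  have gen: "anc l a = anc l b \<or> (anc l a, anc l b) \<in> E" if ab: "(a, b) \<in> E" "lev a = lev b" for a b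
  proof -
    have V: "a \<in> V" "b \<in> V" using ab E_sub by auto
    have "anc (lev a - i) a = anc (lev a - i) b \<or> (anc (lev a - i) a, anc (lev a - i) b) \<in> E" for i
    proof (induction i)
      case 0
      then show ?case using ab by (simp add: anc_self)
    next
      case (Suc i)
      show ?case
      proof (cases "i < lev a")
        case True
        then have "Suc (lev a - Suc i) = lev a - i" by simp
        then have *: "anc (lev a - Suc i) a = par (anc (lev a - i) a)" "anc (lev a - Suc i) b = par (anc (lev a - i) b)"
          using anc_Suc[OF V(1), of "lev a - Suc i"] anc_Suc[OF V(2), of "lev a - Suc i"] ab(2) True by auto
        have "lev (anc (lev a - i) a) = lev (anc (lev a - i) b)" "0 < lev (anc (lev a - i) b)"
          using lev_anc[OF V(1)] lev_anc[OF V(2)] ab(2) True by auto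
        then show ?thesis
          unfolding * using Suc edge_parents[of "anc (lev a - i) a" "anc (lev a - i) b"] by metis
      next
        case False
        then show ?thesis using Suc by simp
      qed
    qed
    from this[of "lev a - l"] show ?thesis
      using anc_self ab by (cases "l \<le> lev a") auto
  qed
  have par_case: "anc l (par b) = anc l b \<or> (anc l (par b), anc l b) \<in> E" if "b \<in> V" "0 < lev b" for b
  proof (cases "l < lev b")
    case True
    then show ?thesis using anc_par that by simp
  next
    case False
    then show ?thesis using par[OF that] symE anc_self by (auto dest: symD)
  qed
  show ?thesis
  proof (cases "lev u \<le> lev v")
    case True
    then show ?thesis using edge_levels[OF assms] gen[OF assms] par_case uv by metis
  next
    case False
    have "(v, u) \<in> E" using assms symE by (auto dest: symD)
    then have "v = par u" "0 < lev u" using edge_levels[of v u] False by auto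
    then show ?thesis using par_case[of u] uv symE by (auto dest: symD)
  qed
qed

lemma reach_anc:
  assumes "reach E W n u v" "\<And>w. w \<in> W \<Longrightarrow> anc l w \<in> W'"
  shows "reach E W' n (anc l u) (anc l v)"
proof -
  have "reach E W' (1 * n) (anc l u) (anc l v)"
  proof (rule reach_transfer[OF assms(1)])
    fix a b assume "a \<in> W" "b \<in> W" "(a, b) \<in> E"
    then show "reach E W' 1 (anc l a) (anc l b)" using assms(2) anc_edge by (intro reach_step) auto
  qed (rule assms(2))
  then show ?thesis by simp
qed

lemma edge_lev: "(u, v) \<in> E \<Longrightarrow> lev v \<le> Suc (lev u)"
  using edge_levels[of u v] par[of v] E_sub by (cases "lev u \<le> lev v") auto

lemma near_lev:
  assumes "near n u v"
  shows "lev v \<le> lev u + n" "lev u \<le> lev v + n"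
proof -
  have *: "lev v \<le> lev u + n" if "near n u v" for u v
    using that by (induction rule: reach_induct) (use edge_lev in fastforce)+
  show "lev v \<le> lev u + n" using *[OF assms] .
  show "lev u \<le> lev v + n" using *[OF reach_sym[OF symE assms]] .
qed

lemma reach_descend:
  assumes "v \<in> V" "\<And>j. l \<le> j \<Longrightarrow> anc j v \<in> W"
  shows "reach E W (lev v - l) v (anc l v)"
proof -
  have "reach E W (lev v - (lev v - i)) v (anc (lev v - i) v)" if "l \<le> lev v - i" for i
    using that
  proof (induction i)
    case 0
    then show ?case using assms(2)[of "lev v"] anc_self reach_refl by simp
  next
    case (Suc i)
    show ?case
    proof (cases "i < lev v")
      case True
      let ?k = "lev v - Suc i"
      have k: "Suc ?k = lev v - i" using True by simp
      have "anc ?k v = par (anc (Suc ?k) v)" using anc_Suc[OF assms(1)] True by simp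
      then have e: "(anc (Suc ?k) v, anc ?k v) \<in> E"
        using par[OF anc_in[OF assms(1)], of "Suc ?k"] lev_anc[OF assms(1)] True by auto
      have "reach E W (lev v - Suc ?k) v (anc (Suc ?k) v)" using Suc k by simp
      moreover have "reach E W 1 (anc (Suc ?k) v) (anc ?k v)"
        using e assms(2) Suc.prems by (intro reach_step) auto
      ultimately show ?thesis by (rule reach_sum) (use True in simp)
    qed (use Suc in simp)
  qed
  from this[of "lev v - l"] show ?thesis
    using assms(2)[of l] anc_self[of v l] reach_refl[of v W E 0] by (cases "l \<le> lev v") auto
qed

definition outside :: "'v \<Rightarrow> nat \<Rightarrow> 'v set" where
  "outside v R = {w \<in> V. \<not> near R v w}"

text \<open>The vertical ray from the origin to \<open>z\<close> passes within \<open>R\<close> of \<open>v\<close>.\<close>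

definition shadow :: "'v \<Rightarrow> nat \<Rightarrow> 'v set" where
  "shadow v R = {z \<in> V. \<exists>l. near R v (anc l z)}"

lemma outside_lev: "w \<in> V \<Longrightarrow> lev v + R < lev w \<or> lev w + R < lev v \<Longrightarrow> w \<in> outside v R"
  unfolding outside_def using near_lev by fastforce

lemma shadow_self: "v \<in> V \<Longrightarrow> v \<in> shadow v R"
  unfolding shadow_def using reach_refl[of v V] anc_self[of v "lev v"] by (auto intro!: exI[of _ "lev v"])

text \<open>The first ancestor of \<open>v\<close> outside the ball of radius \<open>R\<close> about \<open>v\<close>.\<close>

definition base :: "'v \<Rightarrow> nat \<Rightarrow> 'v" where
  "base v R = anc (lev v - Suc R) v"

text \<open>If the ray to \<open>z\<close> misses the ball about \<open>v\<close>, one can go around that ball from below: descend from \<open>z\<close>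
  along its ray, cross over in the level \<open>lev v - (x + R + 1)\<close>, where the ball is out of reach and a path of
  length \<open>x\<close> from \<open>z\<close> to \<open>v\<close> projects, and climb up the ray of \<open>v\<close>. If that level is cut off at \<open>0\<close>,
  the crossing takes place at the origin.\<close>

lemma reach_base:
  assumes v: "v \<in> V" "R < lev v" and z: "z \<in> V" "z \<notin> shadow v R" and x: "near x v z"
  shows "reach E (outside v R) (4 * x + 2 * R + 2) z (base v R)"
proof -
  define y where "y = x + R + 1"
  define l where "l = lev v - y"
  have lv: "l + R < lev v" using v(2) by (auto simp: l_def y_def)
  have 1: "reach E (outside v R) (lev z - l) z (anc l z)"
    using z by (intro reach_descend) (auto simp: outside_def shadow_def anc_in)
  have "reach E {w \<in> V. l \<le> lev w} x v z"
  proof -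
    have "reach E {w. near x v w} x v z" using reach_near[OF x] .
    moreover have "{w. near x v w} \<subseteq> {w \<in> V. l \<le> lev w}"
      using near_lev reach_in by (fastforce simp: l_def y_def)
    ultimately show ?thesis by (rule reach_subset)
  qed
  then have "reach E (outside v R) x (anc l v) (anc l z)"
  proof (rule reach_anc)
    fix w assume "w \<in> {w \<in> V. l \<le> lev w}"
    then show "anc l w \<in> outside v R" using lv lev_anc[of w l] by (intro outside_lev anc_in) auto
  qed
  then have 2: "reach E (outside v R) x (anc l z) (anc l v)" by (rule reach_sym[OF symE])
  let ?b = "base v R"
  have b: "?b \<in> V" "lev ?b = lev v - Suc R" using v anc_in lev_anc by (auto simp: base_def)
  have "reach E (outside v R) (lev ?b - l) ?b (anc l ?b)"
  proof (intro reach_descend b(1) outside_lev anc_in disjI2)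
    fix j assume "l \<le> j"
    show "lev (anc j ?b) + R < lev v" using lev_anc[OF b(1)] b(2) v(2) by auto
  qed
  moreover have "anc l ?b = anc l v"
  proof -
    have "l \<le> lev v - Suc R" by (simp add: l_def y_def)
    then show ?thesis using anc_anc[OF v(1)] by (simp add: base_def min_def)
  qed
  ultimately have 3: "reach E (outside v R) (lev ?b - l) (anc l v) ?b" using reach_sym[OF symE] by metis
  have "lev z \<le> lev v + x" using near_lev[OF x] by simp
  then have "(lev z - l) + x + (lev ?b - l) \<le> 4 * x + 2 * R + 2"
    unfolding b(2) by (auto simp: l_def y_def)
  then show ?thesis using reach_sum[OF reach_trans[OF 1 2] 3] by blast
qed

section \<open>Gates\<close>

definition gate :: "nat \<Rightarrow> nat \<Rightarrow> nat \<Rightarrow> 'v \<Rightarrow> 'v \<Rightarrow> bool" where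
  "gate R d X v e \<longleftrightarrow> v \<in> V \<and> R < lev v \<and> near d v e \<and> \<not> reach E (outside v R) X e (base v R)"

text \<open>Otherwise \<open>reach_base\<close> would connect \<open>e\<close> to the ancestors of \<open>v\<close> too cheaply.\<close>

lemma gate_shadow:
  assumes g: "gate R d X v e" and X: "4 * d + 2 * R + 2 \<le> X"
  shows "e \<in> shadow v R"
proof (rule ccontr)
  assume "e \<notin> shadow v R"
  moreover have "e \<in> V" using g reach_in unfolding gate_def by fast
  ultimately have "reach E (outside v R) (4 * d + 2 * R + 2) e (base v R)"
    using g by (intro reach_base) (auto simp: gate_def)
  then have "reach E (outside v R) X e (base v R)" using X by (rule reach_le)
  then show False using g by (simp add: gate_def)
qed

text \<open>Since the ray to \<open>e\<close> passes near \<open>v\<close>, the distance of \<open>e\<close> from \<open>v\<close> is essentially the difference of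
  their levels.\<close>

lemma gate_lev:
  assumes g: "gate R d X v e" and X: "4 * d + 2 * R + 2 \<le> X" and q: "\<not> near q v e" and "2 * R \<le> q"
  shows "lev v + q < lev e + 2 * R"
proof -
  have "e \<in> V" using g reach_in unfolding gate_def by fast
  obtain l where l: "near R v (anc l e)" using gate_shadow[OF g X] by (auto simp: shadow_def)
  have "near (lev e - l) e (anc l e)" using \<open>e \<in> V\<close> by (intro reach_descend) (auto simp: anc_in)
  then have "near (R + (lev e - l)) v e" using l reach_trans reach_sym[OF symE] by fast
  then have "q < R + (lev e - l)" using q reach_le[of E V _ v e q] not_le by blast
  moreover have "lev v \<le> min l (lev e) + R" using near_lev[OF l] lev_anc[OF \<open>e \<in> V\<close>] by simp
  ultimately show ?thesis using assms(4) by auto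
qed

text \<open>Suppose a path of length \<open>n\<close> leads from outside the shadow of \<open>v\<close> into the shadow of \<open>e\<close> and avoids the
  ball about \<open>v\<close>. Capped at level \<open>lev e + R\<close>, which is above that ball, it has the same properties, and its
  end is at distance at most \<open>3 * R\<close> from \<open>e\<close>. Its start is then within \<open>x = d + n + 3 * R\<close> of \<open>v\<close> and can
  be connected to the base of \<open>v\<close> by \<open>reach_base\<close>. In total \<open>e\<close> is connected to the base by a path of length
  \<open>n + 3 * R + (4 * x + 2 * R + 2)\<close>, which has to exceed \<open>X\<close>.\<close>

lemma gate_crossing:
  assumes g: "gate R d X v e" and X: "4 * d + 2 * R + 2 \<le> X" and q: "\<not> near (5 * R) v e"
    and p: "reach E (outside v R) n z z'" and z: "z \<notin> shadow v R" and z': "z' \<in> shadow e R"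
  shows "X < 5 * n + 4 * d + 17 * R + 2"
proof (rule ccontr)
  assume "\<not> ?thesis"
  then have large: "5 * n + 4 * d + 17 * R + 2 \<le> X" by simp
  have e: "e \<in> V" and v: "v \<in> V" "R < lev v" and d: "near d v e" using g reach_in unfolding gate_def by fast+
  have zV: "z \<in> V" "z' \<in> V" using reach_in[OF p] by (auto simp: outside_def)
  have lev: "lev v + 3 * R < lev e" using gate_lev[OF g X q] by simp
  obtain l where l: "near R e (anc l z')" using z' by (auto simp: shadow_def)
  let ?L = "lev e + R"
  let ?w = "anc l z'"
  have w_lev: "lev ?w \<le> ?L" "lev e \<le> lev ?w + R" using near_lev[OF l] by auto
  have 1: "reach E (outside v R) n (anc ?L z) (anc ?L z')"
  proof (rule reach_anc[OF p])
    fix w assume w: "w \<in> outside v R"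
    then have "w \<in> V" by (simp add: outside_def)
    show "anc ?L w \<in> outside v R"
    proof (cases "lev w \<le> ?L")
      case False
      then show ?thesis using lev lev_anc[OF \<open>w \<in> V\<close>, of ?L] by (intro outside_lev anc_in \<open>w \<in> V\<close>) auto
    qed (use w anc_self in simp)
  qed
  let ?l = "min l (lev z')"
  have w_eq: "anc ?l (anc ?L z') = ?w"
  proof -
    have "lev ?w = ?l" using lev_anc[OF zV(2)] by simp
    then have "min ?l ?L = ?l" using w_lev(1) by linarith
    then show ?thesis using anc_anc[OF zV(2)] by (simp add: anc_def min_def)
  qed
  have lw: "lev ?w = ?l" using lev_anc[OF zV(2)] by simp
  have 2: "reach E (outside v R) (lev (anc ?L z') - ?l) (anc ?L z') ?w"
    unfolding w_eq[symmetric]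
  proof (intro reach_descend anc_in zV(2))
    fix j assume j: "?l \<le> j"
    have "lev (anc j (anc ?L z')) = min j (min ?L (lev z'))"
      using lev_anc[OF anc_in[OF zV(2)]] lev_anc[OF zV(2)] by simp
    then have "lev e \<le> lev (anc j (anc ?L z')) + R" using j w_lev lw by auto
    then show "anc j (anc ?L z') \<in> outside v R" using lev by (intro outside_lev anc_in zV(2)) auto
  qed
  have 3: "reach E (outside v R) R ?w e"
  proof (rule reach_sym[OF symE])
    have "{x. near R e x} \<subseteq> outside v R"
      using near_lev reach_in lev by (fastforce intro!: outside_lev)
    then show "reach E (outside v R) R e ?w" by (rule reach_subset[OF reach_near[OF l]])
  qed
  have "lev (anc ?L z') - ?l \<le> 2 * R" using lev_anc[OF zV(2), of ?L] w_lev lw by linarith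
  then have 4: "reach E (outside v R) (n + 3 * R) (anc ?L z) e"
    using reach_sum[OF reach_trans[OF 1 2] 3] by simp
  define x where "x = d + n + 3 * R"
  have "near (n + 3 * R) e (anc ?L z)"
    by (rule reach_subset[OF reach_sym[OF symE 4]]) (auto simp: outside_def)
  then have "near x v (anc ?L z)" using reach_sum[OF d] by (simp add: x_def)
  moreover have "anc ?L z \<notin> shadow v R"
    using z zV(1) anc_anc[OF zV(1)] by (auto simp: shadow_def anc_in)
  ultimately have "reach E (outside v R) (4 * x + 2 * R + 2) (anc ?L z) (base v R)"
    using v zV(1) by (intro reach_base anc_in) auto
  from reach_sum[OF reach_sym[OF symE 4] this, of X] have "reach E (outside v R) X e (base v R)"
    using large by (simp add: x_def)
  then show False using g by (simp add: gate_def)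
qed

text \<open>The case of a constant path in \<open>gate_crossing\<close>.\<close>

lemma gate_nested:
  assumes g: "gate R d X v e" and X: "4 * d + 17 * R + 2 \<le> X" and q: "\<not> near (5 * R) v e"
  shows "shadow e R \<subseteq> shadow v R"
proof
  fix z assume z: "z \<in> shadow e R"
  show "z \<in> shadow v R"
  proof (rule ccontr)
    assume z': "z \<notin> shadow v R"
    have "z \<in> V" using z by (simp add: shadow_def)
    then have "\<not> near R v (anc (lev z) z)" using z' unfolding shadow_def by blast
    then have "z \<in> outside v R" using \<open>z \<in> V\<close> anc_self[of z "lev z"] by (simp add: outside_def)
    then have "X < 5 * 0 + 4 * d + 17 * R + 2"
      using X by (intro gate_crossing[OF g _ q reach_refl z' z]) auto
    then show False using X by simp
  qed
qed

text \<open>Unlike a gate, this notion does not refer to the levels, so it can be moved around by isometries of a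
  quasi-isometric graph. The doubled bound leaves \<open>X\<close> for one of the two vertices in \<open>fork_gate\<close>.\<close>

definition fork :: "nat \<Rightarrow> nat \<Rightarrow> nat \<Rightarrow> nat \<Rightarrow> 'v \<Rightarrow> bool" where
  "fork R q d X v \<longleftrightarrow> (\<exists>e1 e2. near d v e1 \<and> near d v e2 \<and> \<not> near q v e1 \<and> \<not> near q v e2 \<and>
      \<not> reach E (outside v R) (2 * X) e1 e2)"

text \<open>If both vertices had cheap connections to the base of \<open>v\<close>, concatenating them would connect the two.\<close>

lemma fork_gate:
  assumes "fork R q d X v" "v \<in> V" "R < lev v"
  shows "\<exists>e. gate R d X v e \<and> \<not> near q v e"
proof -
  obtain e1 e2 where e: "near d v e1" "near d v e2" "\<not> near q v e1" "\<not> near q v e2"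
    "\<not> reach E (outside v R) (2 * X) e1 e2" using assms(1) by (auto simp: fork_def)
  have "\<not> reach E (outside v R) X e1 (base v R) \<or> \<not> reach E (outside v R) X e2 (base v R)"
    using e(5) reach_trans[of E "outside v R" X e1 "base v R" X e2] reach_sym[OF symE, of "outside v R" X e2 "base v R"]
    unfolding mult_2 by argo
  then show ?thesis using e assms(2,3) by (auto simp: gate_def)
qed

text \<open>With \<open>6 * R\<close> as the lower bound for the spacing, the levels increase by more than \<open>4 * R\<close> at each gate, so
  the balls about different gates occupy disjoint ranges of levels.\<close>

definition gate_chain :: "nat \<Rightarrow> nat \<Rightarrow> nat \<Rightarrow> (nat \<Rightarrow> 'v) \<Rightarrow> bool" where
  "gate_chain R d X v \<longleftrightarrow> 4 * d + 17 * R + 2 \<le> X \<and> (\<forall>i. gate R d X (v i) (v (Suc i)) \<and> \<not> near (6 * R) (v i) (v (Suc i)))"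

text \<open>The far vertex of a gate carries a fork again, which provides the next gate.\<close>

lemma gate_chain_exists:
  assumes v: "v \<in> V" "R < lev v" and X: "4 * d + 17 * R + 2 \<le> X"
    and forks: "\<And>v. v \<in> V \<Longrightarrow> fork R (6 * R) d X v"
  obtains w where "w 0 = v" "gate_chain R d X w"
proof -
  have "\<exists>w. w 0 = v \<and> (\<forall>i. (w i \<in> V \<and> R < lev (w i)) \<and> gate R d X (w i) (w (Suc i)) \<and> \<not> near (6 * R) (w i) (w (Suc i)))"
  proof -
    have "\<exists>w. \<forall>i. ((w i \<in> V \<and> R < lev (w i)) \<and> (i = 0 \<longrightarrow> w i = v)) \<and> gate R d X (w i) (w (Suc i)) \<and> \<not> near (6 * R) (w i) (w (Suc i))"
    proof (rule dependent_nat_choice)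
      fix x and i :: nat assume x: "(x \<in> V \<and> R < lev x) \<and> (i = 0 \<longrightarrow> x = v)"
      then obtain e where e: "gate R d X x e" "\<not> near (6 * R) x e" using fork_gate[OF forks, of x] by metis
      have "near d x e" using e(1) by (simp add: gate_def)
      then have "e \<in> V" using reach_in by metis
      have "R < lev e" using gate_lev[OF e(1) _ e(2)] X x by simp
      then show "\<exists>y. ((y \<in> V \<and> R < lev y) \<and> (Suc i = 0 \<longrightarrow> y = v)) \<and> gate R d X x y \<and> \<not> near (6 * R) x y"
        using e \<open>e \<in> V\<close> by auto
    qed (use v in auto)
    then show ?thesis by blast
  qed
  then show thesis using that X by (auto simp: gate_chain_def)
qed

lemma gate_chainD:
  assumes c: "gate_chain R d X v"
  shows "v i \<in> V" "R < lev (v i)" "near d (v i) (v (Suc i))" "gate R d X (v i) (v (Suc i))"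
    "4 * d + 17 * R + 2 \<le> X" "\<not> near (5 * R) (v i) (v (Suc i))"
    "lev (v i) + 4 * R < lev (v (Suc i))" "shadow (v (Suc i)) R \<subseteq> shadow (v i) R"
proof -
  have g: "gate R d X (v i) (v (Suc i))" "\<not> near (6 * R) (v i) (v (Suc i))" and X: "4 * d + 17 * R + 2 \<le> X"
    using c by (auto simp: gate_chain_def)
  show "v i \<in> V" "R < lev (v i)" "near d (v i) (v (Suc i))" "gate R d X (v i) (v (Suc i))"
    "4 * d + 17 * R + 2 \<le> X" using g X by (auto simp: gate_def)
  show q: "\<not> near (5 * R) (v i) (v (Suc i))" using g(2) reach_le[of E V "5 * R"] by force
  show "lev (v i) + 4 * R < lev (v (Suc i))" using gate_lev[OF g(1) _ g(2)] X by simp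
  show "shadow (v (Suc i)) R \<subseteq> shadow (v i) R" using gate_nested[OF g(1) X q] .
qed

lemma gate_chain_lev: "gate_chain R d X v \<Longrightarrow> lev (v i) + k * (4 * R + 1) \<le> lev (v (i + k))"
proof (induction k)
  case (Suc k)
  then show ?case using gate_chainD(7)[OF Suc.prems, of "i + k"] by simp
qed simp

lemma gate_chain_near: "gate_chain R d X v \<Longrightarrow> near (k * d) (v i) (v (i + k))"
proof (induction k)
  case 0
  then show ?case using reach_refl[OF gate_chainD(1)[OF 0]] by simp
next
  case (Suc k)
  then show ?case using reach_sum[OF Suc.IH gate_chainD(3)[of R d X v "i + k"]] by simp
qed

lemma gate_chain_shadow: "gate_chain R d X v \<Longrightarrow> shadow (v (i + k)) R \<subseteq> shadow (v i) R"
  by (induction k) (use gate_chainD(8) in fastforce)+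

text \<open>Induction on the number of gates. The path has to enter the shadow of the near vertex of the last gate
  along some edge from \<open>y\<close> to \<open>y'\<close>. The part up to \<open>y'\<close> pays for the first \<open>k\<close> gates; the part from \<open>y\<close> starts
  outside that shadow and pays for the last gate. The edge is counted twice, hence the strict bound for one
  gate.\<close>

lemma gate_chain_cost:
  assumes c: "gate_chain R d X v" and Y: "5 * Y + 4 * d + 17 * R + 2 \<le> X"
    and p: "reach E W n z z'" and W: "\<And>i. i < k \<Longrightarrow> W \<subseteq> outside (v (a + i)) R"
    and z: "z \<notin> shadow (v a) R" and z': "z' \<in> shadow (v (a + k)) R"
  shows "k * Y \<le> n"
  using p W z'
proof (induction k arbitrary: n z')
  case 0
  then show ?case by simp
next
  case (Suc k)
  have "z \<notin> shadow (v (a + k)) R" using z gate_chain_shadow[OF c] by blast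
  moreover have "z' \<in> shadow (v (a + k)) R" using Suc.prems(3) gate_chainD(8)[OF c, of "a + k"] by auto
  ultimately obtain i j y y' where ij: "i + j + 1 \<le> n" "reach E W i z y" "y \<notin> shadow (v (a + k)) R"
    "y' \<in> shadow (v (a + k)) R" "(y, y') \<in> E" "reach E W j y' z'"
    using reach_crossing[OF Suc.prems(1), of "shadow (v (a + k)) R"] by metis
  have yW: "y \<in> W" "y' \<in> W" using reach_in[OF ij(2)] reach_in[OF ij(6)] by auto
  have yy: "reach E W 1 y y'" using yW ij(5) by (intro reach_step) auto
  have 1: "reach E W (i + 1) z y'" using reach_trans[OF ij(2) yy] .
  have "k * Y \<le> i + 1" using Suc.prems(2) ij(4) by (intro Suc.IH[OF 1]) auto
  moreover have "reach E W (1 + j) y z'" using reach_trans[OF yy ij(6)] .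
  then have "reach E (outside (v (a + k)) R) (1 + j) y z'"
    by (rule reach_subset[OF _ Suc.prems(2)]) simp
  then have "X < 5 * (1 + j) + 4 * d + 17 * R + 2"
    using gate_crossing[OF gate_chainD(4)[OF c, of "a + k"] _ gate_chainD(6)[OF c] _ ij(3), of "1 + j" z'] Suc.prems(3)
      gate_chainD(5)[OF c] by (simp only: add_Suc_right)
  then have "Y < 1 + j" using Y by presburger
  ultimately show ?case using ij(1) by simp
qed

end

context leveled_graph
begin

lemma near_in: "near n u v \<Longrightarrow> u \<in> V \<and> v \<in> V"
  by (rule reach_in)

lemma near_sym: "near n u v \<Longrightarrow> near n v u"
  by (rule reach_sym[OF symE])

lemma reach_ball:
  assumes "near n u v" "\<And>x. near n u x \<Longrightarrow> x \<in> W"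
  shows "reach E W n u v"
  by (rule reach_subset[OF reach_near[OF assms(1)]]) (use assms(2) in auto)

lemma shadow_anc:
  assumes z: "z \<in> shadow v R" and N: "lev v + R \<le> N"
  shows "anc N z \<in> shadow v R"
proof -
  have zV: "z \<in> V" using z by (simp add: shadow_def)
  obtain l where l: "near R v (anc l z)" using z by (auto simp: shadow_def)
  let ?k = "min l (lev z)"
  have "lev (anc l z) = ?k" using lev_anc[OF zV] by simp
  then have "?k \<le> N" using near_lev(1)[OF l] N by simp
  then have "anc ?k (anc N z) = anc ?k z" using anc_anc[OF zV] by (simp add: min_def)
  also have "\<dots> = anc l z" by (simp add: anc_def min_def)
  finally have "near R v (anc ?k (anc N z))" using l by simp
  then show ?thesis using zV anc_in unfolding shadow_def by blast
qed

lemma origin_near: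
  assumes "o' \<in> V" "lev o' = 0" "v \<in> V"
  shows "near (lev v) o' v"
proof -
  have "near (lev v - 0) v (anc 0 v)" using assms(3) anc_in by (intro reach_descend) auto
  moreover have "anc 0 v = o'" using origin_unique[OF anc_in[OF assms(3)] assms(1)] lev_anc[OF assms(3)] assms(2) by simp
  ultimately show ?thesis using near_sym by simp
qed

text \<open>A common point of the two shadows would give a path from \<open>e1\<close> to \<open>e2\<close> along the vertical ray of that
  point, and this path stays far above the origin.\<close>

lemma fork_shadows_disjoint:
  assumes o: "o' \<in> V" "lev o' = 0" and e: "near d o' e1" "near d o' e2"
    "\<not> near (6 * R) o' e1" "\<not> near (6 * R) o' e2"
    and sep: "\<not> reach E (outside o' R) (2 * X) e1 e2" and X: "d + 3 * R \<le> X"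
    and z: "z \<in> shadow e1 R" "z \<in> shadow e2 R"
  shows False
proof -
  have gen: "reach E (outside o' R) (2 * X) b a"
    if l: "near R a (anc i z)" "near R b (anc j z)" "i \<le> j"
      and ab: "near d o' a" "near d o' b" "\<not> near (6 * R) o' a" "\<not> near (6 * R) o' b" for a b i j
  proof -
    have zV: "z \<in> V" using z by (simp add: shadow_def)
    have V: "a \<in> V" "b \<in> V" using ab(1,2) near_in by auto
    have lo: "6 * R < lev a" "6 * R < lev b"
      using ab(3,4) origin_near[OF o V(1)] origin_near[OF o V(2)] reach_le by (meson not_le)+
    have hi: "lev b \<le> d" using near_lev(1)[OF ab(2)] o(2) by simp
    have ball: "x \<in> outside o' R" if "near R c x" "6 * R < lev c" for c x
      using near_lev[OF that(1)] near_in[OF that(1)] that(2) o(2) by (intro outside_lev) auto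
    have 1: "reach E (outside o' R) R b (anc j z)" by (rule reach_ball[OF l(2)]) (rule ball[OF _ lo(2)])
    have 3: "reach E (outside o' R) R (anc i z) a"
      by (rule reach_sym[OF symE]) (rule reach_ball[OF l(1)], rule ball[OF _ lo(1)])
    have ji: "anc i (anc j z) = anc i z" using anc_anc[OF zV] l(3) by (simp add: min_def)
    have "lev a \<le> lev (anc i z) + R" using near_lev[OF l(1)] by simp
    then have li: "5 * R < lev (anc i z)" using lo(1) by simp
    have "reach E (outside o' R) (lev (anc j z) - i) (anc j z) (anc i (anc j z))"
    proof (intro reach_descend anc_in zV outside_lev)
      fix k assume "i \<le> k"
      then have "lev (anc i z) \<le> lev (anc k (anc j z))"
        using lev_anc[OF zV] lev_anc[OF anc_in[OF zV]] l(3) by auto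
      then show "lev o' + R < lev (anc k (anc j z)) \<or> lev (anc k (anc j z)) + R < lev o'" using li o(2) by simp
    qed
    then have 2: "reach E (outside o' R) (d + R) (anc j z) (anc i z)"
      unfolding ji using near_lev(1)[OF l(2)] hi by (elim reach_le) simp
    show ?thesis using reach_sum[OF reach_trans[OF 1 2] 3] X by simp
  qed
  obtain i j where "near R e1 (anc i z)" "near R e2 (anc j z)" using z by (auto simp: shadow_def)
  then show False
    using gen[of e1 i e2 j] gen[of e2 j e1 i] e sep reach_sym[OF symE] by (meson linear)
qed

text \<open>The fork at the origin starts two infinite chains of gates. Going up along them yields two vertices of
  level \<open>N\<close>: one inside the shadow of the \<open>k\<close>-th gate of the first chain, the other one in the shadow of \<open>e2\<close>
  and therefore outside the shadow of \<open>e1\<close>. A path between them in level \<open>N\<close> runs above the first \<open>k\<close> gates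
  and pays for them.\<close>

theorem level_diameter_ge:
  assumes o: "o' \<in> V" "lev o' = 0"
    and forks: "\<And>v. v \<in> V \<Longrightarrow> fork R (6 * R) d X v"
    and X: "5 * Y + 4 * d + 17 * R + 2 \<le> X"
    and N: "(k + 1) * d + R < N"
    and D: "\<And>u w. u \<in> V \<Longrightarrow> w \<in> V \<Longrightarrow> lev u = N \<Longrightarrow> lev w = N \<Longrightarrow> reach E {w \<in> V. lev w = N} D u w"
  shows "k * Y \<le> D"
proof -
  obtain e1 e2 where e: "near d o' e1" "near d o' e2" "\<not> near (6 * R) o' e1" "\<not> near (6 * R) o' e2"
    and sep: "\<not> reach E (outside o' R) (2 * X) e1 e2"
    using forks[OF o(1)] by (auto simp: fork_def)
  have V: "e1 \<in> V" "e2 \<in> V" using e near_in by auto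
  have "R < lev e" if "\<not> near (6 * R) o' e" "e \<in> V" for e
    using that origin_near[OF o that(2)] reach_le[of E V "lev e" o' e "6 * R"] by linarith
  then have lo: "R < lev e1" "R < lev e2" using e V by auto
  have X': "4 * d + 17 * R + 2 \<le> X" using X by simp
  obtain v where v: "v 0 = e1" "gate_chain R d X v" using gate_chain_exists[OF V(1) lo(1) X' forks] by blast
  obtain w where w: "w 0 = e2" "gate_chain R d X w" using gate_chain_exists[OF V(2) lo(2) X' forks] by blast
  have le_d: "lev e1 \<le> d" "lev e2 \<le> d" using near_lev(1)[OF e(1)] near_lev(1)[OF e(2)] o(2) by auto
  have chain_lev: "lev (v i) + R < N" if "i \<le> k" for i
  proof -
    have "lev (v (0 + i)) \<le> lev (v 0) + i * d" using near_lev(1)[OF gate_chain_near[OF v(2), of i 0]] .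
    moreover have "i * d \<le> k * d" using that by (rule mult_le_mono1)
    ultimately have "lev (v i) \<le> d + k * d" using le_d(1) unfolding v(1) add_0 by linarith
    then show ?thesis using N by simp
  qed
  have hiN: "N \<le> lev (u (i + N))" if "gate_chain R d X u" for u i
    using gate_chain_lev[OF that, of i N] by simp
  let ?z = "anc N (w (0 + N))" and ?z' = "anc N (v (k + N))"
  have "w (0 + N) \<in> shadow (w 0) R"
    using gate_chain_shadow[OF w(2), of 0 N] shadow_self[OF gate_chainD(1)[OF w(2)]] by blast
  then have zw: "?z \<in> shadow e2 R" using shadow_anc[of _ "w 0" R N] w(1) le_d(2) N by simp
  have "v (k + N) \<in> shadow (v k) R"
    using gate_chain_shadow[OF v(2), of k N] shadow_self[OF gate_chainD(1)[OF v(2)]] by blast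
  then have z': "?z' \<in> shadow (v (0 + k)) R" using shadow_anc[of _ "v k" R N] chain_lev[of k] by simp
  have z: "?z \<notin> shadow (v 0) R"
    using fork_shadows_disjoint[OF o e sep _ _ zw] v(1) X by auto
  have zV: "?z \<in> V" "?z' \<in> V" using anc_in gate_chainD(1) v(2) w(2) by blast+
  have "lev ?z = N" "lev ?z' = N"
    using lev_anc[OF gate_chainD(1)[OF w(2)]] lev_anc[OF gate_chainD(1)[OF v(2)]] hiN[OF w(2), of 0] hiN[OF v(2), of k] by auto
  then have p: "reach E {w \<in> V. lev w = N} D ?z ?z'" using D zV by blast
  show ?thesis
  proof (rule gate_chain_cost[OF v(2) X p _ z z'])
    fix i assume "i < k"
    then show "{w \<in> V. lev w = N} \<subseteq> outside (v (0 + i)) R" using chain_lev[of i] by (auto intro!: outside_lev)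
  qed
qed

end

section \<open>Homogeneous graphs and forks\<close>

definition automorphism :: "'y set \<Rightarrow> ('y \<times> 'y) set \<Rightarrow> ('y \<Rightarrow> 'y) \<Rightarrow> ('y \<Rightarrow> 'y) \<Rightarrow> bool" where
  "automorphism YV YE \<phi> \<psi> \<longleftrightarrow>
     (\<forall>x\<in>YV. \<phi> x \<in> YV \<and> \<psi> x \<in> YV \<and> \<psi> (\<phi> x) = x \<and> \<phi> (\<psi> x) = x) \<and>
     (\<forall>(x, y)\<in>YE. (\<phi> x, \<phi> y) \<in> YE \<and> (\<psi> x, \<psi> y) \<in> YE)"

lemma automorphism_sym: "automorphism YV YE \<phi> \<psi> \<Longrightarrow> automorphism YV YE \<psi> \<phi>"
  by (auto simp: automorphism_def)

text \<open>The complement of an open ball, as in the definition of divergence; the balls that define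
  \<open>outside\<close> are closed.\<close>

definition outside_ball :: "'y set \<Rightarrow> ('y \<times> 'y) set \<Rightarrow> 'y \<Rightarrow> nat \<Rightarrow> 'y set" where
  "outside_ball YV YE x N = {y \<in> YV. \<forall>n<N. \<not> reach YE YV n x y}"

lemma automorphism_reach:
  assumes \<phi>: "automorphism YV YE \<phi> \<psi>" and p: "reach YE W n x y" and W: "\<And>z. z \<in> W \<Longrightarrow> \<phi> z \<in> W'"
  shows "reach YE W' n (\<phi> x) (\<phi> y)"
proof -
  have "reach YE W' (1 * n) (\<phi> x) (\<phi> y)"
  proof (rule reach_transfer[OF p])
    fix a b assume "a \<in> W" "b \<in> W" "(a, b) \<in> YE"
    moreover from this have "(\<phi> a, \<phi> b) \<in> YE" using \<phi> by (auto simp: automorphism_def)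
    ultimately show "reach YE W' 1 (\<phi> a) (\<phi> b)" using W by (intro reach_step) auto
  qed (rule W)
  then show ?thesis by simp
qed

lemma automorphism_near:
  assumes \<phi>: "automorphism YV YE \<phi> \<psi>" and "x \<in> YV" "y \<in> YV"
  shows "reach YE YV n (\<phi> x) (\<phi> y) \<longleftrightarrow> reach YE YV n x y"
proof
  assume "reach YE YV n x y"
  then show "reach YE YV n (\<phi> x) (\<phi> y)" using \<phi> by (intro automorphism_reach[OF \<phi>]) (auto simp: automorphism_def)
next
  assume "reach YE YV n (\<phi> x) (\<phi> y)"
  then have "reach YE YV n (\<psi> (\<phi> x)) (\<psi> (\<phi> y))"
    using \<phi> by (intro automorphism_reach[OF automorphism_sym[OF \<phi>]]) (auto simp: automorphism_def)
  then show "reach YE YV n x y" using assms by (simp add: automorphism_def)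
qed

lemma automorphism_outside_ball:
  assumes \<phi>: "automorphism YV YE \<phi> \<psi>" and x: "x \<in> YV" and z: "z \<in> outside_ball YV YE x N"
  shows "\<phi> z \<in> outside_ball YV YE (\<phi> x) N"
  using automorphism_near[OF \<phi> x] z \<phi> by (auto simp: outside_ball_def automorphism_def)

lemma automorphism_reach_outside_ball:
  assumes \<phi>: "automorphism YV YE \<phi> \<psi>" and c: "c \<in> YV" and p: "reach YE (outside_ball YV YE c N) n x y"
  shows "reach YE (outside_ball YV YE (\<phi> c) N) n (\<phi> x) (\<phi> y)"
  by (rule automorphism_reach[OF \<phi> p automorphism_outside_ball[OF \<phi> c]])

definition geodesic_line :: "'y set \<Rightarrow> ('y \<times> 'y) set \<Rightarrow> (int \<Rightarrow> 'y) \<Rightarrow> bool" where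
  "geodesic_line YV YE \<beta> \<longleftrightarrow> (\<forall>i j. reach YE YV (nat \<bar>i - j\<bar>) (\<beta> i) (\<beta> j) \<and> (\<forall>n < nat \<bar>i - j\<bar>. \<not> reach YE YV n (\<beta> i) (\<beta> j)))"

lemma automorphism_line:
  assumes \<phi>: "automorphism YV YE \<phi> \<psi>" and \<beta>: "geodesic_line YV YE \<beta>"
  shows "geodesic_line YV YE (\<phi> \<circ> \<beta>)"
proof -
  have "\<beta> i \<in> YV" for i using \<beta> reach_in unfolding geodesic_line_def by metis
  then show ?thesis using \<beta> automorphism_near[OF \<phi>] by (simp add: geodesic_line_def)
qed

text \<open>A homogeneous graph \<open>Y\<close> that is quasi-isometric to a leveled graph. A single natural number \<open>C\<close> serves as
  multiplicative and additive constant, so that all estimates stay in the natural numbers.\<close>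

locale combed = leveled_graph V E lev par
  for V :: "'v set" and E lev par +
  fixes YV :: "'y set" and YE :: "('y \<times> 'y) set" and h :: "'v \<Rightarrow> 'y" and C :: nat
  assumes YE_sub: "YE \<subseteq> YV \<times> YV" and symYE: "sym YE" and C_pos: "1 \<le> C"
    and h_in: "v \<in> V \<Longrightarrow> h v \<in> YV"
    and h_upper: "reach E V n u v \<Longrightarrow> reach YE YV (C * n + C) (h u) (h v)"
    and h_lower: "u \<in> V \<Longrightarrow> v \<in> V \<Longrightarrow> reach YE YV n (h u) (h v) \<Longrightarrow> reach E V (C * n + C) u v"
    and h_dense: "y \<in> YV \<Longrightarrow> \<exists>v\<in>V. reach YE YV C (h v) y"
    and homogeneous: "x \<in> YV \<Longrightarrow> y \<in> YV \<Longrightarrow> \<exists>\<phi> \<psi>. automorphism YV YE \<phi> \<psi> \<and> \<phi> x = y"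
    and locally_finite: "x \<in> YV \<Longrightarrow> finite {y. (x, y) \<in> YE}"
    and Y_connected: "x \<in> YV \<Longrightarrow> y \<in> YV \<Longrightarrow> \<exists>n. reach YE YV n x y"
begin

abbreviation nearY :: "nat \<Rightarrow> 'y \<Rightarrow> 'y \<Rightarrow> bool" where
  "nearY \<equiv> reach YE YV"

lemma nearY_sym: "nearY n x y \<Longrightarrow> nearY n y x"
  by (rule reach_sym[OF symYE])

lemma reach_ballY:
  assumes "nearY n u v" "\<And>x. nearY n u x \<Longrightarrow> x \<in> W"
  shows "reach YE W n u v"
  by (rule reach_subset[OF reach_near[OF assms(1)]]) (use assms(2) in auto)

lemma geodesic_line_in: "geodesic_line YV YE \<beta> \<Longrightarrow> \<beta> i \<in> YV"
  using reach_in unfolding geodesic_line_def by metis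

lemma geodesic_line_near: "geodesic_line YV YE \<beta> \<Longrightarrow> nearY n (\<beta> i) (\<beta> j) \<longleftrightarrow> nat \<bar>i - j\<bar> \<le> n"
  unfolding geodesic_line_def by (meson not_le reach_le)

text \<open>Translate the given geodesic to \<open>h v\<close> and pull its points at distance \<open>T\<close> on both sides back to \<open>V\<close>. A path
  between them outside the ball of radius \<open>R\<close> maps to a path outside the ball of radius \<open>n\<close> about \<open>h v\<close>
  that is longer by a factor of at most \<open>2 * C\<close>. Following the geodesic from distance \<open>T\<close> down to distance
  \<open>n\<close> adds at most \<open>T\<close> on each side.\<close>

lemma fork_of_line:
  assumes \<beta>: "geodesic_line YV YE \<beta>"
    and sep: "\<not> reach YE (outside_ball YV YE (\<beta> 0) n) F (\<beta> (- int n)) (\<beta> (int n))"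
    and R: "C * (n + 2 * C) + C \<le> R" and T: "C * q + 2 * C < T" "n + C \<le> T"
    and d: "C * (T + C) + C \<le> d" and F: "4 * C * X + 2 * C + 2 * T \<le> F"
    and v: "v \<in> V"
  shows "fork R q d X v"
proof -
  obtain \<phi> \<psi> where \<phi>: "automorphism YV YE \<phi> \<psi>" "\<phi> (\<beta> 0) = h v"
    using homogeneous[OF geodesic_line_in[OF \<beta>] h_in[OF v]] by blast
  define b where "b = \<phi> \<circ> \<beta>"
  have b: "geodesic_line YV YE b" using automorphism_line[OF \<phi>(1) \<beta>] by (simp add: b_def)
  have b0: "b 0 = h v" using \<phi>(2) by (simp add: b_def)
  let ?W = "outside_ball YV YE (h v) n"
  have sep': "\<not> reach YE ?W F (b (- int n)) (b (int n))"
  proof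
    assume "reach YE ?W F (b (- int n)) (b (int n))"
    then have "reach YE (outside_ball YV YE (\<psi> (h v)) n) F (\<psi> (b (- int n))) (\<psi> (b (int n)))"
      by (rule automorphism_reach_outside_ball[OF automorphism_sym[OF \<phi>(1)] h_in[OF v]])
    moreover have "\<psi> (\<phi> (\<beta> i)) = \<beta> i" for i using \<phi>(1) geodesic_line_in[OF \<beta>] by (auto simp: automorphism_def)
    ultimately show False using sep by (simp add: b_def \<phi>(2)[symmetric])
  qed
  have ends: "\<exists>e. nearY C (h e) (b i) \<and> near d v e \<and> \<not> near q v e" if "nat \<bar>i\<bar> = T" for i
  proof -
    obtain e where e: "e \<in> V" "nearY C (h e) (b i)" using h_dense[OF geodesic_line_in[OF b]] by blast
    have "nearY T (h v) (b i)" using geodesic_line_near[OF b, of T 0 i] b0 that by simp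
    then have "nearY (T + C) (h v) (h e)" using reach_trans nearY_sym[OF e(2)] by fast
    then have "near d v e" using reach_le[OF h_lower[OF v e(1)] d] by blast
    moreover have "\<not> near q v e"
    proof
      assume "near q v e"
      then have "nearY (C * q + C + C) (h v) (b i)" using reach_trans[OF h_upper e(2)] by blast
      then show False using geodesic_line_near[OF b, of _ 0 i] b0 that T(1) by simp
    qed
    ultimately show ?thesis using e(2) by blast
  qed
  obtain e1 where e1: "nearY C (h e1) (b (- int T))" "near d v e1" "\<not> near q v e1" using ends[of "- int T"] by auto
  obtain e2 where e2: "nearY C (h e2) (b (int T))" "near d v e2" "\<not> near q v e2" using ends[of "int T"] by auto
  have "\<not> reach E (outside v R) (2 * X) e1 e2"
  proof
    assume p: "reach E (outside v R) (2 * X) e1 e2"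
    have far: "x \<in> ?W" if a: "a \<in> outside v R" and x: "nearY (2 * C) (h a) x" for a x
    proof -
      have "\<not> nearY m (h v) x" if m: "m < n" for m
      proof
        assume "nearY m (h v) x"
        then have "nearY (m + 2 * C) (h v) (h a)" using reach_trans nearY_sym[OF x] by fast
        then have "near (C * (m + 2 * C) + C) v a" using h_lower v a by (auto simp: outside_def)
        moreover have "C * (m + 2 * C) + C \<le> C * (n + 2 * C) + C" using m by simp
        ultimately have "near R v a" using R reach_le order_trans by metis
        then show False using a by (simp add: outside_def)
      qed
      then show ?thesis using reach_in[OF x] by (simp add: outside_ball_def)
    qed
    have "reach YE ?W (2 * C * (2 * X)) (h e1) (h e2)"
    proof (rule reach_transfer[OF p])
      fix a c assume ac: "a \<in> outside v R" "c \<in> outside v R" "(a, c) \<in> E"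
      then have "near 1 a c" by (intro reach_step) (auto simp: outside_def)
      then have "nearY (2 * C) (h a) (h c)" using h_upper[of 1 a c] by (simp add: mult_2)
      then show "reach YE ?W (2 * C) (h a) (h c)" using far[OF ac(1)] by (rule reach_ballY)
    next
      fix a assume a: "a \<in> outside v R"
      then show "h a \<in> ?W" using far[OF a reach_refl] h_in by (simp add: outside_def)
    qed
    moreover have tail: "reach YE ?W (C + (T - n)) (h e) (b (s * int n))"
      if e: "nearY C (h e) (b (s * int T))" and s: "s = 1 \<or> s = -1" for e and s :: int
    proof -
      have bs: "nearY m (h v) (b (s * int j)) \<longleftrightarrow> j \<le> m" for m j
        using geodesic_line_near[OF b, of m 0 "s * int j"] b0 s by auto
      have "reach YE ?W C (b (s * int T)) (h e)"
      proof (rule reach_ballY[OF nearY_sym[OF e]])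
        fix x assume x: "nearY C (b (s * int T)) x"
        have "\<not> nearY m (h v) x" if "m < n" for m
        proof
          assume "nearY m (h v) x"
          then have "nearY (m + C) (h v) (b (s * int T))" using reach_trans nearY_sym[OF x] by fast
          then show False using bs T(2) that by simp
        qed
        then show "x \<in> ?W" using reach_in[OF x] by (simp add: outside_ball_def)
      qed
      then have 1: "reach YE ?W C (h e) (b (s * int T))" by (rule reach_sym[OF symYE])
      have "reach YE ?W m (b (s * int n)) (b (s * int (n + m)))" for m
      proof (induction m)
        case 0
        have "b (s * int n) \<in> ?W" using bs[of _ n] geodesic_line_in[OF b] by (simp add: outside_ball_def)
        then show ?case by (simp add: reach_refl)
      next
        case (Suc m)
        have W: "b (s * int (n + m)) \<in> ?W" "b (s * int (n + Suc m)) \<in> ?W"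
          using bs[of _ "n + m"] bs[of _ "n + Suc m"] geodesic_line_in[OF b] by (auto simp: outside_ball_def)
        have dist: "nat \<bar>s * int (n + m) - s * int (n + Suc m)\<bar> = 1" using s by auto
        have "nearY 1 (b (s * int (n + m))) (b (s * int (n + Suc m)))"
          using geodesic_line_near[OF b] dist by simp
        then obtain j where j: "j \<le> 1" "(b (s * int (n + m)), b (s * int (n + Suc m))) \<in> (YE \<inter> YV \<times> YV) ^^ j"
          by (auto simp: reach_def)
        have "j = 0 \<or> j = 1" using j(1) by linarith
        then have "b (s * int (n + m)) = b (s * int (n + Suc m)) \<or> (b (s * int (n + m)), b (s * int (n + Suc m))) \<in> YE"
          using j(2) by auto
        then have "reach YE ?W 1 (b (s * int (n + m))) (b (s * int (n + Suc m)))"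
          using W by (intro reach_step)
        then show ?case using reach_sum[OF Suc] by simp
      qed
      from this[of "T - n"] have "reach YE ?W (T - n) (b (s * int n)) (b (s * int T))" using T(2) by simp
      then show ?thesis using reach_trans[OF 1 reach_sym[OF symYE]] by blast
    qed
    have t1: "reach YE ?W (C + (T - n)) (b (- int n)) (h e1)"
      using reach_sym[OF symYE tail[of e1 "-1"]] e1(1) by simp
    have t2: "reach YE ?W (C + (T - n)) (h e2) (b (int n))" using tail[of e2 1] e2(1) by simp
    have "reach YE ?W F (b (- int n)) (b (int n))"
      using reach_sum[OF reach_trans[OF t1 calculation] t2, of F] F by (simp add: algebra_simps)
    then show False using sep' by simp
  qed
  then show ?thesis using e1(2,3) e2(2,3) unfolding fork_def by blast
qed

text \<open>The same with a costly pair in a level in place of a geodesic. The surroundings of the origin are moved to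
  \<open>v\<close> by the correspondence \<open>pull\<close> of \<open>V\<close> with itself that an automorphism of \<open>Y\<close> induces; it maps edges to
  paths of length \<open>c\<close>. A path far from \<open>v\<close> becomes a path in levels \<open>\<ge> n\<close>, and its projection to
  level \<open>n\<close> connects the given pair.\<close>

lemma fork_of_level_pair:
  assumes o: "o' \<in> V" "lev o' = 0" and u: "u1 \<in> V" "u2 \<in> V" "lev u1 = T" "lev u2 = T"
    and sep: "\<not> reach E {w \<in> V. lev w = n} F (anc n u1) (anc n u2)"
    and c: "c = 4 * C * C + C"
    and R: "C * (C * (n + c) + 2 * C) + C \<le> R" and T: "C * (C * q + 2 * C) + C < T" "n + c \<le> T"
    and d: "C * (C * T + 2 * C) + C \<le> d" and F: "2 * c * X + 2 * c \<le> F"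
    and v: "v \<in> V"
  shows "fork R q d X v"
proof -
  obtain \<phi> \<psi> where \<phi>: "automorphism YV YE \<phi> \<psi>" "\<phi> (h o') = h v"
    using homogeneous[OF h_in[OF o(1)] h_in[OF v]] by blast
  have \<phi>_in: "\<phi> y \<in> YV" "\<psi> y \<in> YV" "\<psi> (\<phi> y) = y" "\<phi> (\<psi> y) = y" if "y \<in> YV" for y
    using \<phi>(1) that by (auto simp: automorphism_def)
  have \<psi>0: "\<psi> (h v) = h o'" using \<phi>(2) \<phi>_in(3) h_in[OF o(1)] by metis
  note \<phi>near = automorphism_near[OF \<phi>(1)] and \<psi>near = automorphism_near[OF automorphism_sym[OF \<phi>(1)]]
  have ends: "\<exists>e. e \<in> V \<and> nearY C (h e) (\<phi> (h u)) \<and> near d v e \<and> \<not> near q v e" if u: "u \<in> V" "lev u = T" for u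
  proof -
    have hu: "h u \<in> YV" using h_in u by simp
    obtain e where e: "e \<in> V" "nearY C (h e) (\<phi> (h u))" using h_dense[OF \<phi>_in(1)[OF hu]] by blast
    have "nearY (C * T + C) (h o') (h u)" using h_upper[OF origin_near[OF o u(1)]] u(2) by simp
    then have "nearY (C * T + C) (h v) (\<phi> (h u))" using \<phi>near[OF h_in[OF o(1)] hu] \<phi>(2) by simp
    then have "nearY (C * T + C + C) (h v) (h e)" using reach_trans nearY_sym[OF e(2)] by fast
    then have "near (C * (C * T + C + C) + C) v e" using h_lower[OF v e(1)] by blast
    then have "near d v e" by (rule reach_le) (use d in \<open>simp add: mult_2 add.assoc\<close>)
    moreover have "\<not> near q v e"
    proof
      assume "near q v e"
      then have "nearY (C * q + C + C) (h v) (\<phi> (h u))" using reach_trans[OF h_upper e(2)] by blast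
      then have "nearY (C * q + C + C) (h o') (h u)" using \<phi>near[OF h_in[OF o(1)] hu] \<phi>(2) by simp
      then have "near (C * (C * q + C + C) + C) o' u" using h_lower o u by blast
      then have "T \<le> C * (C * q + C + C) + C" using near_lev(1) u(2) o(2) by fastforce
      then show False using T(1) by (simp add: mult_2 add.assoc)
    qed
    ultimately show ?thesis using e by blast
  qed
  obtain e1 where e1: "e1 \<in> V" "nearY C (h e1) (\<phi> (h u1))" "near d v e1" "\<not> near q v e1" using ends u by metis
  obtain e2 where e2: "e2 \<in> V" "nearY C (h e2) (\<phi> (h u2))" "near d v e2" "\<not> near q v e2" using ends u by metis
  have "\<forall>a\<in>V. \<exists>w\<in>V. nearY C (h w) (\<psi> (h a))"
    by (intro ballI h_dense \<phi>_in(2) h_in)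
  then obtain pull where pull: "\<And>a. a \<in> V \<Longrightarrow> pull a \<in> V \<and> nearY C (h (pull a)) (\<psi> (h a))" by metis
  let ?W = "{w \<in> V. n \<le> lev w}"
  have "\<not> reach E (outside v R) (2 * X) e1 e2"
  proof
    assume p: "reach E (outside v R) (2 * X) e1 e2"
    have far: "w \<in> ?W" if a: "a \<in> outside v R" and w: "near c (pull a) w" for a w
    proof (rule ccontr)
      assume "w \<notin> ?W"
      then have "lev w \<le> n" using near_in[OF w] by simp
      then have l: "lev (pull a) \<le> n + c" using near_lev(2)[OF w] by simp
      have aV: "a \<in> V" using a by (simp add: outside_def)
      have "near (n + c) o' (pull a)" using reach_le[OF origin_near[OF o] l] pull[OF aV] by blast
      then have "nearY (C * (n + c) + C + C) (h o') (\<psi> (h a))" using reach_trans[OF h_upper] pull[OF aV] by blast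
      then have "nearY (C * (n + c) + C + C) (h v) (h a)" using \<psi>near[OF h_in[OF v] h_in[OF aV]] \<psi>0 by simp
      then have "near (C * (C * (n + c) + C + C) + C) v a" using h_lower v aV by blast
      then have "near R v a" by (rule reach_le) (use R in \<open>simp add: mult_2 add.assoc\<close>)
      then show False using a by (simp add: outside_def)
    qed
    have "reach E ?W (c * (2 * X)) (pull e1) (pull e2)"
    proof (rule reach_transfer[OF p])
      fix a b assume ab: "a \<in> outside v R" "b \<in> outside v R" "(a, b) \<in> E"
      then have V: "a \<in> V" "b \<in> V" unfolding outside_def by blast+
      have "near 1 a b" using ab V by (intro reach_step) auto
      then have "nearY (2 * C) (h a) (h b)" using h_upper[of 1 a b] by (simp add: mult_2)
      then have "nearY (2 * C) (\<psi> (h a)) (\<psi> (h b))" using \<psi>near[OF h_in[OF V(1)] h_in[OF V(2)]] by simp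
      then have "nearY (C + 2 * C + C) (h (pull a)) (h (pull b))"
        using pull[OF V(1)] pull[OF V(2)] nearY_sym by (meson reach_trans)
      then have "near (C * (C + 2 * C + C) + C) (pull a) (pull b)" using h_lower pull V by blast
      then have "near c (pull a) (pull b)" by (rule reach_le) (simp add: c algebra_simps)
      then show "reach E ?W c (pull a) (pull b)" using far[OF ab(1)] by (rule reach_ball)
    next
      fix a assume a: "a \<in> outside v R"
      then show "pull a \<in> ?W" using far[OF a reach_refl] pull[of a] by (simp add: outside_def)
    qed
    moreover have tail: "reach E ?W c u (pull e)"
      if u: "u \<in> V" "lev u = T" and e: "e \<in> V" "nearY C (h e) (\<phi> (h u))" for u e
    proof -
      have hu: "h u \<in> YV" using h_in u by simp
      have "nearY C (\<psi> (h e)) (\<psi> (\<phi> (h u)))" using \<psi>near[OF h_in[OF e(1)] \<phi>_in(1)[OF hu]] e(2) by simp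
      then have "nearY C (\<psi> (h e)) (h u)" using \<phi>_in(3)[OF hu] by simp
      then have "nearY (C + C) (h (pull e)) (h u)" using pull[OF e(1)] by (meson reach_trans)
      then have "near (C * (C + C) + C) (pull e) u" using h_lower pull e u by blast
      then have "near c (pull e) u" by (rule reach_le) (simp add: c algebra_simps)
      then have "near c u (pull e)" by (rule near_sym)
      then show ?thesis
      proof (rule reach_ball)
        fix w assume w: "near c u w"
        show "w \<in> ?W" using near_lev(2)[OF w] near_in[OF w] u(2) T(2) by simp
      qed
    qed
    have "reach E ?W F u1 u2"
      using reach_sum[OF reach_trans[OF tail[OF u(1,3) e1(1,2)] calculation] reach_sym[OF symE tail[OF u(2,4) e2(1,2)]], of F] F
      by (simp add: algebra_simps)
    then have "reach E {w \<in> V. lev w = n} F (anc n u1) (anc n u2)"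
      by (rule reach_anc) (use anc_in lev_anc in auto)
    then show False using sep by simp
  qed
  then show ?thesis using e1 e2 unfolding fork_def by blast
qed

end

section \<open>Geodesics through a chain of gates\<close>

definition geodesic_segment :: "('y \<times> 'y) set \<Rightarrow> 'y set \<Rightarrow> nat \<Rightarrow> (nat \<Rightarrow> 'y) \<Rightarrow> bool" where
  "geodesic_segment YE YV M s \<longleftrightarrow> (\<forall>i j n. i \<le> j \<longrightarrow> j \<le> M \<longrightarrow> (reach YE YV n (s i) (s j) \<longleftrightarrow> j - i \<le> n))"

lemma geodesic_segment_exists:
  assumes "reach YE YV n x y"
  obtains M s where "geodesic_segment YE YV M s" "s 0 = x" "s M = y" "\<And>i. i < M \<Longrightarrow> (s i, s (Suc i)) \<in> YE"
proof -
  define M where "M = (LEAST n. reach YE YV n x y)"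
  have M: "reach YE YV M x y" unfolding M_def using assms by (rule LeastI)
  have least: "M \<le> n" if "reach YE YV n x y" for n unfolding M_def using that by (rule Least_le)
  obtain j where j: "j \<le> M" "x \<in> YV" "(x, y) \<in> (YE \<inter> YV \<times> YV) ^^ j" using M by (auto simp: reach_def)
  have "reach YE YV j x y" using j by (auto simp: reach_def)
  then have "j = M" using j(1) least by (simp add: le_antisym)
  then obtain s where s: "s 0 = x" "s M = y" "\<And>i. i < M \<Longrightarrow> (s i, s (Suc i)) \<in> YE \<inter> YV \<times> YV"
    using j(3) relpow_fun_conv[of x y M] by blast
  have up: "reach YE YV (j - i) (s i) (s j)" if "i \<le> j" "j \<le> M" for i j
    using that
  proof (induction j rule: dec_induct)
    case base
    have "s i \<in> YV" using s(3)[of i] s(1,2) j(2) reach_in[OF M] base by (cases "i < M") auto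
    then show ?case by (simp add: reach_refl)
  next
    case (step j)
    have "reach YE YV 1 (s j) (s (Suc j))" using s(3)[of j] step by (intro reach_step) auto
    then show ?case using reach_sum[of YE YV "j - i" "s i" "s j" 1 "s (Suc j)"] step by simp
  qed
  have lo: "j - i \<le> n" if ij: "i \<le> j" "j \<le> M" and n: "reach YE YV n (s i) (s j)" for i j n
  proof -
    have "reach YE YV (i + n + (M - j)) (s 0) (s M)"
    proof (rule reach_trans[OF reach_trans[OF _ n]])
      show "reach YE YV i (s 0) (s i)" using up[of 0 i] ij by simp
      show "reach YE YV (M - j) (s j) (s M)" using up[of j M] ij by simp
    qed
    then have "M \<le> i + n + (M - j)" using least s by simp
    then show ?thesis using ij by simp
  qed
  have "geodesic_segment YE YV M s" unfolding geodesic_segment_def using up lo reach_le by metis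
  then show thesis using that s by blast
qed

lemma gradual_value:
  fixes f :: "nat \<Rightarrow> nat"
  assumes "\<And>i. p \<le> i \<Longrightarrow> i < r \<Longrightarrow> f (Suc i) \<le> f i + J" and "f p \<le> y" "y \<le> f r" "p \<le> r"
  shows "\<exists>i. p \<le> i \<and> i \<le> r \<and> f i \<le> y \<and> y \<le> f i + J"
  using assms(4,1,3)
proof (induction r rule: dec_induct)
  case base
  then show ?case using assms(2) by auto
next
  case (step r)
  show ?case
  proof (cases "y \<le> f r")
    case True
    then obtain i where "p \<le> i \<and> i \<le> r \<and> f i \<le> y \<and> y \<le> f i + J" using step by force
    then show ?thesis using le_SucI by blast
  next
    case False
    moreover have "f (Suc r) \<le> f r + J" using step.prems(1)[of r] step.hyps by simp
    ultimately show ?thesis using step.prems(2) step.hyps by (intro exI[of _ r]) auto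
  qed
qed

context combed
begin

lemma finite_nearY: "x \<in> YV \<Longrightarrow> finite {y. nearY n x y}"
proof (induction n)
  case 0
  have "{y. nearY 0 x y} \<subseteq> {x}" by (auto simp: reach_def)
  then show ?case using finite_subset by blast
next
  case (Suc n)
  let ?B = "{y. nearY n x y}"
  have "{y. nearY (Suc n) x y} \<subseteq> ?B \<union> (\<Union>y\<in>?B. {z. (y, z) \<in> YE})"
  proof
    fix z assume "z \<in> {y. nearY (Suc n) x y}"
    then obtain j where j: "j \<le> Suc n" "(x, z) \<in> (YE \<inter> YV \<times> YV) ^^ j" by (auto simp: reach_def)
    show "z \<in> ?B \<union> (\<Union>y\<in>?B. {z. (y, z) \<in> YE})"
    proof (cases "j \<le> n")
      case True
      then show ?thesis using j Suc.prems by (auto simp: reach_def)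
    next
      case False
      then have "j = Suc n" using j(1) by simp
      then obtain y where "(x, y) \<in> (YE \<inter> YV \<times> YV) ^^ n" "(y, z) \<in> YE" using j(2) by auto
      then show ?thesis using Suc.prems by (auto simp: reach_def)
    qed
  qed
  moreover have "finite (?B \<union> (\<Union>y\<in>?B. {z. (y, z) \<in> YE}))"
  proof (intro finite_UnI finite_UN_I)
    show "finite {z. (y, z) \<in> YE}" if "y \<in> ?B" for y
      using that reach_in[of YE YV n x y] by (intro locally_finite) simp
  qed (use Suc in auto)
  ultimately show ?case by (rule finite_subset)
qed

text \<open>Koenig's lemma. By local finiteness infinitely many of the segments agree on \<open>[-N, N]\<close> for each \<open>N\<close>, and
  these infinite sets of indices can be chosen decreasing in \<open>N\<close>. The limit agrees on each interval with
  one of the segments, so finite configurations along the segments survive.\<close>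

lemma limit_line:
  fixes g :: "nat \<Rightarrow> int \<Rightarrow> 'y"
  assumes y0: "y0 \<in> YV" and g0: "\<And>q. g q 0 = y0"
    and g: "\<And>q i j n. \<bar>i\<bar> \<le> int q \<Longrightarrow> \<bar>j\<bar> \<le> int q \<Longrightarrow> nearY n (g q i) (g q j) \<longleftrightarrow> nat \<bar>i - j\<bar> \<le> n"
  obtains \<beta> where "geodesic_line YV YE \<beta>" "\<And>N. \<exists>q\<ge>N. \<forall>i. \<bar>i\<bar> \<le> int N \<longrightarrow> \<beta> i = g q i"
proof -
  define agree where "agree = (\<lambda>N Q. \<forall>p\<in>Q. \<forall>q\<in>Q. \<forall>i. \<bar>i\<bar> \<le> int N \<longrightarrow> g p i = g q i)"
  have "\<exists>Q. \<forall>N. (infinite (Q N) \<and> (\<forall>q\<in>Q N. N \<le> q) \<and> agree N (Q N)) \<and> Q (Suc N) \<subseteq> Q N"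
  proof (rule dependent_nat_choice)
    have "agree 0 UNIV" using g0 by (auto simp: agree_def)
    then show "\<exists>Q. infinite Q \<and> (\<forall>q\<in>Q. 0 \<le> q) \<and> agree 0 Q" using infinite_UNIV_nat by blast
  next
    fix Q N assume Q: "infinite Q \<and> (\<forall>q\<in>Q. N \<le> q) \<and> agree N Q"
    let ?Q = "Q - {..N}" and ?I = "{- int (Suc N)..int (Suc N)}"
    let ?f = "\<lambda>q. restrict (g q) ?I"
    have inf: "infinite ?Q" using Q by simp
    have "?f ` ?Q \<subseteq> Pi\<^sub>E ?I (\<lambda>_. {y. nearY (Suc N) y0 y})"
    proof (intro image_subsetI restrict_PiE_iff[THEN iffD2] ballI)
      fix q i assume "q \<in> ?Q" "i \<in> ?I"
      then have "\<bar>i\<bar> \<le> int q" "nat \<bar>0 - i\<bar> \<le> Suc N" by auto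
      then show "g q i \<in> {y. nearY (Suc N) y0 y}" using g[of 0 q i] g0[of q] by simp
    qed
    moreover have "finite (Pi\<^sub>E ?I (\<lambda>_. {y. nearY (Suc N) y0 y}))"
      using finite_nearY[OF y0] by (intro finite_PiE) auto
    ultimately have "finite (?f ` ?Q)" by (rule finite_subset)
    from pigeonhole_infinite[OF inf this] obtain p where p: "p \<in> ?Q" "infinite {q \<in> ?Q. ?f q = ?f p}" by blast
    have "agree (Suc N) {q \<in> ?Q. ?f q = ?f p}"
      unfolding agree_def
    proof (intro ballI allI impI)
      fix a b i assume a: "a \<in> {q \<in> ?Q. ?f q = ?f p}" and b: "b \<in> {q \<in> ?Q. ?f q = ?f p}" and i: "\<bar>i\<bar> \<le> int (Suc N)"
      have "i \<in> ?I" using i by auto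
      moreover have "?f a i = ?f b i" using a b by simp
      ultimately show "g a i = g b i" by simp
    qed
    moreover have "\<forall>q\<in>{q \<in> ?Q. ?f q = ?f p}. Suc N \<le> q" by auto
    ultimately show "\<exists>Q'. (infinite Q' \<and> (\<forall>q\<in>Q'. Suc N \<le> q) \<and> agree (Suc N) Q') \<and> Q' \<subseteq> Q"
      using p(2) by (intro exI[of _ "{q \<in> ?Q. ?f q = ?f p}"]) auto
  qed
  then obtain Q where Q: "\<And>N. infinite (Q N)" "\<And>N q. q \<in> Q N \<Longrightarrow> N \<le> q" "\<And>N. agree N (Q N)" "\<And>N. Q (Suc N) \<subseteq> Q N"
    by blast
  have mono: "Q N \<subseteq> Q M" if "M \<le> N" for M N using Q(4) that by (rule lift_Suc_antimono_le)
  define pick where "pick N = (SOME q. q \<in> Q N)" for N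
  have pick: "pick N \<in> Q N" for N
    unfolding pick_def by (rule someI_ex, rule ex_in_conv[THEN iffD2]) (metis Q(1) finite.emptyI)
  define \<beta> where "\<beta> i = g (pick (nat \<bar>i\<bar>)) i" for i
  have \<beta>: "\<beta> i = g (pick N) i" if "\<bar>i\<bar> \<le> int N" for i N
  proof -
    have "nat \<bar>i\<bar> \<le> N" using that by simp
    then have "pick N \<in> Q (nat \<bar>i\<bar>)" using pick[of N] mono[of "nat \<bar>i\<bar>" N] by blast
    moreover have "\<bar>i\<bar> \<le> int (nat \<bar>i\<bar>)" by simp
    ultimately show ?thesis using Q(3)[of "nat \<bar>i\<bar>"] pick[of "nat \<bar>i\<bar>"] unfolding agree_def \<beta>_def by metis
  qed
  have "nearY n (\<beta> i) (\<beta> j) \<longleftrightarrow> nat \<bar>i - j\<bar> \<le> n" for i j n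
  proof -
    let ?N = "nat (max \<bar>i\<bar> \<bar>j\<bar>)"
    have b: "\<bar>i\<bar> \<le> int ?N" "\<bar>j\<bar> \<le> int ?N" by auto
    moreover have "?N \<le> pick ?N" using Q(2)[OF pick] .
    ultimately have "\<bar>i\<bar> \<le> int (pick ?N)" "\<bar>j\<bar> \<le> int (pick ?N)" by linarith+
    then show ?thesis using g \<beta>[OF b(1)] \<beta>[OF b(2)] by simp
  qed
  then have "geodesic_line YV YE \<beta>" unfolding geodesic_line_def by auto
  moreover have "\<exists>q\<ge>N. \<forall>i. \<bar>i\<bar> \<le> int N \<longrightarrow> \<beta> i = g q i" for N
    using \<beta> Q(2)[OF pick] by blast
  ultimately show thesis using that by blast
qed

definition pull :: "'y \<Rightarrow> 'v" where
  "pull y = (SOME v. v \<in> V \<and> nearY C (h v) y)"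

lemma pull: "y \<in> YV \<Longrightarrow> pull y \<in> V \<and> nearY C (h (pull y)) y"
  unfolding pull_def by (rule someI_ex) (use h_dense in blast)

text \<open>Pull-backs of adjacent vertices of \<open>Y\<close> are at most this far apart in \<open>V\<close>.\<close>

definition C1 :: nat where
  "C1 = C * (2 * C + 1) + C"

lemma pull_near:
  assumes "nearY n x y"
  shows "near (C * (n + 2 * C) + C) (pull x) (pull y)"
proof -
  have xy: "x \<in> YV" "y \<in> YV" using reach_in[OF assms] by auto
  have "nearY (C + n + C) (h (pull x)) (h (pull y))"
    using reach_trans[OF reach_trans[OF conjunct2[OF pull[OF xy(1)]] assms] nearY_sym[OF conjunct2[OF pull[OF xy(2)]]]] .
  then have "near (C * (C + n + C) + C) (pull x) (pull y)" using h_lower pull[OF xy(1)] pull[OF xy(2)] by blast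
  then show ?thesis by (rule reach_le) (simp add: algebra_simps)
qed

lemma pull_near_rev:
  assumes "near n (pull x) (pull y)" "x \<in> YV" "y \<in> YV"
  shows "nearY (C * n + 3 * C) x y"
  using reach_trans[OF reach_trans[OF nearY_sym[OF conjunct2[OF pull[OF assms(2)]]] h_upper[OF assms(1)]] conjunct2[OF pull[OF assms(3)]]]
  by (rule reach_le) simp

lemma pull_h: "v \<in> V \<Longrightarrow> near C1 v (pull (h v))"
proof -
  assume v: "v \<in> V"
  have "near (C * C + C) v (pull (h v))"
    using h_lower[OF v] pull[OF h_in[OF v]] nearY_sym by blast
  then show ?thesis by (rule reach_le) (simp add: C1_def algebra_simps)
qed

lemma pull_edge: "(x, y) \<in> YE \<Longrightarrow> near C1 (pull x) (pull y)"
proof -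
  assume "(x, y) \<in> YE"
  then have "nearY 1 x y" using YE_sub by (intro reach_step) auto
  from pull_near[OF this] show ?thesis by (rule reach_le) (simp add: C1_def algebra_simps)
qed

end

text \<open>A chain of gates whose price \<open>Y\<close> is large compared with the spacing \<open>d\<close>. The last assumption compares the
  price of a gate with the length of a path in \<open>V\<close> that follows a geodesic segment of \<open>Y\<close> between the
  neighborhoods of two consecutive gates, for twice the spacing.\<close>

locale gated = combed V E lev par YV YE h C
  for V :: "'v set" and E lev par and YV :: "'y set" and YE h C +
  fixes R d X Y :: nat and v :: "nat \<Rightarrow> 'v"
  assumes chain: "gate_chain R d X v"
    and YX: "5 * Y + 4 * d + 17 * R + 2 \<le> X"
    and C1R: "C1 \<le> R"
    and Y_large: "2 * (R + C1) + C1 * (2 * C * d + 2 * C * (R + C1) + 3 * C) < Y"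
begin

text \<open>A geodesic segment that visits two consecutive gates needs at most this time between the visits, see
  \<open>visit_distance\<close>.\<close>

definition J :: nat where "J = C * d + 2 * C * (R + C1) + 3 * C"

lemma chain_in: "v i \<in> V" using gate_chainD(1)[OF chain] .

lemma chain_lev: "i < j \<Longrightarrow> lev (v i) + 4 * R < lev (v j)"
proof -
  assume "i < j"
  then obtain k where "j = i + Suc k" using less_imp_Suc_add by auto
  then show ?thesis using gate_chain_lev[OF chain, of i "Suc k"] by simp
qed

lemma not_in_later_shadow:
  assumes "i < j"
  shows "v i \<notin> shadow (v j) R"
proof
  assume "v i \<in> shadow (v j) R"
  then obtain l where "near R (v j) (anc l (v i))" by (auto simp: shadow_def)
  from near_lev(2)[OF this] have "lev (v j) \<le> lev (v i) + R" using lev_anc[OF chain_in, of l i] by simp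
  then show False using chain_lev[OF assms] by simp
qed

lemma in_earlier_shadow: "i \<le> j \<Longrightarrow> v j \<in> shadow (v i) R"
  using gate_chain_shadow[OF chain, of i "j - i"] shadow_self[OF chain_in] by auto

lemma visit_distance:
  assumes seg: "geodesic_segment YE YV M s" and i: "near (R + C1) (v i) (pull (s j))" "near (R + C1) (v i') (pull (s j'))"
    and ij: "j \<le> j'" "j' \<le> M" and L: "near L (v i) (v i')"
  shows "j' - j \<le> C * L + 2 * C * (R + C1) + 3 * C"
proof -
  have s: "s j \<in> YV" "s j' \<in> YV" using seg ij unfolding geodesic_segment_def by (meson reach_in order_refl)+
  have "near (R + C1 + L + (R + C1)) (pull (s j)) (pull (s j'))"
    using reach_trans[OF reach_trans[OF near_sym[OF i(1)] L] i(2)] .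
  from pull_near_rev[OF this s] have "j' - j \<le> C * (R + C1 + L + (R + C1)) + 3 * C"
    using seg ij unfolding geodesic_segment_def by blast
  then show ?thesis by (simp add: algebra_simps)
qed

lemma geodesic_segment_in: "geodesic_segment YE YV M s \<Longrightarrow> j \<le> M \<Longrightarrow> s j \<in> YV"
  unfolding geodesic_segment_def by (meson reach_in order_refl)

text \<open>Suppose that the segment misses the \<open>i\<close>-th gate, and let \<open>a\<close> and \<open>b\<close> be the nearest visited gates before
  and after it. Between these visits the segment avoids the \<open>b - a - 1\<close> gates between them and pays for all of
  them. As a geodesic it is not much longer than the part of the chain from \<open>a\<close> to \<open>b\<close>, which is linear in
  \<open>b - a \<le> 2 * (b - a - 1)\<close>. The price of a gate is chosen to rule this out.\<close>

lemma segment_visits: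
  assumes seg: "geodesic_segment YE YV M s" and edges: "\<And>j. j < M \<Longrightarrow> (s j, s (Suc j)) \<in> YE"
    and ends: "s 0 = h (v 0)" "s M = h (v m)" and im: "i \<le> m"
  shows "\<exists>j\<le>M. near (R + C1) (v i) (pull (s j))"
proof (rule ccontr)
  let ?vis = "\<lambda>i. \<exists>j\<le>M. near (R + C1) (v i) (pull (s j))"
  assume not: "\<not> ?vis i"
  have "near C1 (v 0) (pull (s 0))" "near C1 (v m) (pull (s M))" using pull_h chain_in ends by auto
  then have vis0: "?vis 0" and vism: "?vis m" using reach_le[of E V C1 _ _ "R + C1"] by force+
  define b where "b = (LEAST b. i \<le> b \<and> ?vis b)"
  have b: "i \<le> b" "?vis b" unfolding b_def using LeastI[of "\<lambda>b. i \<le> b \<and> ?vis b" m] vism im by blast+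
  have b_least: "\<not> ?vis k" if "i \<le> k" "k < b" for k using not_less_Least[of k "\<lambda>b. i \<le> b \<and> ?vis b"] that b_def by blast
  define a where "a = (GREATEST a. a \<le> i \<and> ?vis a)"
  have a: "a \<le> i" "?vis a"
    unfolding a_def using GreatestI_nat[of "\<lambda>a. a \<le> i \<and> ?vis a" 0 i] vis0 by blast+
  have a_greatest: "\<not> ?vis k" if "k \<le> i" "a < k" for k
    using Greatest_le_nat[of "\<lambda>a. a \<le> i \<and> ?vis a" k i] that a_def by fastforce
  have "a \<noteq> i" "b \<noteq> i" using a b not by auto
  then have ab: "a < i" "i < b" using a b by auto
  have novis: "\<not> near (R + C1) (v k) (pull (s j))" if "a < k" "k < b" "j \<le> M" for k j
    using a_greatest[of k] b_least[of k] that by (cases "k \<le> i") auto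
  define W where "W = {w \<in> V. \<forall>k. a < k \<longrightarrow> k < b \<longrightarrow> \<not> near R (v k) w}"
  obtain ja where ja: "ja \<le> M" "near (R + C1) (v a) (pull (s ja))" using a by blast
  obtain jb where jb: "jb \<le> M" "near (R + C1) (v b) (pull (s jb))" using b by blast
  have stepW: "reach E W C1 (pull (s j)) (pull (s (Suc j)))" if "j < M" for j
  proof (rule reach_ball[OF pull_edge[OF edges[OF that]]])
    fix w assume w: "near C1 (pull (s j)) w"
    have "\<not> near R (v k) w" if "a < k" "k < b" for k
    proof
      assume "near R (v k) w"
      from reach_trans[OF this near_sym[OF w]] show False using novis[OF that] \<open>j < M\<close> by simp
    qed
    then show "w \<in> W" using near_in[OF w] by (simp add: W_def)
  qed
  have path: "reach E W (C1 * (j' - j)) (pull (s j)) (pull (s j'))" if "j \<le> j'" "j' \<le> M" for j j'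
    using that
  proof (induction j' rule: dec_induct)
    case base
    have "pull (s j) \<in> V" using pull[OF geodesic_segment_in[OF seg]] base by blast
    moreover have "\<not> near R (v k) (pull (s j))" if "a < k" "k < b" for k
      using novis[OF that base] reach_le[of E V R _ _ "R + C1"] by auto
    ultimately show ?case by (simp add: W_def reach_refl)
  next
    case (step j')
    have "reach E W (C1 * (j' - j)) (pull (s j)) (pull (s j'))" using step by simp
    from reach_trans[OF this stepW] show ?case using step by (simp add: Suc_diff_le algebra_simps)
  qed
  have lev_ab: "\<bar>int (lev (v k)) - int (lev (v e))\<bar> > int (4 * R)" if "a < k" "k < b" "e = a \<or> e = b" for k e
    using chain_lev[of a k] chain_lev[of k b] that by auto
  have endW: "reach E W (R + C1) (v e) (pull (s j))" if e: "e = a \<or> e = b" and near: "near (R + C1) (v e) (pull (s j))" for e j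
  proof (rule reach_ball[OF near])
    fix w assume w: "near (R + C1) (v e) w"
    have "\<not> near R (v k) w" if k: "a < k" "k < b" for k
    proof
      assume n: "near R (v k) w"
      show False using lev_ab[OF k e] near_lev[OF w] near_lev[OF n] C1R by linarith
    qed
    then show "w \<in> W" using near_in[OF w] by (simp add: W_def)
  qed
  define L where "L = b - a"
  have L: "near (L * d) (v a) (v b)" using gate_chain_near[OF chain, of L a] ab by (simp add: L_def)
  define D where "D = C * (L * d) + 2 * C * (R + C1) + 3 * C"
  have "reach E W (C1 * D) (pull (s ja)) (pull (s jb))"
  proof (cases "ja \<le> jb")
    case True
    have "jb - ja \<le> D" unfolding D_def by (rule visit_distance[OF seg ja(2) jb(2) True jb(1) L])
    then show ?thesis using reach_le[OF path[OF True jb(1)]] by simp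
  next
    case False
    then have le: "jb \<le> ja" by simp
    have "ja - jb \<le> D" unfolding D_def by (rule visit_distance[OF seg jb(2) ja(2) le ja(1) near_sym[OF L]])
    then show ?thesis using reach_le[OF reach_sym[OF symE path[OF le ja(1)]]] by simp
  qed
  then have p: "reach E W (2 * (R + C1) + C1 * D) (v a) (v b)"
    using reach_sum[OF reach_trans[OF endW[of a ja] _] reach_sym[OF symE endW[of b jb]]] ja jb by (simp add: algebra_simps)
  have "(b - Suc a) * Y \<le> 2 * (R + C1) + C1 * D"
  proof (rule gate_chain_cost[OF chain YX p])
    show "W \<subseteq> outside (v (Suc a + k)) R" if "k < b - Suc a" for k
      using that by (auto simp: W_def outside_def)
    show "v a \<notin> shadow (v (Suc a)) R" by (rule not_in_later_shadow) simp
    show "v b \<in> shadow (v (Suc a + (b - Suc a))) R" using in_earlier_shadow ab by simp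
  qed
  moreover define K where "K = b - Suc a"
  ultimately have "K * Y \<le> 2 * (R + C1) + C1 * D" by simp
  moreover have K: "1 \<le> K" "L \<le> 2 * K" using ab by (auto simp: K_def L_def)
  have "D \<le> K * (2 * C * d + 2 * C * (R + C1) + 3 * C)"
  proof -
    have "C * (L * d) \<le> C * (2 * K * d)" using K(2) by (intro mult_le_mono order_refl)
    moreover have "2 * C * (R + C1) + 3 * C \<le> K * (2 * C * (R + C1) + 3 * C)" using K(1) by simp
    moreover have "K * (2 * C * d + 2 * C * (R + C1) + 3 * C) = C * (2 * K * d) + K * (2 * C * (R + C1) + 3 * C)"
      by (simp add: algebra_simps)
    ultimately show ?thesis unfolding D_def by linarith
  qed
  then have "C1 * D \<le> C1 * (K * (2 * C * d + 2 * C * (R + C1) + 3 * C))" by (rule mult_le_mono2)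
  moreover have "2 * (R + C1) \<le> K * (2 * (R + C1))" using K(1) by simp
  ultimately have "K * Y \<le> K * (2 * (R + C1) + C1 * (2 * C * d + 2 * C * (R + C1) + 3 * C))"
    by (simp add: algebra_simps)
  then show False using K(1) Y_large by simp
qed

text \<open>For each \<open>q\<close> take a geodesic segment between the images of the gates \<open>0\<close> and \<open>2 * c q\<close> and recenter it at
  its visit \<open>x q\<close> to the gate \<open>c q\<close>. Both halves have length at least \<open>q\<close>, so the segments have a limit line.
  A detour for the line around the ball of radius \<open>N\<close> is a detour for one of the segments. Its ends are
  close to visits to gates \<open>i1 < c q\<close> and \<open>i2 > c q + k\<close>, so the pulled-back detour can be prolonged to these
  two gates, and it pays for the \<open>k\<close> gates from \<open>c q\<close> on, all of which lie deep inside the ball.\<close>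

lemma gate_line:
  assumes N: "C * (R + C1) + C * (k * d + R + (R + C1 + C * (J + 2 * C) + C) + C1) + 6 * C < N"
  obtains \<beta> where "geodesic_line YV YE \<beta>"
    "\<And>n. reach YE (outside_ball YV YE (\<beta> 0) N) n (\<beta> (- int N)) (\<beta> (int N)) \<Longrightarrow>
       k * Y \<le> C1 * n + 2 * (R + C1 + C * (J + 2 * C) + C)"
proof -
  define R6 where "R6 = R + C1"
  define J2 where "J2 = R6 + C * (J + 2 * C) + C"
  \<comment> \<open>The gate \<open>i\<close> is visited at time \<open>t i\<close>. The value of \<open>c q\<close> is what \<open>spread\<close> needs to make both halves long.\<close>
  define c where "c q = C * q + 2 * R6 + 2 * C * C + C + 1" for q :: nat
  define good where "good q M s t \<longleftrightarrow> geodesic_segment YE YV M s \<and> (\<forall>j<M. (s j, s (Suc j)) \<in> YE) \<and>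
      (\<forall>i\<le>2 * c q. t i \<le> M \<and> near R6 (v i) (pull (s (t i)))) \<and> t 0 = 0 \<and> t (2 * c q) = M" for q M s t
  have "\<exists>M s t. good q M s t" for q
  proof -
    obtain n where "nearY n (h (v 0)) (h (v (2 * c q)))" using Y_connected h_in chain_in by blast
    then obtain M s where s: "geodesic_segment YE YV M s" "s 0 = h (v 0)" "s M = h (v (2 * c q))" "\<And>i. i < M \<Longrightarrow> (s i, s (Suc i)) \<in> YE"
      by (rule geodesic_segment_exists) blast
    have "\<forall>i. \<exists>j. i \<le> 2 * c q \<longrightarrow> j \<le> M \<and> near R6 (v i) (pull (s j))"
      unfolding R6_def using segment_visits[OF s(1) s(4) s(2) s(3)] by blast
    then obtain t0 where t0: "\<And>i. i \<le> 2 * c q \<Longrightarrow> t0 i \<le> M \<and> near R6 (v i) (pull (s (t0 i)))" by metis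
    have e: "near R6 (v 0) (pull (s 0))" "near R6 (v (2 * c q)) (pull (s M))"
      using reach_le[OF pull_h[OF chain_in], of R6] s(2,3) by (auto simp: R6_def)
    have "good q M s (t0(0 := 0, 2 * c q := M))"
      unfolding good_def using s(1,4) t0 e by (auto simp: c_def)
    then show ?thesis by blast
  qed
  then obtain M s t where good: "\<And>q. good q (M q) (s q) (t q)" by metis
  have seg: "geodesic_segment YE YV (M q) (s q)" and t: "i \<le> 2 * c q \<Longrightarrow> t q i \<le> M q \<and> near R6 (v i) (pull (s q (t q i)))"
    and edge: "j < M q \<Longrightarrow> (s q j, s q (Suc j)) \<in> YE"
    and t0: "t q 0 = 0" and tm: "t q (2 * c q) = M q" for q i j
    using good[of q] by (auto simp: good_def)
  have sin: "j \<le> M q \<Longrightarrow> s q j \<in> YV" for q j using geodesic_segment_in[OF seg] .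
  have near_seg: "nearY n (s q i) (s q j) \<longleftrightarrow> nat \<bar>int i - int j\<bar> \<le> n" if "i \<le> M q" "j \<le> M q" for q i j n
  proof (cases "i \<le> j")
    case True
    then have "nat \<bar>int i - int j\<bar> = j - i" by auto
    then show ?thesis using seg[of q] True that unfolding geodesic_segment_def by auto
  next
    case False
    then have "nat \<bar>int i - int j\<bar> = i - j" by auto
    moreover have "nearY n (s q i) (s q j) \<longleftrightarrow> nearY n (s q j) (s q i)" using nearY_sym by blast
    ultimately show ?thesis using seg[of q] False that unfolding geodesic_segment_def by auto
  qed
  have spread: "i' - i \<le> C * (nat \<bar>int (t q i) - int (t q i')\<bar>) + 2 * R6 + 2 * C * C + C"
    if "i \<le> i'" "i' \<le> 2 * c q" for q i i'
  proof -
    let ?n = "nat \<bar>int (t q i) - int (t q i')\<bar>"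
    have ti: "t q i \<le> M q" "near R6 (v i) (pull (s q (t q i)))" "t q i' \<le> M q" "near R6 (v i') (pull (s q (t q i')))"
      using t that by auto
    have "nearY ?n (s q (t q i)) (s q (t q i'))" using near_seg ti by simp
    from reach_trans[OF reach_trans[OF ti(2) pull_near[OF this]] near_sym[OF ti(4)]]
    have "lev (v i') \<le> lev (v i) + (R6 + (C * (?n + 2 * C) + C) + R6)" by (rule near_lev(1))
    moreover have "lev (v i) + (i' - i) * (4 * R + 1) \<le> lev (v i')"
      using gate_chain_lev[OF chain, of i "i' - i"] that by simp
    then have "lev (v i) + (i' - i) \<le> lev (v i')" by (simp add: algebra_simps)
    ultimately show ?thesis by (simp add: algebra_simps)
  qed
  have tJ: "t q (Suc i) \<le> t q i + J" if "Suc i \<le> 2 * c q" for q i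
  proof (cases "t q i \<le> t q (Suc i)")
    case True
    have "t q (Suc i) - t q i \<le> C * d + 2 * C * (R + C1) + 3 * C"
      using t[of i q] t[of "Suc i" q] that unfolding R6_def
      by (intro visit_distance[OF seg _ _ True _ gate_chainD(3)[OF chain]]) auto
    then show ?thesis by (simp add: J_def)
  qed simp
  define x where "x q = s q (t q (c q))" for q
  have center: "q \<le> t q (c q)" "t q (c q) + q \<le> M q" for q
  proof -
    have far: "q \<le> n" if "c q \<le> C * n + 2 * R6 + 2 * C * C + C" for n
    proof (rule ccontr)
      assume "\<not> q \<le> n"
      then have "C * n \<le> C * q" by (intro mult_le_mono2) simp
      then show False using that unfolding c_def by linarith
    qed
    have "c q \<le> C * t q (c q) + 2 * R6 + 2 * C * C + C" using spread[of 0 "c q" q] t0[of q] by simp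
    then show "q \<le> t q (c q)" by (rule far)
    have le: "t q (c q) \<le> M q" using t[of "c q" q] by simp
    then have eq: "nat \<bar>int (t q (c q)) - int (M q)\<bar> = M q - t q (c q)" by simp
    have "2 * c q - c q \<le> C * nat \<bar>int (t q (c q)) - int (t q (2 * c q))\<bar> + 2 * R6 + 2 * C * C + C"
      by (rule spread) simp_all
    then have "c q \<le> C * (M q - t q (c q)) + 2 * R6 + 2 * C * C + C"
      unfolding tm eq by simp
    then have "q \<le> M q - t q (c q)" by (rule far)
    then show "t q (c q) + q \<le> M q" using le by simp
  qed
  define y0 where "y0 = h (v 0)"
  have y0: "y0 \<in> YV" using h_in chain_in by (simp add: y0_def)
  have xin: "x q \<in> YV" for q using sin center(2)[of q] by (simp add: x_def)
  have "\<forall>q. \<exists>\<phi> \<psi>. automorphism YV YE \<phi> \<psi> \<and> \<phi> (x q) = y0"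
    using homogeneous[OF xin y0] by blast
  then obtain \<phi> \<psi> where \<phi>: "\<And>q. automorphism YV YE (\<phi> q) (\<psi> q)" "\<And>q. \<phi> q (x q) = y0" by metis
  define g where "g q i = \<phi> q (s q (nat (int (t q (c q)) + i)))" for q i
  have idx: "nat (int (t q (c q)) + i) \<le> M q" "int (nat (int (t q (c q)) + i)) = int (t q (c q)) + i" if "\<bar>i\<bar> \<le> int q" for q i
    using center[of q] that by linarith+
  have g0: "g q 0 = y0" for q using \<phi>(2) by (simp add: g_def x_def)
  have g: "nearY n (g q i) (g q j) \<longleftrightarrow> nat \<bar>i - j\<bar> \<le> n" if "\<bar>i\<bar> \<le> int q" "\<bar>j\<bar> \<le> int q" for q i j n
    using automorphism_near[OF \<phi>(1) sin[OF idx(1)[OF that(1)]] sin[OF idx(1)[OF that(2)]]]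
      near_seg[OF idx(1)[OF that(1)] idx(1)[OF that(2)]] idx(2)[OF that(1)] idx(2)[OF that(2)] by (simp add: g_def)
  obtain \<beta> where \<beta>: "geodesic_line YV YE \<beta>" "\<And>N. \<exists>q\<ge>N. \<forall>i. \<bar>i\<bar> \<le> int N \<longrightarrow> \<beta> i = g q i"
    using limit_line[OF y0, of g] g0 g by blast
  show thesis
  proof (rule that[OF \<beta>(1)])
    fix n assume p: "reach YE (outside_ball YV YE (\<beta> 0) N) n (\<beta> (- int N)) (\<beta> (int N))"
    obtain q where q: "N \<le> q" "\<And>i. \<bar>i\<bar> \<le> int N \<Longrightarrow> \<beta> i = g q i" using \<beta>(2)[of N] by blast
    let ?c = "c q" and ?tc = "t q (c q)"
    have tc: "N \<le> ?tc" "?tc + N \<le> M q" using center[of q] q(1) by auto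
    have "\<beta> 0 = \<phi> q (x q)" "\<beta> (- int N) = \<phi> q (s q (?tc - N))" "\<beta> (int N) = \<phi> q (s q (?tc + N))"
      using q(2)[of 0] q(2)[of "- int N"] q(2)[of "int N"] tc by (auto simp: g_def x_def nat_diff_distrib nat_add_distrib)
    then have "reach YE (outside_ball YV YE (\<psi> q (\<phi> q (x q))) N) n (\<psi> q (\<phi> q (s q (?tc - N)))) (\<psi> q (\<phi> q (s q (?tc + N))))"
      using automorphism_reach_outside_ball[OF automorphism_sym[OF \<phi>(1)] geodesic_line_in[OF \<beta>(1)] p] by simp
    moreover have "\<psi> q (\<phi> q y) = y" if "y \<in> YV" for y using \<phi>(1)[of q] that by (simp add: automorphism_def)
    moreover have "s q (?tc - N) \<in> YV" "s q (?tc + N) \<in> YV" using sin tc by auto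
    ultimately have p: "reach YE (outside_ball YV YE (x q) N) n (s q (?tc - N)) (s q (?tc + N))" using xin by simp
    define r where "r = k * d + R"
    let ?W = "{w \<in> V. \<not> near (r + J2) (v ?c) w}" and ?W' = "{w \<in> V. \<not> near r (v ?c) w}"
    have c2: "?c \<le> 2 * c q" by simp
    have far: "w \<in> ?W" if y: "y \<in> outside_ball YV YE (x q) N" and w: "near C1 (pull y) w" for y w
    proof -
      have "\<not> near (r + J2) (v ?c) w"
      proof
        assume "near (r + J2) (v ?c) w"
        from reach_trans[OF reach_trans[OF near_sym[OF conjunct2[OF t[OF c2]]] this] near_sym[OF w]]
        have 1: "near (R6 + (r + J2) + C1) (pull (x q)) (pull y)" by (simp add: x_def)
        have "y \<in> YV" using y by (simp add: outside_ball_def)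
        from pull_near_rev[OF 1 xin this] have "nearY (C * (R6 + (r + J2) + C1) + 3 * C) (x q) y" .
        moreover have "C * (R6 + (r + J2) + C1) + 3 * C < N"
          using N by (simp add: R6_def J2_def r_def algebra_simps)
        ultimately show False using y by (simp add: outside_ball_def)
      qed
      then show ?thesis using near_in[OF w] by simp
    qed
    have "reach E ?W (C1 * n) (pull (s q (?tc - N))) (pull (s q (?tc + N)))"
    proof (rule reach_transfer[OF p])
      fix a b assume ab: "a \<in> outside_ball YV YE (x q) N" "b \<in> outside_ball YV YE (x q) N" "(a, b) \<in> YE"
      show "reach E ?W C1 (pull a) (pull b)" by (rule reach_ball[OF pull_edge[OF ab(3)] far[OF ab(1)]])
    next
      fix a assume a: "a \<in> outside_ball YV YE (x q) N"
      have "a \<in> YV" using a by (simp add: outside_ball_def)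
      then show "pull a \<in> ?W" using far[OF a reach_refl] pull by blast
    qed
    then have mid: "reach E ?W' (C1 * n) (pull (s q (?tc - N))) (pull (s q (?tc + N)))"
      by (rule reach_subset) (use reach_le[of E V r _ _ "r + J2"] in auto)
    have endW: "reach E ?W' J2 (v i) (pull (s q j)) \<and> v i \<in> ?W'"
      if i: "i \<le> 2 * c q" "t q i \<le> j" "j \<le> t q i + J" "j \<le> M q" and far: "pull (s q j) \<in> ?W" for i j
    proof -
      have "nearY J (s q (t q i)) (s q j)" using near_seg[of "t q i" q j J] t[OF i(1)] i by simp
      from reach_trans[OF conjunct2[OF t[OF i(1)]] pull_near[OF this]]
      have "near J2 (v i) (pull (s q j))" by (simp add: J2_def add.assoc)
      then have n: "near J2 (pull (s q j)) (v i)" by (rule near_sym)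
      have "w \<in> ?W'" if w: "near J2 (pull (s q j)) w" for w
        using reach_trans[OF _ near_sym[OF w], of r "v ?c"] far near_in[OF w] by auto
      then have "reach E ?W' J2 (pull (s q j)) (v i)" by (rule reach_ball[OF n])
      then have 2: "reach E ?W' J2 (v i) (pull (s q j))" by (rule reach_sym[OF symE])
      show ?thesis by (rule conjI[OF 2 conjunct1[OF reach_in[OF 2]]])
    qed
    have ends_far: "pull (s q (?tc - N)) \<in> ?W" "pull (s q (?tc + N)) \<in> ?W"
      using reach_in[OF \<open>reach E ?W (C1 * n) (pull (s q (?tc - N))) (pull (s q (?tc + N)))\<close>] by auto
    obtain i1 where i1: "i1 \<le> ?c" "t q i1 \<le> ?tc - N" "?tc - N \<le> t q i1 + J"
      using gradual_value[of 0 ?c "t q" J "?tc - N"] tJ t0 by auto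
    obtain i2 where i2: "?c \<le> i2" "i2 \<le> 2 * c q" "t q i2 \<le> ?tc + N" "?tc + N \<le> t q i2 + J"
      using gradual_value[of ?c "2 * c q" "t q" J "?tc + N"] tJ tm tc by auto
    have e1: "reach E ?W' J2 (v i1) (pull (s q (?tc - N)))" "v i1 \<in> ?W'"
      using endW[of i1 "?tc - N"] i1 tc ends_far by auto
    have e2: "reach E ?W' J2 (v i2) (pull (s q (?tc + N)))" "v i2 \<in> ?W'"
      using endW[of i2 "?tc + N"] i2 tc ends_far by auto
    have "near r (v ?c) (v i)" if i: "?c \<le> i" "i \<le> ?c + k" for i
    proof -
      have "near ((i - ?c) * d) (v ?c) (v i)" using gate_chain_near[OF chain, of "i - ?c" ?c] i by simp
      moreover have "(i - ?c) * d \<le> k * d" using i by (intro mult_le_mono1) simp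
      then have "(i - ?c) * d \<le> r" unfolding r_def by linarith
      ultimately show ?thesis by (rule reach_le)
    qed
    then have i12: "i1 < ?c" "?c + k < i2" using e1(2) e2(2) i1(1) i2(1) by (force simp: not_less[symmetric])+
    have "reach E ?W' (J2 + C1 * n + J2) (v i1) (v i2)"
      using reach_trans[OF reach_trans[OF e1(1) mid] reach_sym[OF symE e2(1)]] .
    then have "k * Y \<le> J2 + C1 * n + J2"
    proof (rule gate_chain_cost[OF chain YX, where k = k and a = ?c])
      show "v i1 \<notin> shadow (v ?c) R" using not_in_later_shadow i12(1) .
      show "v i2 \<in> shadow (v (?c + k)) R" using in_earlier_shadow i12(2) by simp
      fix i assume "i < k"
      have "near (i * d + R) (v ?c) w" if "near R (v (?c + i)) w" for w
        using reach_trans[OF gate_chain_near[OF chain] that] .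
      moreover have "i * d \<le> k * d" using \<open>i < k\<close> by (intro mult_le_mono1) simp
      then have "i * d + R \<le> r" unfolding r_def by linarith
      ultimately have "near r (v ?c) w" if "near R (v (?c + i)) w" for w
        using reach_le[OF _ \<open>i * d + R \<le> r\<close>] that by metis
      then show "?W' \<subseteq> outside (v (?c + i)) R" unfolding outside_def by auto
    qed
    then show "k * Y \<le> C1 * n + 2 * (R + C1 + C * (J + 2 * C) + C)"
      by (simp add: J2_def R6_def)
  qed
qed

end

section \<open>Bounds linear in the radius\<close>

context combed
begin

text \<open>The multiplicative constant disappears here. A detour of cost \<open>F\<close> buys gates of price about
  \<open>F / (20 * C)\<close>, and \<open>20 * C\<close> of them are chained, at the expense of an error linear in \<open>n\<close>. All radii are
  multiples of \<open>s = n + 1\<close>, which absorbs the additive constants; for \<open>F\<close> below the error nothing has to be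
  shown.\<close>

theorem line_divergence_bound:
  assumes o: "o' \<in> V" "lev o' = 0"
  shows "\<exists>A. \<forall>n \<beta> F D. geodesic_line YV YE \<beta> \<longrightarrow>
     \<not> reach YE (outside_ball YV YE (\<beta> 0) n) F (\<beta> (- int n)) (\<beta> (int n)) \<longrightarrow>
     (\<forall>u\<in>V. \<forall>w\<in>V. lev u = A * n + A + 1 \<longrightarrow> lev w = A * n + A + 1 \<longrightarrow>
        reach E {w \<in> V. lev w = A * n + A + 1} D u w) \<longrightarrow>
     F < D + (A * n + A)"
proof -
  define r where "r = 2 * C * C + 2 * C"
  define t where "t = 6 * C * r + 3 * C + 1"
  define \<delta> where "\<delta> = C * t + C * C + C"
  define b where "b = 4 * \<delta> + 17 * r + t + 3"
  define k where "k = 20 * C"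
  define A where "A = (k + 1) * \<delta> + r + k * b + k"
  have main: "F < D + (A * n + A)"
    if \<beta>: "geodesic_line YV YE \<beta>" and sep: "\<not> reach YE (outside_ball YV YE (\<beta> 0) n) F (\<beta> (- int n)) (\<beta> (int n))"
      and D: "\<forall>u\<in>V. \<forall>w\<in>V. lev u = A * n + A + 1 \<longrightarrow> lev w = A * n + A + 1 \<longrightarrow>
        reach E {w \<in> V. lev w = A * n + A + 1} D u w" for n \<beta> F D
  proof -
    define s where "s = n + 1"
    define R where "R = r * s"
    define T where "T = t * s"
    define d where "d = \<delta> * s"
    define B where "B = b * s"
    have An: "A * n + A = (k + 1) * d + R + k * B + k * s"
      by (simp add: A_def s_def R_def d_def B_def algebra_simps)
    have Bge: "4 * d + 17 * R + T + 3 \<le> B"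
      by (simp add: B_def b_def d_def R_def T_def s_def algebra_simps)
    define m where "m = F div k"
    have kpos: "0 < k" using C_pos by (simp add: k_def)
    have Fm: "k * m \<le> F" "F < k * m + k"
      using kpos mult_div_mod_eq[of k F] mod_less_divisor[of k F] unfolding m_def by linarith+
    show ?thesis
    proof (cases "m < B")
      case True
      then have "k * (m + 1) \<le> k * B" by (intro mult_le_mono2) simp
      then have "F < k * B" using Fm(2) by (simp add: algebra_simps)
      then show ?thesis using An by linarith
    next
      case False
      define Y where "Y = m - B"
      have mY: "m = Y + B" using False by (simp add: Y_def)
      define X where "X = 5 * Y + 4 * d + 17 * R + 2"
      have FX: "4 * C * X + 2 * C + 2 * T \<le> F"
      proof -
        define Z where "Z = C * (4 * d + 17 * R + 2)"
        have "C * (4 * d + 17 * R + T + 3) \<le> C * B" using Bge by (rule mult_le_mono2)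
        moreover have "C * (4 * d + 17 * R + T + 3) = Z + C * T + C" by (simp add: Z_def algebra_simps)
        moreover have "T \<le> C * T" using C_pos by simp
        moreover have "k * m = 20 * (C * Y) + 20 * (C * B)" by (simp add: k_def mY algebra_simps)
        moreover have "4 * C * X = 20 * (C * Y) + 4 * Z" by (simp add: X_def Z_def algebra_simps)
        ultimately show ?thesis using Fm(1) by linarith
      qed
      have "k * Y \<le> D"
      proof (rule level_diameter_ge[OF o, of R d X Y k "A * n + A + 1"])
        fix v assume "v \<in> V"
        show "fork R (6 * R) d X v"
        proof (rule fork_of_line[OF \<beta> sep _ _ _ _ FX \<open>v \<in> V\<close>])
          show "C * (n + 2 * C) + C \<le> R" by (simp add: R_def r_def s_def algebra_simps)
          show "C * (6 * R) + 2 * C < T" by (simp add: T_def t_def R_def s_def algebra_simps)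
          show "n + C \<le> T"
          proof -
            have "n \<le> t * n" by (simp add: t_def)
            moreover have "C \<le> t" by (simp add: t_def)
            ultimately have "n + C \<le> t * n + t" by (rule add_mono)
            then show ?thesis by (simp add: T_def s_def)
          qed
          show "C * (T + C) + C \<le> d" by (simp add: T_def d_def \<delta>_def s_def algebra_simps)
        qed
      next
        show "(k + 1) * d + R < A * n + A + 1" unfolding An by simp
      qed (use D X_def in auto)
      then have "k * m \<le> D + k * B" by (simp add: mY add_mult_distrib2)
      moreover have "k \<le> k * s" by (simp add: s_def)
      moreover have "F < D + k * B + k" using calculation(1) Fm(2) by linarith
      ultimately show ?thesis using An by linarith
    qed
  qed
  then show ?thesis by blast
qed

text \<open>As in \<open>line_divergence_bound\<close>, but moving a pair from the origin to another vertex of \<open>V\<close> costs a factor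
  \<open>c\<close>, and pulling back the detour around the line costs another factor \<open>C1\<close>; hence \<open>10 * c * C1\<close> gates.\<close>

theorem level_distance_bound:
  assumes o: "o' \<in> V" "lev o' = 0"
  shows "\<exists>A. \<forall>n F.
     (\<forall>T>n. \<exists>u\<in>V. \<exists>w\<in>V. lev u = T \<and> lev w = T \<and>
        \<not> reach E {w \<in> V. lev w = n + 1} F (anc (n + 1) u) (anc (n + 1) w)) \<longrightarrow>
     F < A * n + A \<or> (\<exists>\<beta>. geodesic_line YV YE \<beta> \<and>
       (\<forall>l. reach YE (outside_ball YV YE (\<beta> 0) (A * n + A)) l (\<beta> (- int (A * n + A))) (\<beta> (int (A * n + A)))
          \<longrightarrow> F < l + (A * n + A)))"
proof -
  define c where "c = 4 * C * C + C"
  define r where "r = C * C * (1 + c) + 2 * C * C + C + C1"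
  define t where "t = 6 * C * C * r + 2 * C * C + C + 2 + c"
  define \<delta> where "\<delta> = C * C * t + 2 * C * C + C"
  define y where "y = 2 * (r + C1) + C1 * (2 * C * \<delta> + 2 * C * (r + C1) + 3 * C)"
  define b where "b = 4 * \<delta> + 17 * r + 4 + y"
  define k0 where "k0 = 10 * c"
  define k where "k = k0 * C1"
  define j where "j = r + C1 + C * (C * \<delta> + 2 * C * (r + C1) + 3 * C + 2 * C) + C"
  define A where "A = C * (r + C1) + C * (k * \<delta> + r + j + C1) + 6 * C + 1 + 2 * j + k0 * b + k0"
  have main: "F < A * n + A \<or> (\<exists>\<beta>. geodesic_line YV YE \<beta> \<and>
       (\<forall>l. reach YE (outside_ball YV YE (\<beta> 0) (A * n + A)) l (\<beta> (- int (A * n + A))) (\<beta> (int (A * n + A)))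
          \<longrightarrow> F < l + (A * n + A)))"
    if pairs: "\<forall>T>n. \<exists>u\<in>V. \<exists>w\<in>V. lev u = T \<and> lev w = T \<and>
        \<not> reach E {w \<in> V. lev w = n + 1} F (anc (n + 1) u) (anc (n + 1) w)" for n F
  proof -
    define s where "s = n + 1"
    have s1: "1 \<le> s" by (simp add: s_def)
    define R where "R = r * s"
    define T where "T = t * s"
    define d where "d = \<delta> * s"
    define B where "B = b * s"
    let ?Y0 = "2 * (R + C1) + C1 * (2 * C * d + 2 * C * (R + C1) + 3 * C)"
    let ?J2 = "R + C1 + C * (C * d + 2 * C * (R + C1) + 3 * C + 2 * C) + C"
    have Y0: "?Y0 \<le> y * s" by (simp add: y_def R_def d_def s_def algebra_simps)
    have J2: "?J2 \<le> j * s" by (simp add: j_def R_def d_def s_def algebra_simps)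
    have An: "A * n + A = C * (R + C1 * s) + C * (k * d + R + j * s + C1 * s) + 6 * C * s + s + 2 * (j * s) + k0 * B + k0 * s"
      by (simp add: A_def s_def R_def d_def B_def algebra_simps)
    have Bge: "4 * d + 17 * R + 4 + y * s \<le> B"
      by (simp add: B_def b_def d_def R_def s_def algebra_simps)
    have cpos: "1 \<le> c" "1 \<le> C1" using C_pos by (auto simp: c_def C1_def)
    define m where "m = F div k0"
    have kpos: "0 < k0" using cpos by (simp add: k0_def)
    have Fm: "k0 * m \<le> F" "F < k0 * m + k0"
      using kpos mult_div_mod_eq[of k0 F] mod_less_divisor[of k0 F] unfolding m_def by linarith+
    show ?thesis
    proof (cases "m < B")
      case True
      then have "k0 * (m + 1) \<le> k0 * B" by (intro mult_le_mono2) simp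
      then have "F < k0 * B" using Fm(2) by (simp add: algebra_simps)
      then show ?thesis using An by linarith
    next
      case False
      define Y where "Y = m - (4 * d + 17 * R + 3)"
      have mY: "m = Y + (4 * d + 17 * R + 3)" and Y_large: "?Y0 < Y" and mB: "m \<le> Y + B"
        using False Bge Y0 unfolding Y_def by linarith+
      define X where "X = 5 * Y + 4 * d + 17 * R + 2"
      have FX: "2 * c * X + 2 * c \<le> F"
      proof -
        have "k0 * m = 10 * (c * Y) + 10 * (c * (4 * d + 17 * R + 3))" by (simp add: k0_def mY algebra_simps)
        moreover have "2 * c * X + 2 * c = 10 * (c * Y) + 2 * (c * (4 * d + 17 * R + 3))"
          by (simp add: X_def algebra_simps)
        ultimately show ?thesis using Fm(1) by linarith
      qed
      have "n < T" by (simp add: T_def t_def s_def algebra_simps)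
      then obtain u w where uw: "u \<in> V" "w \<in> V" "lev u = T" "lev w = T"
        "\<not> reach E {w \<in> V. lev w = n + 1} F (anc (n + 1) u) (anc (n + 1) w)"
        using pairs by blast
      have R_ge: "C * (C * (n + 1 + c) + 2 * C) + C + C1 \<le> R"
      proof -
        have "C * (C * (n + 1 + c) + 2 * C) + C + C1 = C * C * s + (C * C * c + 2 * C * C + C + C1)"
          by (simp add: s_def algebra_simps)
        also have "\<dots> \<le> C * C * s + (C * C * c + 2 * C * C + C + C1) * s" using s1 by simp
        also have "\<dots> = R" by (simp add: R_def r_def algebra_simps)
        finally show ?thesis .
      qed
      have forks: "fork R (6 * R) d X v" if "v \<in> V" for v
      proof (rule fork_of_level_pair[OF o uw c_def _ _ _ _ FX that])
        show "C * (C * (n + 1 + c) + 2 * C) + C \<le> R" using R_ge by simp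
        show "C * (C * (6 * R) + 2 * C) + C < T" by (simp add: T_def t_def R_def s_def algebra_simps)
        show "n + 1 + c \<le> T"
        proof -
          have "n \<le> t * n" by (simp add: t_def)
          moreover have "1 + c \<le> t" by (simp add: t_def)
          ultimately have "n + (1 + c) \<le> t * n + t" by (rule add_mono)
          then show ?thesis by (simp add: T_def s_def)
        qed
        show "C * (C * T + 2 * C) + C \<le> d" by (simp add: T_def d_def \<delta>_def s_def algebra_simps)
      qed
      obtain e where e: "near d o' e" "\<not> near (6 * R) o' e" using forks[OF o(1)] unfolding fork_def by blast
      have eV: "e \<in> V" using near_in[OF e(1)] by simp
      have "R < lev e" using e(2) origin_near[OF o eV] reach_le[of E V "lev e" o' e "6 * R"] by linarith
      moreover have "4 * d + 17 * R + 2 \<le> X" by (simp add: X_def)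
      ultimately obtain v where chain: "gate_chain R d X v"
        using gate_chain_exists[OF eV _ _ forks] by blast
      interpret gated V E lev par YV YE h C R d X Y v
        by unfold_locales (use chain R_ge Y_large X_def in auto)
      let ?N = "A * n + A"
      have "C * (R + C1) + C * (k * d + R + ?J2 + C1) + 6 * C < ?N"
      proof -
        have "C * (R + C1) \<le> C * (R + C1 * s)" "6 * C \<le> 6 * C * s" using s1 by auto
        moreover have "C1 \<le> C1 * s" using s1 by simp
        then have "k * d + R + ?J2 + C1 \<le> k * d + R + j * s + C1 * s" using J2 by linarith
        then have "C * (k * d + R + ?J2 + C1) \<le> C * (k * d + R + j * s + C1 * s)" by (rule mult_le_mono2)
        ultimately show ?thesis using An s1 by linarith
      qed
      then obtain \<beta> where \<beta>: "geodesic_line YV YE \<beta>"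
        "\<And>l. reach YE (outside_ball YV YE (\<beta> 0) ?N) l (\<beta> (- int ?N)) (\<beta> (int ?N)) \<Longrightarrow> k * Y \<le> C1 * l + 2 * ?J2"
        unfolding J_def[symmetric] using gate_line[of k ?N] by blast
      have "F < l + ?N" if "reach YE (outside_ball YV YE (\<beta> 0) ?N) l (\<beta> (- int ?N)) (\<beta> (int ?N))" for l
      proof -
        have "C1 * (k0 * Y) \<le> C1 * l + 2 * ?J2" using \<beta>(2)[OF that] by (simp add: k_def mult.commute mult.left_commute)
        also have "\<dots> \<le> C1 * l + C1 * (2 * ?J2)" using cpos(2) by simp
        finally have "C1 * (k0 * Y) \<le> C1 * (l + 2 * ?J2)" by (simp only: add_mult_distrib2)
        then have "k0 * Y \<le> l + 2 * ?J2" using cpos(2) by (simp only: mult_le_cancel1)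
        moreover have "k0 * m \<le> k0 * Y + k0 * B" using mB by (metis add_mult_distrib2 mult_le_mono2)
        moreover have "k0 \<le> k0 * s" using s1 by simp
        moreover have "2 * (j * s) + k0 * B + k0 * s \<le> ?N" using An by linarith
        moreover define Q where "Q = ?J2"
        ultimately have "k0 * Y \<le> l + 2 * Q" "k0 * m \<le> k0 * Y + k0 * B" "k0 \<le> k0 * s"
          "2 * (j * s) + k0 * B + k0 * s \<le> ?N" "Q \<le> j * s"
          using J2 by simp_all
        then show ?thesis using Fm(2) by linarith
      qed
      then show ?thesis using \<beta>(1) by blast
    qed
  qed
  then show ?thesis by blast
qed

end

section \<open>Distances and Cayley graphs\<close>

lemma gdist_le: "gdist \<Gamma> u v \<le> enat n \<longleftrightarrow> (\<exists>j\<le>n. (u, v) \<in> gedges \<Gamma> ^^ j)"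
proof -
  have "gdist \<Gamma> u v \<le> enat n \<longleftrightarrow> gdist \<Gamma> u v < enat (Suc n)"
    by (cases "gdist \<Gamma> u v") auto
  also have "\<dots> \<longleftrightarrow> (\<exists>j\<in>{j. (u, v) \<in> gedges \<Gamma> ^^ j}. enat j < enat (Suc n))"
    unfolding gdist_def by (rule INF_less_iff)
  also have "\<dots> \<longleftrightarrow> (\<exists>j\<le>n. (u, v) \<in> gedges \<Gamma> ^^ j)" by (auto simp: less_Suc_eq_le)
  finally show ?thesis .
qed

lemma gdist_induced_le:
  assumes "u \<in> W"
  shows "gdist (induced \<Gamma> W) u v \<le> enat n \<longleftrightarrow> reach (gedges \<Gamma>) W n u v"
  using assms by (simp add: gdist_le reach_def induced_def)

lemma gdist_le_reach:
  assumes "gedges \<Gamma> \<subseteq> gverts \<Gamma> \<times> gverts \<Gamma>" "u \<in> gverts \<Gamma>"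
  shows "gdist \<Gamma> u v \<le> enat n \<longleftrightarrow> reach (gedges \<Gamma>) (gverts \<Gamma>) n u v"
proof -
  have "gedges \<Gamma> \<inter> gverts \<Gamma> \<times> gverts \<Gamma> = gedges \<Gamma>" using assms(1) by blast
  then show ?thesis using assms(2) by (simp add: gdist_le reach_def)
qed

lemma biinfinite_geodesic_line:
  assumes "gedges \<Gamma> \<subseteq> gverts \<Gamma> \<times> gverts \<Gamma>"
  shows "biinfinite_geodesic \<Gamma> \<beta> \<longleftrightarrow> geodesic_line (gverts \<Gamma>) (gedges \<Gamma>) \<beta>"
proof
  assume b: "biinfinite_geodesic \<Gamma> \<beta>"
  then have V: "\<beta> i \<in> gverts \<Gamma>" for i by (auto simp: biinfinite_geodesic_def)
  have "reach (gedges \<Gamma>) (gverts \<Gamma>) n (\<beta> i) (\<beta> j) \<longleftrightarrow> nat \<bar>i - j\<bar> \<le> n" for n i j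
    using gdist_le_reach[OF assms V, of i "\<beta> j" n] b by (simp add: biinfinite_geodesic_def)
  then show "geodesic_line (gverts \<Gamma>) (gedges \<Gamma>) \<beta>" unfolding geodesic_line_def by auto
next
  assume l: "geodesic_line (gverts \<Gamma>) (gedges \<Gamma>) \<beta>"
  have V: "\<beta> i \<in> gverts \<Gamma>" for i using l reach_in unfolding geodesic_line_def by metis
  have near: "gdist \<Gamma> (\<beta> i) (\<beta> j) \<le> enat n \<longleftrightarrow> nat \<bar>i - j\<bar> \<le> n" for n i j
    unfolding gdist_le_reach[OF assms V] using l unfolding geodesic_line_def by (meson not_le reach_le)
  have "gdist \<Gamma> (\<beta> i) (\<beta> j) = enat (nat \<bar>i - j\<bar>)" for i j
  proof (rule antisym)
    show "gdist \<Gamma> (\<beta> i) (\<beta> j) \<le> enat (nat \<bar>i - j\<bar>)" using near by simp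
    show "enat (nat \<bar>i - j\<bar>) \<le> gdist \<Gamma> (\<beta> i) (\<beta> j)"
    proof (cases "gdist \<Gamma> (\<beta> i) (\<beta> j)")
      case (enat k)
      then show ?thesis using near[of i j k] by simp
    qed simp
  qed
  then show "biinfinite_geodesic \<Gamma> \<beta>" using V by (auto simp: biinfinite_geodesic_def)
qed

lemma geodesic_divergence_le:
  assumes sub: "gedges \<Gamma> \<subseteq> gverts \<Gamma> \<times> gverts \<Gamma>" and b: "biinfinite_geodesic \<Gamma> \<beta>"
  shows "geodesic_divergence \<Gamma> \<beta> n \<le> enat k \<longleftrightarrow>
    reach (gedges \<Gamma>) (outside_ball (gverts \<Gamma>) (gedges \<Gamma>) (\<beta> 0) n) k (\<beta> (- int n)) (\<beta> (int n))"
proof -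
  have V: "\<beta> i \<in> gverts \<Gamma>" and dist: "gdist \<Gamma> (\<beta> i) (\<beta> j) = enat (nat \<bar>i - j\<bar>)" for i j
    using b by (auto simp: biinfinite_geodesic_def)
  have lt: "gdist \<Gamma> u v < enat n \<longleftrightarrow> (\<exists>m<n. reach (gedges \<Gamma>) (gverts \<Gamma>) m u v)"
    if u: "u \<in> gverts \<Gamma>" for u v n
  proof (cases "gdist \<Gamma> u v")
    case (enat k)
    have "gdist \<Gamma> u v \<le> enat m \<longleftrightarrow> reach (gedges \<Gamma>) (gverts \<Gamma>) m u v" for m by (rule gdist_le_reach[OF sub u])
    then show ?thesis unfolding enat by (metis enat_ord_simps order.strict_trans1 order_refl)
  next
    case infinity
    have "gdist \<Gamma> u v \<le> enat m \<longleftrightarrow> reach (gedges \<Gamma>) (gverts \<Gamma>) m u v" for m by (rule gdist_le_reach[OF sub u])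
    then show ?thesis unfolding infinity by simp
  qed
  have W: "gverts \<Gamma> - gball \<Gamma> (\<beta> 0) n = outside_ball (gverts \<Gamma>) (gedges \<Gamma>) (\<beta> 0) n"
    using lt[OF V] by (auto simp: gball_def outside_ball_def)
  have "\<beta> (- int n) \<in> gverts \<Gamma> - gball \<Gamma> (\<beta> 0) n"
    using V dist[of 0 "- int n"] by (simp add: gball_def)
  from gdist_induced_le[OF this, of \<Gamma>] show ?thesis
    unfolding geodesic_divergence_def W .
qed

lemma cayley_simps [simp]:
  "gverts (cayley_graph G A) = carrier G"
  "(x, y) \<in> gedges (cayley_graph G A) \<longleftrightarrow> x \<in> carrier G \<and> y \<in> carrier G \<and>
     (\<exists>s\<in>A. y = x \<otimes>\<^bsub>G\<^esub> s \<or> x = y \<otimes>\<^bsub>G\<^esub> s)"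
  by (auto simp: cayley_graph_def)

lemma cayley_sub: "gedges (cayley_graph G A) \<subseteq> gverts (cayley_graph G A) \<times> gverts (cayley_graph G A)"
  by auto

lemma cayley_sym: "sym (gedges (cayley_graph G A))"
  by (auto simp: sym_def)

lemma cayley_translation:
  assumes "group G" "A \<subseteq> carrier G" "a \<in> carrier G"
  shows "automorphism (carrier G) (gedges (cayley_graph G A)) (\<lambda>x. a \<otimes>\<^bsub>G\<^esub> x) (\<lambda>x. inv\<^bsub>G\<^esub> a \<otimes>\<^bsub>G\<^esub> x)"
proof -
  interpret group G by fact
  have edge: "(b \<otimes>\<^bsub>G\<^esub> x, b \<otimes>\<^bsub>G\<^esub> y) \<in> gedges (cayley_graph G A)"
    if b: "b \<in> carrier G" and e: "(x, y) \<in> gedges (cayley_graph G A)" for b x y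
  proof -
    obtain s where s: "s \<in> A" "y = x \<otimes>\<^bsub>G\<^esub> s \<or> x = y \<otimes>\<^bsub>G\<^esub> s" and xy: "x \<in> carrier G" "y \<in> carrier G" using e by auto
    have "s \<in> carrier G" using s(1) assms(2) by blast
    then have "b \<otimes>\<^bsub>G\<^esub> y = (b \<otimes>\<^bsub>G\<^esub> x) \<otimes>\<^bsub>G\<^esub> s \<or> b \<otimes>\<^bsub>G\<^esub> x = (b \<otimes>\<^bsub>G\<^esub> y) \<otimes>\<^bsub>G\<^esub> s"
      using s(2) xy b by (auto simp: m_assoc)
    then show ?thesis using s(1) xy b by auto
  qed
  show ?thesis
    unfolding automorphism_def
    using edge[OF assms(3)] edge[OF inv_closed[OF assms(3)]] assms(3)
    by (auto simp: m_assoc[symmetric] simp del: cayley_simps(2))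
qed

lemma cayley_homogeneous:
  assumes "group G" "A \<subseteq> carrier G" "x \<in> carrier G" "y \<in> carrier G"
  shows "\<exists>\<phi> \<psi>. automorphism (carrier G) (gedges (cayley_graph G A)) \<phi> \<psi> \<and> \<phi> x = y"
proof -
  interpret group G by fact
  have "(y \<otimes>\<^bsub>G\<^esub> inv\<^bsub>G\<^esub> x) \<otimes>\<^bsub>G\<^esub> x = y" using assms(3,4) by (simp add: m_assoc)
  then show ?thesis using cayley_translation[OF assms(1,2), of "y \<otimes>\<^bsub>G\<^esub> inv\<^bsub>G\<^esub> x"] assms(3,4) by blast
qed

lemma cayley_locally_finite:
  assumes "group G" "finite A" "A \<subseteq> carrier G" "x \<in> carrier G"
  shows "finite {y. (x, y) \<in> gedges (cayley_graph G A)}"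
proof -
  interpret group G by fact
  have "{y. (x, y) \<in> gedges (cayley_graph G A)} \<subseteq> (\<lambda>s. x \<otimes>\<^bsub>G\<^esub> s) ` A \<union> (\<lambda>s. x \<otimes>\<^bsub>G\<^esub> inv\<^bsub>G\<^esub> s) ` A"
  proof
    fix y assume "y \<in> {y. (x, y) \<in> gedges (cayley_graph G A)}"
    then obtain s where s: "s \<in> A" "y \<in> carrier G" "y = x \<otimes>\<^bsub>G\<^esub> s \<or> x = y \<otimes>\<^bsub>G\<^esub> s" by auto
    have "s \<in> carrier G" using s(1) assms(3) by blast
    then have "y = x \<otimes>\<^bsub>G\<^esub> s \<or> y = x \<otimes>\<^bsub>G\<^esub> inv\<^bsub>G\<^esub> s" using s(2,3) by (auto simp: m_assoc)
    then show "y \<in> (\<lambda>s. x \<otimes>\<^bsub>G\<^esub> s) ` A \<union> (\<lambda>s. x \<otimes>\<^bsub>G\<^esub> inv\<^bsub>G\<^esub> s) ` A" using s(1) by blast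
  qed
  moreover have "finite ((\<lambda>s. x \<otimes>\<^bsub>G\<^esub> s) ` A \<union> (\<lambda>s. x \<otimes>\<^bsub>G\<^esub> inv\<^bsub>G\<^esub> s) ` A)"
    using assms(2) by simp
  ultimately show ?thesis by (rule finite_subset)
qed

lemma cayley_connected:
  assumes "group G" "A \<subseteq> carrier G" "generate G A = carrier G" "x \<in> carrier G" "y \<in> carrier G"
  shows "\<exists>n. reach (gedges (cayley_graph G A)) (carrier G) n x y"
proof -
  interpret group G by fact
  let ?E = "gedges (cayley_graph G A)"
  have trans: "reach ?E (carrier G) n (a \<otimes>\<^bsub>G\<^esub> u) (a \<otimes>\<^bsub>G\<^esub> v)" if "reach ?E (carrier G) n u v" "a \<in> carrier G" for n a u v
    using automorphism_reach[OF cayley_translation[OF assms(1,2) that(2)] that(1)] that(2) by simp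
  have one: "\<exists>n. reach ?E (carrier G) n \<one>\<^bsub>G\<^esub> g" if "g \<in> generate G A" for g
    using that
  proof induction
    case one
    then show ?case using reach_refl[of "\<one>\<^bsub>G\<^esub>" "carrier G"] by blast
  next
    case (incl s)
    have "s \<in> carrier G" using incl assms(2) by blast
    then have "(\<one>\<^bsub>G\<^esub>, s) \<in> ?E" using incl by (auto intro!: bexI[of _ s])
    then show ?case using reach_step[of "\<one>\<^bsub>G\<^esub>" "carrier G" s ?E] \<open>s \<in> carrier G\<close> by auto
  next
    case (inv s)
    have "s \<in> carrier G" using inv assms(2) by blast
    then have "(\<one>\<^bsub>G\<^esub>, inv\<^bsub>G\<^esub> s) \<in> ?E" using inv by (auto intro!: bexI[of _ s])
    then show ?case using reach_step[of "\<one>\<^bsub>G\<^esub>" "carrier G" "inv\<^bsub>G\<^esub> s" ?E] \<open>s \<in> carrier G\<close> by auto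
  next
    case (eng a b)
    have ab: "a \<in> carrier G" "b \<in> carrier G" using eng.hyps assms(3) by auto
    obtain m n where mn: "reach ?E (carrier G) m \<one>\<^bsub>G\<^esub> a" "reach ?E (carrier G) n \<one>\<^bsub>G\<^esub> b" using eng.IH by blast
    have "reach ?E (carrier G) n a (a \<otimes>\<^bsub>G\<^esub> b)" using trans[OF mn(2) ab(1)] ab by simp
    from reach_trans[OF mn(1) this] show ?case by blast
  qed
  obtain n where "reach ?E (carrier G) n \<one>\<^bsub>G\<^esub> (inv\<^bsub>G\<^esub> x \<otimes>\<^bsub>G\<^esub> y)"
    using one[of "inv\<^bsub>G\<^esub> x \<otimes>\<^bsub>G\<^esub> y"] assms(3-5) by auto
  from trans[OF this assms(4)] have "reach ?E (carrier G) n x y"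
    using assms(4,5) by (simp add: m_assoc[symmetric])
  then show ?thesis by blast
qed

text \<open>The lower inequality also shows that the distance of two vertices of \<open>\<Gamma>\<close> is finite if that of their images is.\<close>

lemma quasi_isometric_reach:
  assumes qi: "quasi_isometric \<Gamma> \<Delta>"
    and \<Gamma>: "gedges \<Gamma> \<subseteq> gverts \<Gamma> \<times> gverts \<Gamma>" and \<Delta>: "gedges \<Delta> \<subseteq> gverts \<Delta> \<times> gverts \<Delta>"
  obtains h C where "1 \<le> C" "\<And>v. v \<in> gverts \<Gamma> \<Longrightarrow> h v \<in> gverts \<Delta>"
    "\<And>n u v. reach (gedges \<Gamma>) (gverts \<Gamma>) n u v \<Longrightarrow> reach (gedges \<Delta>) (gverts \<Delta>) (C * n + C) (h u) (h v)"
    "\<And>n u v. u \<in> gverts \<Gamma> \<Longrightarrow> v \<in> gverts \<Gamma> \<Longrightarrow> reach (gedges \<Delta>) (gverts \<Delta>) n (h u) (h v) \<Longrightarrow>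
       reach (gedges \<Gamma>) (gverts \<Gamma>) (C * n + C) u v"
    "\<And>y. y \<in> gverts \<Delta> \<Longrightarrow> \<exists>v\<in>gverts \<Gamma>. reach (gedges \<Delta>) (gverts \<Delta>) C (h v) y"
proof -
  obtain h and K L :: real where K: "K \<ge> 1" "L \<ge> 0" and h: "h ` gverts \<Gamma> \<subseteq> gverts \<Delta>"
    and qi: "\<forall>u\<in>gverts \<Gamma>. \<forall>v\<in>gverts \<Gamma>.
           ereal (1 / K) * ereal_of_enat (gdist \<Gamma> u v) - ereal L \<le> ereal_of_enat (gdist \<Delta> (h u) (h v)) \<and>
           ereal_of_enat (gdist \<Delta> (h u) (h v)) \<le> ereal K * ereal_of_enat (gdist \<Gamma> u v) + ereal L"
    and dense: "\<forall>w\<in>gverts \<Delta>. \<exists>v\<in>gverts \<Gamma>. ereal_of_enat (gdist \<Delta> (h v) w) \<le> ereal L"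
    using qi unfolding quasi_isometric_def by blast
  obtain C :: nat where C: "max (max K L) (K * L) \<le> real C" using real_arch_simple by blast
  then have C': "K \<le> C" "L \<le> C" "K * L \<le> C" by auto
  have fin: "gdist \<Delta>' a b \<le> enat m" if "ereal_of_enat (gdist \<Delta>' a b) \<le> ereal r" "r \<le> real m" for \<Delta>' :: "'c ugraph" and a b m r
  proof (cases "gdist \<Delta>' a b")
    case (enat k)
    then show ?thesis using that by simp
  next
    case infinity
    then show ?thesis using that by simp
  qed
  show thesis
  proof (rule that)
    show "1 \<le> C" using C'(1) K(1) by linarith
    show hv: "h v \<in> gverts \<Delta>" if "v \<in> gverts \<Gamma>" for v using h that by blast
    show "reach (gedges \<Delta>) (gverts \<Delta>) (C * n + C) (h u) (h v)"
      if r: "reach (gedges \<Gamma>) (gverts \<Gamma>) n u v" for n u v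
    proof -
      have uv: "u \<in> gverts \<Gamma>" "v \<in> gverts \<Gamma>" using reach_in[OF r] by auto
      obtain k where k: "gdist \<Gamma> u v = enat k" "k \<le> n"
        using r gdist_le_reach[OF \<Gamma> uv(1), of v n] by (cases "gdist \<Gamma> u v") auto
      have "ereal_of_enat (gdist \<Delta> (h u) (h v)) \<le> ereal (K * real k + L)" using qi uv k(1) by fastforce
      moreover have "K * real k \<le> real C * real n" using C'(1) k(2) K by (intro mult_mono) auto
      then have "K * real k + L \<le> real (C * n + C)" using C'(2) by simp
      ultimately have "gdist \<Delta> (h u) (h v) \<le> enat (C * n + C)" by (rule fin)
      then show ?thesis using gdist_le_reach[OF \<Delta> hv[OF uv(1)]] by simp
    qed
    show "reach (gedges \<Gamma>) (gverts \<Gamma>) (C * n + C) u v"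
      if uv: "u \<in> gverts \<Gamma>" "v \<in> gverts \<Gamma>" and r: "reach (gedges \<Delta>) (gverts \<Delta>) n (h u) (h v)" for n u v
    proof -
      obtain k where k: "gdist \<Delta> (h u) (h v) = enat k" "k \<le> n"
        using r gdist_le_reach[OF \<Delta> hv[OF uv(1)], of "h v" n] by (cases "gdist \<Delta> (h u) (h v)") auto
      have lower: "ereal (1 / K) * ereal_of_enat (gdist \<Gamma> u v) - ereal L \<le> ereal (real k)"
        using qi uv k(1) by fastforce
      obtain j where j: "gdist \<Gamma> u v = enat j"
      proof (cases "gdist \<Gamma> u v")
        case infinity
        then have False using lower K(1) by simp
        then show ?thesis ..
      qed (use that in auto)
      have "1 / K * real j - L \<le> real k" using lower j by simp
      then have "real j \<le> K * real k + K * L" using K(1) by (simp add: field_simps)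
      moreover have "K * real k \<le> real C * real n" using C'(1) k(2) K by (intro mult_mono) auto
      ultimately have "real j \<le> real (C * n + C)" using C'(3) by simp
      then have "j \<le> C * n + C" by (simp only: of_nat_le_iff)
      then show ?thesis using gdist_le_reach[OF \<Gamma> uv(1), of v] j by simp
    qed
    show "\<exists>v\<in>gverts \<Gamma>. reach (gedges \<Delta>) (gverts \<Delta>) C (h v) y" if y: "y \<in> gverts \<Delta>" for y
    proof -
      obtain v where v: "v \<in> gverts \<Gamma>" "ereal_of_enat (gdist \<Delta> (h v) y) \<le> ereal L" using dense y by blast
      have "gdist \<Delta> (h v) y \<le> enat C" using v(2) C'(2) by (rule fin)
      then show ?thesis using gdist_le_reach[OF \<Delta> hv[OF v(1)]] v(1) by blast
    qed
  qed
qed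

section \<open>The history graph\<close>

lemma level_graph_Suc: "level_graph R X (Suc n) = dual_graph R (subdivide R (subdivide_n R n X))"
  by (simp add: level_graph_def)

lemma gverts_level: "gverts (level_graph R X n) = tiles R (subdivide_n R n X)"
  by (simp add: level_graph_def dual_graph_def)

lemma dual_edges: "(d, e) \<in> gedges (dual_graph R X) \<Longrightarrow> d \<in> tiles R X \<and> e \<in> tiles R X"
  "sym (gedges (dual_graph R X))"
  by (auto simp: dual_graph_def sym_def)

lemma history_verts: "gverts (history_graph R X) = {Origin} \<union> {Tile n e | n e. e \<in> tiles R (subdivide_n R n X)}"
  by (simp add: history_graph_def Let_def gverts_level)

lemma history_edge_cases:
  assumes "(u, v) \<in> gedges (history_graph R X)"
  obtains (horizontal) n d e where "u = Tile n d" "v = Tile n e" "(d, e) \<in> gedges (level_graph R X n)"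
  | (up) n d e where "u = Tile n d" "v = Tile (Suc n) e" "d \<in> tiles R (subdivide_n R n X)"
      "e \<in> tiles R (subdivide_n R (Suc n) X)" "e \<subseteq> d"
  | (down) n d e where "v = Tile n d" "u = Tile (Suc n) e" "d \<in> tiles R (subdivide_n R n X)"
      "e \<in> tiles R (subdivide_n R (Suc n) X)" "e \<subseteq> d"
  | (start) e where "u = Origin" "v = Tile 0 e" "e \<in> tiles R X"
  | (finish) e where "v = Origin" "u = Tile 0 e" "e \<in> tiles R X"
  using assms unfolding history_graph_def Let_def gverts_level
  by (auto simp: gverts_level)

lemma history_edge_horizontal:
  "(Tile n d, Tile n e) \<in> gedges (history_graph R X) \<longleftrightarrow> (d, e) \<in> gedges (level_graph R X n)"
  by (auto simp: history_graph_def Let_def)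

fun depth :: "'x history_vertex \<Rightarrow> nat" where
  "depth Origin = 0"
| "depth (Tile n e) = Suc n"

text \<open>The default value \<open>Origin\<close> is the parent of the tiles of \<open>X\<close> itself.\<close>

definition parent :: "'s subdivision_rule \<Rightarrow> ('x, 's) rcomplex \<Rightarrow> 'x history_vertex \<Rightarrow> 'x history_vertex" where
  "parent R X v = (case v of Tile (Suc n) e \<Rightarrow> Tile n (THE d. d \<in> tiles R (subdivide_n R n X) \<and> e \<subseteq> d) | _ \<Rightarrow> Origin)"

context
  fixes R :: "'s subdivision_rule" and X :: "('x, 's) rcomplex"
  assumes R: "finite_subdivision_rule R" and X: "r_complex R X"
begin

lemma parent_Tile:
  assumes "e \<in> tiles R (subdivide_n R (Suc n) X)" "d \<in> tiles R (subdivide_n R n X)" "e \<subseteq> d"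
  shows "parent R X (Tile (Suc n) e) = Tile n d"
proof -
  note ch = charted_subdivide_n[OF R X]
  have ne: "e \<noteq> {}" using tile_nonempty[OF R ch assms(1)] .
  have "(THE d. d \<in> tiles R (subdivide_n R n X) \<and> e \<subseteq> d) = d"
  proof (rule the_equality)
    show "d \<in> tiles R (subdivide_n R n X) \<and> e \<subseteq> d" using assms by simp
    fix d' assume d': "d' \<in> tiles R (subdivide_n R n X) \<and> e \<subseteq> d'"
    then have "d' \<inter> d \<noteq> {}" using ne assms(3) by blast
    then show "d' = d" using tiles_disjoint[OF ch] d' assms(2) by blast
  qed
  then show ?thesis by (simp add: parent_def)
qed

lemma parent_exists:
  assumes "e \<in> tiles R (subdivide_n R (Suc n) X)"
  obtains d where "d \<in> tiles R (subdivide_n R n X)" "e \<subseteq> d" "parent R X (Tile (Suc n) e) = Tile n d"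
proof -
  have "e \<in> tiles R (subdivide R (subdivide_n R n X))" using assms by simp
  then obtain d where "d \<in> tiles R (subdivide_n R n X)" "e \<subseteq> d"
    using tile_parent[OF R charted_subdivide_n[OF R X]] by blast
  then show thesis using that parent_Tile[OF assms] by blast
qed

lemma history_sub: "gedges (history_graph R X) \<subseteq> gverts (history_graph R X) \<times> gverts (history_graph R X)"
proof clarify
  fix u v assume "(u, v) \<in> gedges (history_graph R X)"
  then show "u \<in> gverts (history_graph R X) \<and> v \<in> gverts (history_graph R X)"
    by (cases rule: history_edge_cases)
      (use dual_edges(1) in \<open>auto simp: history_verts level_graph_def simp del: funpow.simps intro: exI[of _ 0]\<close>)
qed

lemma leveled_history:
  "leveled_graph (gverts (history_graph R X)) (gedges (history_graph R X)) depth (parent R X)"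
proof
  let ?H = "history_graph R X"
  show "gedges ?H \<subseteq> gverts ?H \<times> gverts ?H" by (rule history_sub)
  show "sym (gedges ?H)"
  proof (rule symI)
    fix u v assume "(u, v) \<in> gedges ?H"
    then show "(v, u) \<in> gedges ?H"
    proof (cases rule: history_edge_cases)
      case (horizontal n d e)
      then show ?thesis
        using symD[OF dual_edges(2), of d e R "subdivide_n R n X"] unfolding level_graph_def[symmetric]
        by (simp add: history_edge_horizontal)
    qed (auto simp: history_graph_def Let_def gverts_level simp del: funpow.simps)
  qed
  show "parent R X v \<in> gverts ?H \<and> depth v = Suc (depth (parent R X v)) \<and> (v, parent R X v) \<in> gedges ?H"
    if v: "v \<in> gverts ?H" "0 < depth v" for v
  proof -
    obtain n e where ve: "v = Tile n e" "e \<in> tiles R (subdivide_n R n X)"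
      using v by (auto simp: history_verts)
    show ?thesis
    proof (cases n)
      case 0
      then show ?thesis using ve by (auto simp: parent_def history_graph_def Let_def gverts_level)
    next
      case (Suc k)
      then obtain d where d: "d \<in> tiles R (subdivide_n R k X)" "e \<subseteq> d" "parent R X v = Tile k d"
        using parent_exists[of e k] ve by metis
      then show ?thesis using ve Suc
        by (auto simp: history_graph_def Let_def gverts_level simp del: funpow.simps)
    qed
  qed
  show "u = v" if "u \<in> gverts ?H" "v \<in> gverts ?H" "depth u = 0" "depth v = 0" for u v
    using that by (cases u; cases v) auto
  show "depth u = depth v \<or> u = parent R X v \<and> 0 < depth v"
    if "(u, v) \<in> gedges ?H" "depth u \<le> depth v" for u v
    using that(1)
  proof (cases rule: history_edge_cases)
    case (up n d e)
    then show ?thesis using parent_Tile[of e n d] by simp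
  next
    case (start e)
    then show ?thesis by (simp add: parent_def)
  qed (use that in auto)
  show "parent R X u = parent R X v \<or> (parent R X u, parent R X v) \<in> gedges ?H"
    if "(u, v) \<in> gedges ?H" "depth u = depth v" "0 < depth v" for u v
    using that(1)
  proof (cases rule: history_edge_cases)
    case (horizontal n d e)
    show ?thesis
    proof (cases n)
      case 0
      then show ?thesis using horizontal by (simp add: parent_def)
    next
      case (Suc k)
      have de: "(d, e) \<in> gedges (dual_graph R (subdivide R (subdivide_n R k X)))"
        using horizontal(3) unfolding Suc level_graph_Suc .
      then have "d \<in> tiles R (subdivide_n R (Suc k) X)" "e \<in> tiles R (subdivide_n R (Suc k) X)"
        using dual_edges(1) by auto
      then obtain P Q where P: "P \<in> tiles R (subdivide_n R k X)" "d \<subseteq> P" "parent R X u = Tile k P"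
        and Q: "Q \<in> tiles R (subdivide_n R k X)" "e \<subseteq> Q" "parent R X v = Tile k Q"
        using parent_exists[of d k] parent_exists[of e k] horizontal(1,2) Suc by metis
      show ?thesis
      proof (cases "P = Q")
        case False
        have "(P, Q) \<in> gedges (level_graph R X k)"
          using adjacent_tile_parents[OF R charted_subdivide_n[OF R X] de P(1,2) Q(1,2) False]
          by (simp add: level_graph_def)
        then show ?thesis unfolding P(3) Q(3) history_edge_horizontal by simp
      qed (use P Q in simp)
    qed
  qed (use that in auto)
qed

text \<open>The level of a vertex is its distance from the origin, so a geodesic that starts at the origin climbs one
  level at each step and is a vertical ray.\<close>

lemma anc_on_geodesic:
  assumes g: "biinfinite_geodesic (history_graph R X) \<gamma>" and g0: "\<gamma> 0 = Origin"
    and s: "s = 1 \<or> s = -1"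
  shows "depth (\<gamma> (s * int i)) = i"
    "l \<le> i \<Longrightarrow> leveled_graph.anc depth (parent R X) l (\<gamma> (s * int i)) = \<gamma> (s * int l)"
proof -
  let ?H = "history_graph R X"
  interpret leveled_graph "gverts ?H" "gedges ?H" depth "parent R X" by (rule leveled_history)
  have geodesic_line: "geodesic_line (gverts ?H) (gedges ?H) \<gamma>" using g biinfinite_geodesic_line[OF history_sub] by blast
  have V: "\<gamma> j \<in> gverts ?H" for j using g by (auto simp: biinfinite_geodesic_def)
  have dep: "depth (\<gamma> (s * int i)) = i" for i
  proof -
    have near_iff: "near n Origin (\<gamma> (s * int i)) \<longleftrightarrow> i \<le> n" for n
    proof -
      have "nat \<bar>0 - s * int i\<bar> = i" using s by auto
      then show ?thesis
        using geodesic_line g0 unfolding geodesic_line_def by (metis not_le reach_le)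
    qed
    have O: "Origin \<in> gverts ?H" using V[of 0] g0 by simp
    have "near (depth (\<gamma> (s * int i))) Origin (\<gamma> (s * int i))"
      by (rule origin_near[OF O _ V]) simp
    then have "i \<le> depth (\<gamma> (s * int i))" using near_iff by simp
    moreover have "near i Origin (\<gamma> (s * int i))" using near_iff by simp
    then have "depth (\<gamma> (s * int i)) \<le> depth (Origin :: 'x history_vertex) + i" by (rule near_lev(1))
    ultimately show ?thesis by simp
  qed
  show "depth (\<gamma> (s * int i)) = i" by (rule dep)
  have par_step: "parent R X (\<gamma> (s * int (Suc j))) = \<gamma> (s * int j)" for j
  proof -
    have dist: "nat \<bar>s * int j - s * int (Suc j)\<bar> = 1" using s by auto
    have "near 1 (\<gamma> (s * int j)) (\<gamma> (s * int (Suc j)))"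
      using geodesic_line dist unfolding geodesic_line_def by metis
    then obtain k where k: "k \<le> 1" "(\<gamma> (s * int j), \<gamma> (s * int (Suc j))) \<in> (gedges ?H \<inter> gverts ?H \<times> gverts ?H) ^^ k"
      by (auto simp: reach_def)
    have "\<gamma> (s * int j) \<noteq> \<gamma> (s * int (Suc j))" using dep[of j] dep[of "Suc j"] by force
    then have "k \<noteq> 0" using k(2) by (intro notI) simp
    then have "k = 1" using k(1) by simp
    then have "(\<gamma> (s * int j), \<gamma> (s * int (Suc j))) \<in> gedges ?H" using k(2) by simp
    then show ?thesis
      using edge_levels[of "\<gamma> (s * int j)" "\<gamma> (s * int (Suc j))"] dep[of j] dep[of "Suc j"] by simp
  qed
  show "anc l (\<gamma> (s * int i)) = \<gamma> (s * int l)" if "l \<le> i"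
  proof -
    have "(parent R X ^^ k) (\<gamma> (s * int (l + k))) = \<gamma> (s * int l)" for k
    proof (induction k)
      case (Suc k)
      have "(parent R X ^^ Suc k) (\<gamma> (s * int (l + Suc k))) = (parent R X ^^ k) (parent R X (\<gamma> (s * int (Suc (l + k)))))"
        by (simp add: funpow_Suc_right del: funpow.simps)
      then show ?case using Suc par_step[of "l + k"] by simp
    qed simp
    from this[of "i - l"] show ?thesis using that dep[of i] by (simp add: anc_def)
  qed
qed

lemma reach_level_graph:
  "reach (gedges (history_graph R X)) {w \<in> gverts (history_graph R X). depth w = Suc n} k (Tile n d) (Tile n e) \<longleftrightarrow>
   reach (gedges (level_graph R X n)) (gverts (level_graph R X n)) k d e"
  (is "reach ?E ?W k _ _ \<longleftrightarrow> reach ?L ?T k d e")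
proof
  assume p: "reach ?E ?W k (Tile n d) (Tile n e)"
  define tile where "tile w = (case w of Tile n e \<Rightarrow> e | Origin \<Rightarrow> {})" for w :: "'x history_vertex"
  have W: "\<exists>a. w = Tile n a \<and> a \<in> ?T" if "w \<in> ?W" for w
    using that by (auto simp: history_verts gverts_level)
  have "reach ?L ?T (1 * k) (tile (Tile n d)) (tile (Tile n e))"
  proof (rule reach_transfer[OF p])
    fix a b assume ab: "a \<in> ?W" "b \<in> ?W" "(a, b) \<in> ?E"
    obtain a' b' where "a = Tile n a'" "a' \<in> ?T" "b = Tile n b'" "b' \<in> ?T" using W ab(1,2) by metis
    then show "reach ?L ?T 1 (tile a) (tile b)"
      using ab(3) by (intro reach_step) (auto simp: tile_def history_edge_horizontal)
  next
    fix a assume "a \<in> ?W"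
    then show "tile a \<in> ?T" using W[of a] by (auto simp: tile_def)
  qed
  then show "reach ?L ?T k d e" by (simp add: tile_def)
next
  assume p: "reach ?L ?T k d e"
  have "reach ?E ?W (1 * k) (Tile n d) (Tile n e)"
  proof (rule reach_transfer[OF p])
    fix a b assume "a \<in> ?T" "b \<in> ?T" "(a, b) \<in> ?L"
    then show "reach ?E ?W 1 (Tile n a) (Tile n b)"
      by (intro reach_step) (auto simp: history_edge_horizontal history_verts gverts_level)
  qed (auto simp: history_verts gverts_level)
  then show "reach ?E ?W k (Tile n d) (Tile n e)" by simp
qed

end

theorem theorem6:
  fixes R :: "'s subdivision_rule"
    and X :: "('x, 's) rcomplex"
    and G :: "('g, 'b) monoid_scheme"
    and A :: "'g set"
  assumes "finite_subdivision_rule R"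
    and "r_complex R X"
    and "group G"
    and "finite_generating_set G A"
    and "associated R X G A"
  shows "divergence (cayley_graph G A) \<preceq>\<^sub>d diam_level R X \<and>
         ((\<exists>\<gamma>. realizes_diameter R X \<gamma>) \<longrightarrow>
            diam_level R X \<preceq>\<^sub>d divergence (cayley_graph G A))"
proof -
  note R = assms(1) and X = assms(2) and G = assms(3)
  have A: "finite A" "A \<subseteq> carrier G" "generate G A = carrier G"
    using assms(4) by (auto simp: finite_generating_set_def)
  let ?H = "history_graph R X" and ?Y = "cayley_graph G A"
  obtain h C where h: "1 \<le> C" "\<And>v. v \<in> gverts ?H \<Longrightarrow> h v \<in> gverts ?Y"
    "\<And>n u v. reach (gedges ?H) (gverts ?H) n u v \<Longrightarrow> reach (gedges ?Y) (gverts ?Y) (C * n + C) (h u) (h v)"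
    "\<And>n u v. u \<in> gverts ?H \<Longrightarrow> v \<in> gverts ?H \<Longrightarrow> reach (gedges ?Y) (gverts ?Y) n (h u) (h v) \<Longrightarrow>
       reach (gedges ?H) (gverts ?H) (C * n + C) u v"
    "\<And>y. y \<in> gverts ?Y \<Longrightarrow> \<exists>v\<in>gverts ?H. reach (gedges ?Y) (gverts ?Y) C (h v) y"
    by (rule quasi_isometric_reach[OF assms(5)[unfolded associated_def] history_sub[OF R X] cayley_sub]) blast
  interpret combed "gverts ?H" "gedges ?H" depth "parent R X" "gverts ?Y" "gedges ?Y" h C
  proof (intro combed.intro combed_axioms.intro leveled_history[OF R X] cayley_sub cayley_sym h)
    show "\<exists>\<phi> \<psi>. automorphism (gverts ?Y) (gedges ?Y) \<phi> \<psi> \<and> \<phi> x = y" if "x \<in> gverts ?Y" "y \<in> gverts ?Y" for x y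
      using cayley_homogeneous[OF G A(2)] that by simp
    show "finite {y. (x, y) \<in> gedges ?Y}" if "x \<in> gverts ?Y" for x
      using cayley_locally_finite[OF G A(1,2)] that by (simp del: cayley_simps(2))
    show "\<exists>n. reach (gedges ?Y) (gverts ?Y) n x y" if "x \<in> gverts ?Y" "y \<in> gverts ?Y" for x y
      using cayley_connected[OF G A(2,3)] that by simp
  qed
  have O: "Origin \<in> gverts ?H" "depth (Origin :: 'x history_vertex) = 0" by (auto simp: history_verts)
  have level_sub: "gedges (level_graph R X n) \<subseteq> gverts (level_graph R X n) \<times> gverts (level_graph R X n)" for n
    using dual_edges(1) unfolding level_graph_def by (fastforce simp: dual_graph_def)
  have "divergence ?Y \<preceq>\<^sub>d diam_level R X"
  proof -
    obtain a where "\<forall>n \<beta> F D. geodesic_line (gverts ?Y) (gedges ?Y) \<beta> \<longrightarrow>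
       \<not> reach (gedges ?Y) (outside_ball (gverts ?Y) (gedges ?Y) (\<beta> 0) n) F (\<beta> (- int n)) (\<beta> (int n)) \<longrightarrow>
       (\<forall>u\<in>gverts ?H. \<forall>w\<in>gverts ?H. depth u = a * n + a + 1 \<longrightarrow> depth w = a * n + a + 1 \<longrightarrow>
          reach (gedges ?H) {w \<in> gverts ?H. depth w = a * n + a + 1} D u w) \<longrightarrow>
       F < D + (a * n + a)"
      using line_divergence_bound[OF O] by (elim exE)
    note a = this[rule_format]
    have "divergence ?Y n \<le> diam_level R X (a * n + a) + enat (a * n + a)" for n
    proof (cases "diam_level R X (a * n + a)")
      case (enat D)
      have D: "reach (gedges ?H) {w \<in> gverts ?H. depth w = a * n + a + 1} D u w"
        if uw: "u \<in> gverts ?H" "w \<in> gverts ?H" "depth u = a * n + a + 1" "depth w = a * n + a + 1" for u w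
      proof -
        let ?L = "level_graph R X (a * n + a)"
        obtain d e where de: "u = Tile (a * n + a) d" "w = Tile (a * n + a) e" "d \<in> gverts ?L" "e \<in> gverts ?L"
          using uw by (auto simp: history_verts gverts_level)
        have "gdist ?L d e \<le> gdiam ?L"
          unfolding gdiam_def using de(3,4) by (meson SUP_upper order_trans)
        then have "gdist ?L d e \<le> enat D" using enat by (simp add: diam_level_def)
        then show ?thesis
          using gdist_le_reach[OF level_sub de(3)] reach_level_graph[OF R X, of "a * n + a" D d e] de(1,2) by simp
      qed
      have "geodesic_divergence ?Y \<beta> n \<le> enat (D + (a * n + a))" if \<beta>: "biinfinite_geodesic ?Y \<beta>" for \<beta>
      proof (rule ccontr)
        assume "\<not> ?thesis"
        then have sep: "\<not> reach (gedges ?Y) (outside_ball (gverts ?Y) (gedges ?Y) (\<beta> 0) n) (D + (a * n + a)) (\<beta> (- int n)) (\<beta> (int n))"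
          using geodesic_divergence_le[OF cayley_sub \<beta>] by blast
        have "geodesic_line (gverts ?Y) (gedges ?Y) \<beta>" using \<beta> biinfinite_geodesic_line[OF cayley_sub] by blast
        from a[OF this sep D] have "D + (a * n + a) < D + (a * n + a)" by simp
        then show False by simp
      qed
      then have "divergence ?Y n \<le> enat (D + (a * n + a))"
        unfolding divergence_def by (intro SUP_least) simp
      then show ?thesis using enat by simp
    qed simp
    then show ?thesis unfolding asymp_le_def by blast
  qed
  moreover have "diam_level R X \<preceq>\<^sub>d divergence ?Y" if \<gamma>: "realizes_diameter R X \<gamma>" for \<gamma>
  proof -
    have geo: "biinfinite_geodesic ?H \<gamma>" and \<gamma>0: "\<gamma> 0 = Origin"
      using \<gamma> by (auto simp: realizes_diameter_def)
    note dep = anc_on_geodesic(1)[OF R X geo \<gamma>0] and anc_\<gamma> = anc_on_geodesic(2)[OF R X geo \<gamma>0]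
    obtain a where "\<forall>n F. (\<forall>T>n. \<exists>u\<in>gverts ?H. \<exists>w\<in>gverts ?H. depth u = T \<and> depth w = T \<and>
        \<not> reach (gedges ?H) {w \<in> gverts ?H. depth w = n + 1} F (anc (n + 1) u) (anc (n + 1) w)) \<longrightarrow>
     F < a * n + a \<or> (\<exists>\<beta>. geodesic_line (gverts ?Y) (gedges ?Y) \<beta> \<and>
       (\<forall>l. reach (gedges ?Y) (outside_ball (gverts ?Y) (gedges ?Y) (\<beta> 0) (a * n + a)) l (\<beta> (- int (a * n + a))) (\<beta> (int (a * n + a)))
          \<longrightarrow> F < l + (a * n + a)))"
      using level_distance_bound[OF O] by (elim exE)
    note a = mp[OF this[THEN spec, THEN spec]]
    have "diam_level R X n \<le> divergence ?Y (a * n + a) + enat (a * n + a)" for n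
    proof (rule ccontr)
      let ?N = "a * n + a"
      assume "\<not> ?thesis"
      then have lt: "divergence ?Y ?N + enat ?N < diam_level R X n" by simp
      then obtain l where l: "divergence ?Y ?N = enat l" by (cases "divergence ?Y ?N") auto
      obtain d e where de: "Tile n d \<in> \<gamma> ` {0<..}" "Tile n e \<in> \<gamma> ` {..<0}"
        "gdist (level_graph R X n) d e = diam_level R X n"
        using \<gamma> unfolding realizes_diameter_def by meson
      obtain i where i: "0 < i" "\<gamma> i = Tile n d" using de(1) by auto
      obtain j where j: "j < 0" "\<gamma> j = Tile n e" using de(2) by auto
      have "nat i = Suc n" using dep[of 1 "nat i"] i by simp
      then have i': "\<gamma> (1 * int (n + 1)) = Tile n d" using i by (metis Suc_eq_plus1 int_nat_eq mult_1 order_less_imp_le)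
      have "nat (- j) = Suc n" using dep[of "-1" "nat (- j)"] j by simp
      then have "-1 * int (n + 1) = j" using j(1) by simp
      then have j': "\<gamma> (-1 * int (n + 1)) = Tile n e" using j(2) by simp
      have V: "\<gamma> i \<in> gverts ?H" for i using geo by (auto simp: biinfinite_geodesic_def)
      have dV: "d \<in> gverts (level_graph R X n)" using V[of i] i(2) by (auto simp: history_verts gverts_level)
      have "\<not> gdist (level_graph R X n) d e \<le> enat (l + ?N)" using lt l de(3) by simp
      then have sep: "\<not> reach (gedges ?H) {w \<in> gverts ?H. depth w = n + 1} (l + ?N) (Tile n d) (Tile n e)"
        using gdist_le_reach[OF level_sub dV] reach_level_graph[OF R X, of n "l + ?N" d e] by simp
      have pair: "\<exists>u\<in>gverts ?H. \<exists>w\<in>gverts ?H. depth u = T \<and> depth w = T \<and>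
        \<not> reach (gedges ?H) {w \<in> gverts ?H. depth w = n + 1} (l + ?N) (anc (n + 1) u) (anc (n + 1) w)" if "n < T" for T
      proof (intro bexI conjI)
        show "depth (\<gamma> (1 * int T)) = T" "depth (\<gamma> (-1 * int T)) = T" by (rule dep, simp)+
        have "anc (n + 1) (\<gamma> (1 * int T)) = Tile n d" "anc (n + 1) (\<gamma> (-1 * int T)) = Tile n e"
          using anc_\<gamma>[of 1 "n + 1" T] anc_\<gamma>[of "-1" "n + 1" T] that i' j' by auto
        then show "\<not> reach (gedges ?H) {w \<in> gverts ?H. depth w = n + 1} (l + ?N)
            (anc (n + 1) (\<gamma> (1 * int T))) (anc (n + 1) (\<gamma> (-1 * int T)))"
          using sep by simp
      qed (rule V)+
      have "l + ?N < ?N \<or> (\<exists>\<beta>. geodesic_line (gverts ?Y) (gedges ?Y) \<beta> \<and>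
         (\<forall>k. reach (gedges ?Y) (outside_ball (gverts ?Y) (gedges ?Y) (\<beta> 0) ?N) k (\<beta> (- int ?N)) (\<beta> (int ?N))
            \<longrightarrow> l + ?N < k + ?N))"
        by (rule a) (use pair in simp)
      then obtain \<beta> where \<beta>: "geodesic_line (gverts ?Y) (gedges ?Y) \<beta>"
        "\<And>k. reach (gedges ?Y) (outside_ball (gverts ?Y) (gedges ?Y) (\<beta> 0) ?N) k (\<beta> (- int ?N)) (\<beta> (int ?N)) \<Longrightarrow> l + ?N < k + ?N"
        by auto
      have geo\<beta>: "biinfinite_geodesic ?Y \<beta>" using \<beta>(1) biinfinite_geodesic_line[OF cayley_sub] by blast
      then have "geodesic_divergence ?Y \<beta> ?N \<le> divergence ?Y ?N"
        unfolding divergence_def by (intro SUP_upper) simp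
      then have "reach (gedges ?Y) (outside_ball (gverts ?Y) (gedges ?Y) (\<beta> 0) ?N) l (\<beta> (- int ?N)) (\<beta> (int ?N))"
        using geodesic_divergence_le[OF cayley_sub geo\<beta>] l by metis
      then show False using \<beta>(2) by blast
    qed
    then show ?thesis unfolding asymp_le_def by blast
  qed
  ultimately show ?thesis by blast
qed

end
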